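(* Let $N\in\mathbb N$, $\alpha\in(0,N)$, $p\ge1$ and $q\in[1,+\infty)$. The embedding $E^{\alpha,p}(\mathbb R^N)\subset L^q_{\mathrm{loc}}(\mathbb R^N)$ is compact if and only if $$\frac1q>\min\Bigl\{\frac12-\frac1N,\ \frac1p,\ \frac{2+\alpha}{2(2p+\alpha)}\Bigr\}.$$
   Context: $\mathbb N$ denotes the positive integers. For $\alpha\in(0,N)$ the Riesz potential is $I_\alpha(x)=A_\alpha|x|^{-(N-\alpha)}$ for $x\in\mathbb R^N\setminus\{0\}$, with $A_\alpha=\frac{\Gamma((N-\alpha)/2)}{\Gamma(\alpha/2)\pi^{N/2}2^\alpha}$. For $p\ge1$, the Coulomb--Sobolev space $E^{\alpha,p}(\mathbb R^N)$ is the vector space of (a.e. classes of) measurable functions $u:\mathbb R^N\to\mathbb R$ with $\int_{\mathbb R^N}|I_{\alpha/2}*|u|^p|^2<\infty$ that are weakly differentiable with $Du\in L^2(\mathbb R^N)$, normed by $$\|u\|_{E^{\alpha,p}}=\Bigl(\int_{\mathbb R^N}|Du|^2+\Bigl(\int_{\mathbb R^N}\bigl|I_{\alpha/2}*|u|^p\bigr|^2\Bigr)^{1/p}\Bigr)^{1/2}.$$ Compactness of the embedding into $L^q_{\mathrm{loc}}$ means that $E^{\alpha,p}(\mathbb R^N)\subset L^q_{\mathrm{loc}}(\mathbb R^N)$ and every bounded sequence in $E^{\alpha,p}(\mathbb R^N)$ has a subsequence converging in $L^q(K)$ for every compact $K\subset\mathbb R^N$. *)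

theory Defs
  imports "HOL-Analysis.Analysis"
begin

text \<open>
  The Euclidean space $R^N$ is an arbitrary type \<open>'a :: euclidean_space\<close>, with $N$ = \<open>DIM('a)\<close>.
  Elements of function spaces are represented by functions; the measurability, integrability,
  norm and convergence notions below do not distinguish functions that agree almost everywhere.
\<close>

subsection \<open>Riesz potential\<close>

definition riesz_const :: "nat \<Rightarrow> real \<Rightarrow> real" where
  "riesz_const N \<alpha> = Gamma ((real N - \<alpha>) / 2) / (Gamma (\<alpha> / 2) * pi powr (real N / 2) * 2 powr \<alpha>)"

text \<open>At the origin, where the kernel is mathematically undefined, this takes the value $0$
  because \<open>0 powr a = 0\<close>; the convolution below is not affected.\<close>

definition riesz_kernel :: "real \<Rightarrow> 'a::euclidean_space \<Rightarrow> real" where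
  "riesz_kernel \<alpha> x = riesz_const DIM('a) \<alpha> * norm x powr (- (real DIM('a) - \<alpha>))"

text \<open>Convolution with a nonnegative density, so that the value $\infty$ is allowed.\<close>

definition riesz_potential :: "real \<Rightarrow> ('a::euclidean_space \<Rightarrow> real) \<Rightarrow> 'a \<Rightarrow> ennreal" where
  "riesz_potential \<alpha> f x = (\<integral>\<^sup>+ y. ennreal (riesz_kernel \<alpha> (x - y) * f y) \<partial>lebesgue)"

definition coulomb_energy :: "real \<Rightarrow> real \<Rightarrow> ('a::euclidean_space \<Rightarrow> real) \<Rightarrow> ennreal" where
  "coulomb_energy \<alpha> p u =
     (\<integral>\<^sup>+ x. (riesz_potential (\<alpha> / 2) (\<lambda>y. \<bar>u y\<bar> powr p) x)\<^sup>2 \<partial>lebesgue)"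

subsection \<open>Weak derivatives\<close>

primrec Ck :: "nat \<Rightarrow> ('a::euclidean_space \<Rightarrow> real) \<Rightarrow> bool" where
  "Ck 0 f \<longleftrightarrow> continuous_on UNIV f"
| "Ck (Suc k) f \<longleftrightarrow>
     (\<forall>x. f differentiable (at x)) \<and> (\<forall>v. Ck k (\<lambda>x. frechet_derivative f (at x) v))"

definition test_function :: "('a::euclidean_space \<Rightarrow> real) \<Rightarrow> bool" where
  "test_function \<phi> \<longleftrightarrow> (\<forall>k. Ck k \<phi>) \<and> compact (closure {x. \<phi> x \<noteq> 0})"

definition locally_integrable :: "('a::euclidean_space \<Rightarrow> 'b::euclidean_space) \<Rightarrow> bool" where
  "locally_integrable f \<longleftrightarrow> (\<forall>K. compact K \<longrightarrow> f absolutely_integrable_on K)"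

definition has_weak_gradient ::
    "('a::euclidean_space \<Rightarrow> real) \<Rightarrow> ('a \<Rightarrow> 'a) \<Rightarrow> bool" where
  "has_weak_gradient u g \<longleftrightarrow>
     locally_integrable u \<and> locally_integrable g \<and>
     (\<forall>\<phi>. test_function \<phi> \<longrightarrow> (\<forall>b\<in>Basis.
        (LINT x|lebesgue. u x * frechet_derivative \<phi> (at x) b)
          = - (LINT x|lebesgue. (g x \<bullet> b) * \<phi> x)))"

definition weakly_differentiable :: "('a::euclidean_space \<Rightarrow> real) \<Rightarrow> bool" where
  "weakly_differentiable u \<longleftrightarrow> (\<exists>g. has_weak_gradient u g)"

text \<open>The weak gradient is unique up to null sets; any choice gives the same integrals below.\<close>

definition weak_gradient :: "('a::euclidean_space \<Rightarrow> real) \<Rightarrow> 'a \<Rightarrow> 'a" where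
  "weak_gradient u = (SOME g. has_weak_gradient u g)"

subsection \<open>Coulomb--Sobolev space\<close>

definition coulomb_sobolev :: "real \<Rightarrow> real \<Rightarrow> ('a::euclidean_space \<Rightarrow> real) set" where
  "coulomb_sobolev \<alpha> p =
     {u. u \<in> borel_measurable lebesgue \<and> coulomb_energy \<alpha> p u < \<infinity> \<and>
         weakly_differentiable u \<and> integrable lebesgue (\<lambda>x. (norm (weak_gradient u x))\<^sup>2)}"

definition coulomb_sobolev_norm ::
    "real \<Rightarrow> real \<Rightarrow> ('a::euclidean_space \<Rightarrow> real) \<Rightarrow> real" where
  "coulomb_sobolev_norm \<alpha> p u =
     sqrt ((LINT x|lebesgue. (norm (weak_gradient u x))\<^sup>2)
           + enn2real (coulomb_energy \<alpha> p u) powr (1 / p))"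

subsection \<open>Compact embeddings into local Lebesgue spaces\<close>

definition Lq_on :: "real \<Rightarrow> 'a::euclidean_space set \<Rightarrow> ('a \<Rightarrow> real) set" where
  "Lq_on q K = {f. f \<in> borel_measurable (lebesgue_on K) \<and>
                   integrable (lebesgue_on K) (\<lambda>x. \<bar>f x\<bar> powr q)}"

definition Lq_norm :: "real \<Rightarrow> 'a::euclidean_space set \<Rightarrow> ('a \<Rightarrow> real) \<Rightarrow> real" where
  "Lq_norm q K f = (LINT x|lebesgue_on K. \<bar>f x\<bar> powr q) powr (1 / q)"

definition Lq_loc :: "real \<Rightarrow> ('a::euclidean_space \<Rightarrow> real) set" where
  "Lq_loc q = {f. f \<in> borel_measurable lebesgue \<and> (\<forall>K. compact K \<longrightarrow> f \<in> Lq_on q K)}"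

definition converges_in_Lq ::
    "real \<Rightarrow> 'a::euclidean_space set \<Rightarrow> (nat \<Rightarrow> 'a \<Rightarrow> real) \<Rightarrow> bool" where
  "converges_in_Lq q K u \<longleftrightarrow>
     (\<exists>v\<in>Lq_on q K. (\<lambda>n. Lq_norm q K (\<lambda>x. u n x - v x)) \<longlonglongrightarrow> 0)"

text \<open>The subsequence is chosen once, independently of the compact set.\<close>

definition compactly_embedded_Lq_loc ::
    "('a::euclidean_space \<Rightarrow> real) set \<Rightarrow> (('a \<Rightarrow> real) \<Rightarrow> real) \<Rightarrow> real \<Rightarrow> bool" where
  "compactly_embedded_Lq_loc E nrm q \<longleftrightarrow>
     E \<subseteq> Lq_loc q \<and>
     (\<forall>u. (\<forall>n::nat. u n \<in> E) \<and> (\<exists>B. \<forall>n. nrm (u n) \<le> B) \<longrightarrow>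
        (\<exists>r. strict_mono (r::nat \<Rightarrow> nat) \<and>
             (\<forall>K. compact K \<longrightarrow> converges_in_Lq q K (\<lambda>n. u (r n)))))"

end

theory Submission
  imports Defs "HOL-Complex_Analysis.Great_Picard"
begin

text \<open>
  Write $A_j u$ for the function that replaces $u$ by its mean on each dyadic cube of side
  $2^{-j}$. Everything in the direct half rests on two pointwise inequalities for these averages.
  For a function with weak gradient $g$,
  $|A_{j+1}u - A_j u| \le C 2^{-j} A_j|g|$ (\<open>avg_increment_le\<close>): the difference of the means of
  $u$ on the two halves of a box is the integral of $u$ against the derivative of a tent function,
  so it is controlled by the integral of $|g|$ over the box. Moreover
  $A_j(|u|^p) \le C 2^{j\alpha/2} I_{\alpha/2}*|u|^p$ (\<open>navg_le_riesz_potential\<close>), since the Riesz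
  kernel is at least a multiple of $2^{j(N-\alpha/2)}$ inside a cube of side $2^{-j}$.

  With $E$ the Coulomb energy, the increments $\Delta_j = A_{j+1}u-A_ju$ hence satisfy
  $\|\Delta_j\|_2 \le C 2^{-j}\|Du\|_2$, $\|\Delta_j\|_\infty \le C 2^{-j}2^{jN/2}\|Du\|_2$,
  $\|\Delta_j\|_{2p}^{2p} \le C 2^{j\alpha}E$, and are bounded in $L^p$ on bounded sets. Interpolating the $L^2$
  estimate with each of the other three gives geometric decay of $\Delta_j$ in $L^q$ on bounded sets for
  $1/q$ above $1/2-1/N$, $(2+\alpha)/(2(2p+\alpha))$ and $1/p$, respectively (for $q\le 2$ the $L^2$ estimate
  suffices); this is \<open>increments_Lq_decay\<close>. Since $A_ju\to u$ almost everywhere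
  (\<open>AE_avg_tendsto\<close>), $u-A_ju$ is small in $L^q$ on bounded sets, uniformly over bounded sets of
  the Coulomb--Sobolev space, while for fixed $j$ the values of $A_ju$ are bounded and a diagonal
  subsequence makes all of them converge. This proves compactness
  (\<open>compactly_embedded_of_subcritical\<close>).

  For the converse, place about $r^{-(N-d)}$ disjoint bumps of radius $r$ and height $r^{-d/q}$ on a
  lattice in a fixed cube. Their $L^q$ norm stays bounded below while their supports, of measure
  about $r^d$, shrink to null sets, so no subsequence converges in $L^q$. The Dirichlet integral is
  of order $r^{d-2-2d/q}$ and the Coulomb energy of order $r^{d+\alpha-2pd/q}+r^{2(d-pd/q)}$, the two
  terms being the self-energies of the bumps and their interactions
  (\<open>coulomb_energy_le_sup\<close>, \<open>separated_potential_bound\<close>). All three exponents are nonnegative when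
  $1/q\le 1/2-1/d$, $1/q\le (d+\alpha)/(2pd)$ and $1/q\le 1/p$. A single bump, $d=N$, serves for
  $p\le (N+\alpha)/(N-2)$; for larger $p$ the choice $d=(2p+\alpha)/(p-1)<N$ makes the first two bounds both equal to
  $(2+\alpha)/(2(2p+\alpha))$.
\<close>

section \<open>Smooth functions and plateau functions\<close>

lemma Ck_differentiable: "Ck (Suc k) f \<Longrightarrow> f differentiable (at x)"
  by simp

lemma Ck_has_derivative: "Ck (Suc k) f \<Longrightarrow> (f has_derivative frechet_derivative f (at x)) (at x)"
  using Ck_differentiable frechet_derivative_works by blast

lemma Ck_decrease: "Ck (Suc k) f \<Longrightarrow> Ck k f"
proof (induction k arbitrary: f)
  case 0
  then show ?case
    by (auto simp: continuous_on_eq_continuous_at intro: differentiable_imp_continuous_within)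
next
  case (Suc k)
  have 1: "f differentiable (at x)" for x
    using Suc.prems by simp
  have 2: "Ck k (\<lambda>x. frechet_derivative f (at x) v)" for v
    by (rule Suc.IH) (use Suc.prems in simp)
  show ?case
    using 1 2 by simp
qed

lemma Ck_SucI:
  assumes "\<And>x. (f has_derivative f' x) (at x)" and "\<And>v. Ck k (\<lambda>x. f' x v)"
  shows "Ck (Suc k) f"
proof -
  have "frechet_derivative f (at x) = f' x" for x
    using assms(1) frechet_derivative_at by metis
  moreover have "f differentiable (at x)" for x
    using assms(1) differentiable_def by blast
  ultimately show ?thesis
    using assms(2) by simp
qed

lemma Ck_const [simp]: "Ck k (\<lambda>x. c)"
proof (induction k arbitrary: c)
  case (Suc k)
  show ?case
    by (rule Ck_SucI[where f'="\<lambda>x v. 0"]) (use Suc in \<open>auto intro!: derivative_eq_intros\<close>)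
qed simp

lemma Ck_add: "Ck k f \<Longrightarrow> Ck k g \<Longrightarrow> Ck k (\<lambda>x. f x + g x)"
proof (induction k arbitrary: f g)
  case 0
  then show ?case by (simp add: continuous_on_add)
next
  case (Suc k)
  show ?case
    by (rule Ck_SucI[where f'="\<lambda>x v. frechet_derivative f (at x) v + frechet_derivative g (at x) v"])
       (use Suc.prems in \<open>auto intro!: Suc.IH has_derivative_add Ck_has_derivative\<close>)
qed

lemma Ck_mult: "Ck k f \<Longrightarrow> Ck k g \<Longrightarrow> Ck k (\<lambda>x. f x * g x)"
proof (induction k arbitrary: f g)
  case 0
  then show ?case by (simp add: continuous_on_mult)
next
  case (Suc k)
  show ?case
  proof (rule Ck_SucI)
    show "((\<lambda>x. f x * g x) has_derivative
        (\<lambda>v. f x * frechet_derivative g (at x) v + frechet_derivative f (at x) v * g x)) (at x)" for x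
      by (intro has_derivative_mult Ck_has_derivative[OF Suc.prems(1)] Ck_has_derivative[OF Suc.prems(2)])
    show "Ck k (\<lambda>x. f x * frechet_derivative g (at x) v + frechet_derivative f (at x) v * g x)" for v
      using Suc.prems Ck_decrease[OF Suc.prems(1)] Ck_decrease[OF Suc.prems(2)]
      by (auto intro!: Ck_add Suc.IH)
  qed
qed

lemma Ck_prod: "(\<And>i. i \<in> I \<Longrightarrow> Ck k (f i)) \<Longrightarrow> Ck k (\<lambda>x. \<Prod>i\<in>I. f i x)"
  by (induction I rule: infinite_finite_induct) (auto intro: Ck_mult)

lemma Ck_diff: "Ck k f \<Longrightarrow> Ck k g \<Longrightarrow> Ck k (\<lambda>x. f x - g x)"
  using Ck_add[of k f "\<lambda>x. (-1) * g x"] Ck_mult[of k "\<lambda>_. -1" g] by simp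

lemma Ck_inner_left: "Ck k (\<lambda>x. x \<bullet> c)"
proof (cases k)
  case (Suc n)
  show ?thesis unfolding Suc
    by (rule Ck_SucI[where f'="\<lambda>x v. v \<bullet> c"]) (auto intro!: derivative_eq_intros)
qed (auto intro!: continuous_intros)

text \<open>
  The derivative of $F\circ h$ is $(F'\circ h)\,Dh$; the induction on $k$ runs over all $F$ at once,
  so that it applies to $F'$.
\<close>

lemma Ck_compose:
  fixes F :: "real \<Rightarrow> real"
  shows "Ck k F \<Longrightarrow> Ck k h \<Longrightarrow> Ck k (\<lambda>x. F (h x))"
proof (induction k arbitrary: F)
  case 0
  then show ?case
    by (auto intro!: continuous_on_compose2[of UNIV F])
next
  case (Suc k)
  have lin: "frechet_derivative F (at y) r = r * frechet_derivative F (at y) 1" for y r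
    using linear_cmul[OF linear_frechet_derivative[of F "at y"], of r 1] Suc.prems(1) by simp
  show ?case
  proof (rule Ck_SucI)
    show "((\<lambda>x. F (h x)) has_derivative
        (\<lambda>v. frechet_derivative h (at x) v * frechet_derivative F (at (h x)) 1)) (at x)" for x
      using has_derivative_compose[OF Ck_has_derivative[OF Suc.prems(2)] Ck_has_derivative[OF Suc.prems(1)], of x]
      unfolding lin[of _ "frechet_derivative h (at x) v" for v] .
    show "Ck k (\<lambda>x. frechet_derivative h (at x) v * frechet_derivative F (at (h x)) 1)" for v
      by (rule Ck_mult, use Suc.prems in simp)
         (rule Suc.IH, use Suc.prems Ck_decrease[OF Suc.prems(2)] in simp_all)
  qed
qed

lemma Ck_Suc_real:
  fixes F :: "real \<Rightarrow> real"
  assumes "\<And>x. (F has_real_derivative f x) (at x)" and "Ck k f"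
  shows "Ck (Suc k) F"
  by (rule Ck_SucI[where f'="\<lambda>x v. f x * v"])
     (use assms in \<open>auto simp: has_field_derivative_def intro!: Ck_mult\<close>)

lemma Ck_exp: "Ck k (exp :: real \<Rightarrow> real)"
proof (induction k)
  case (Suc k)
  then show ?case by (intro Ck_Suc_real[where f=exp]) (auto intro!: derivative_eq_intros)
qed (auto intro!: continuous_intros)

text \<open>
  For $m=0$ this is the standard smooth function that vanishes to infinite order at the origin; the
  family over $m$ spans all its derivatives, which turns smoothness into one induction.
\<close>

definition flat :: "nat \<Rightarrow> real \<Rightarrow> real" where
  "flat m t = (if t > 0 then exp (- (1 / t)) / t ^ m else 0)"

text \<open>
  From $(1+x/n)^n\le e^x$ with $x=1/t$ and $n=m+2$. A quadratic bound is what differentiability at the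
  origin, with derivative $0$, needs.
\<close>

lemma flat_le_square:
  "\<bar>flat m t\<bar> \<le> real (m + 2) ^ (m + 2) * t\<^sup>2"
proof (cases "t > 0")
  case True
  define n where "n = m + 2"
  have n: "n > 0" by (simp add: n_def)
  have "(1 / (real n * t)) ^ n \<le> (1 + (1 / t) / real n) ^ n"
    using True n by (intro power_mono) (auto simp: field_simps)
  also have "\<dots> \<le> exp (1 / t)"
    using True n by (intro exp_ge_one_plus_x_over_n_power_n) (auto intro: order_trans[of _ 0])
  finally have "1 / (real n ^ n * t ^ n) \<le> exp (1 / t)"
    by (simp add: power_divide power_mult_distrib)
  then have "exp (- (1 / t)) \<le> real n ^ n * t ^ n"
    using True n by (simp add: exp_minus field_simps)
  also have "\<dots> = real n ^ n * t\<^sup>2 * t ^ m"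
    by (simp add: n_def power_add power2_eq_square)
  finally have "exp (- (1 / t)) / t ^ m \<le> real n ^ n * t\<^sup>2"
    using True by (simp add: field_simps)
  then show ?thesis
    using True by (simp add: flat_def n_def)
qed (simp add: flat_def)

lemma has_derivative_zero_of_square_bound:
  fixes f :: "real \<Rightarrow> real"
  assumes "\<And>t. \<bar>f t\<bar> \<le> C * t\<^sup>2"
  shows "(f has_real_derivative 0) (at 0)"
proof -
  have f0: "f 0 = 0" using assms[of 0] by simp
  have "((\<lambda>h. f h / h) \<longlongrightarrow> 0) (at 0)"
  proof (rule Lim_null_comparison)
    show "\<forall>\<^sub>F h in at 0. norm (f h / h) \<le> C * \<bar>h\<bar>"
      unfolding eventually_at
    proof (intro exI[of _ 1] conjI ballI impI)
      fix h :: real assume h: "h \<noteq> 0 \<and> dist h 0 < 1"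
      have "\<bar>f h\<bar> \<le> C * \<bar>h\<bar> * \<bar>h\<bar>"
        using assms[of h] by (simp add: power2_eq_square mult.assoc flip: abs_mult)
      then show "norm (f h / h) \<le> C * \<bar>h\<bar>"
        using h by (simp add: field_simps)
    qed simp
    show "((\<lambda>h. C * \<bar>h\<bar>) \<longlongrightarrow> 0) (at 0)"
      by (auto intro!: tendsto_eq_intros)
  qed
  then show ?thesis
    by (simp add: DERIV_def f0)
qed

lemma flat_has_derivative:
  "(flat m has_real_derivative flat (m + 2) t - real m * flat (m + 1) t) (at t)"
proof -
  consider "t > 0" | "t = 0" | "t < 0" by linarith
  then show ?thesis
  proof cases
    case 1
    have "((\<lambda>t. exp (- (1 / t)) / t ^ m) has_real_derivative
        (exp (- (1 / t)) * (1 / (t * t)) * t ^ m - exp (- (1 / t)) * (real m * t ^ (m - 1))) / (t ^ m * t ^ m)) (at t)"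
      using 1 by (intro DERIV_divide) (auto intro!: derivative_eq_intros)
    also have "(exp (- (1 / t)) * (1 / (t * t)) * t ^ m - exp (- (1 / t)) * (real m * t ^ (m - 1))) / (t ^ m * t ^ m)
        = flat (m + 2) t - real m * flat (m + 1) t"
      using 1 by (cases m) (auto simp: flat_def field_simps)
    finally have "((\<lambda>t. exp (- (1 / t)) / t ^ m) has_real_derivative
        flat (m + 2) t - real m * flat (m + 1) t) (at t)" .
    then show ?thesis
      by (rule has_field_derivative_transform_within_open[of _ _ _ "{0<..}"])
         (use 1 in \<open>auto simp: flat_def\<close>)
  next
    case 2
    then show ?thesis
      using has_derivative_zero_of_square_bound[OF flat_le_square, of m] by (auto simp: flat_def[of _ 0])
  next
    case 3
    have "((\<lambda>t. 0) has_real_derivative flat (m + 2) t - real m * flat (m + 1) t) (at t)"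
      using 3 by (auto simp: flat_def)
    then show ?thesis
      by (rule has_field_derivative_transform_within_open[of _ _ _ "{..<0}"])
         (use 3 in \<open>auto simp: flat_def\<close>)
  qed
qed

lemma Ck_flat: "Ck k (flat m)"
proof (induction k arbitrary: m)
  case 0
  show ?case
    using DERIV_isCont[OF flat_has_derivative] by (simp add: continuous_on_eq_continuous_at del: One_nat_def)
next
  case (Suc k)
  show ?case
    by (rule Ck_Suc_real[OF flat_has_derivative]) (intro Ck_diff Ck_mult Ck_const Suc)
qed

text \<open>
  For $n\ge 1$ a smooth function that is positive exactly on $(a,c)$, pushed up towards the indicator function of
  $(a,c)$ as $n\to\infty$.
\<close>

definition plateau :: "real \<Rightarrow> real \<Rightarrow> nat \<Rightarrow> real \<Rightarrow> real" where
  "plateau a c n t = 1 - exp (- (real n * (flat 0 (t - a) * flat 0 (c - t))))"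

lemma flat_nonneg: "flat m t \<ge> 0" and flat_pos_iff: "flat m t > 0 \<longleftrightarrow> t > 0"
  by (auto simp: flat_def)

lemma Ck_plateau: "Ck k (plateau a c n)"
proof -
  have 1: "Ck k (\<lambda>t::real. t - a)" "Ck k (\<lambda>t::real. c - t)" for a c
    using Ck_inner_left[of k "1::real"] by (auto intro!: Ck_diff)
  have "Ck k (\<lambda>t. 1 - exp (0 - (real n * (flat 0 (t - a) * flat 0 (c - t)))))"
    by (intro Ck_diff Ck_const Ck_mult Ck_compose[OF Ck_exp] Ck_compose[OF Ck_flat] 1)
  then show ?thesis
    by (simp add: plateau_def[abs_def])
qed

lemma plateau_range: "0 \<le> plateau a c n t" "plateau a c n t \<le> 1"
  by (auto simp: plateau_def flat_nonneg)

lemma plateau_outside: "t \<le> a \<or> c \<le> t \<Longrightarrow> plateau a c n t = 0"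
  by (auto simp: plateau_def flat_def)

lemma plateau_tendsto: "(\<lambda>n. plateau a c n t) \<longlonglongrightarrow> indicator {a<..<c} t"
proof (cases "a < t \<and> t < c")
  case True
  \<comment> \<open>the plateau function at \<open>t\<close> is \<open>1 - exp (- \<kappa>) ^ n\<close>\<close>
  define \<kappa> where "\<kappa> = flat 0 (t - a) * flat 0 (c - t)"
  have "\<kappa> > 0" using True by (simp add: \<kappa>_def flat_pos_iff)
  have "(\<lambda>n. 1 - exp (- \<kappa>) ^ n) \<longlonglongrightarrow> 1 - 0"
    using \<open>\<kappa> > 0\<close> by (intro tendsto_intros LIMSEQ_power_zero) auto
  moreover have "exp (- \<kappa>) ^ n = exp (- (real n * \<kappa>))" for n
    by (simp flip: exp_of_nat_mult)
  ultimately show ?thesis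
    using True by (simp add: plateau_def \<kappa>_def)
next
  case False
  then show ?thesis
    using plateau_outside[of t a c] by (auto simp: not_less)
qed

lemma plateau_translate: "plateau (a + d) (c + d) n t = plateau a c n (t - d)"
  by (simp add: plateau_def algebra_simps)

lemma plateau_antiderivative:
  fixes a c :: real and n :: nat
  obtains F where "\<And>t. (F has_real_derivative plateau a c n t) (at t)"
proof -
  have "\<exists>F. \<forall>x :: real. - \<infinity> < ereal x \<longrightarrow> ereal x < \<infinity> \<longrightarrow> (F has_vector_derivative plateau a c n x) (at x)"
    by (rule einterval_antiderivative)
       (use Ck_plateau[of 0 a c n] in \<open>auto simp: continuous_on_eq_continuous_at\<close>)
  then obtain F where "\<And>x :: real. (F has_vector_derivative plateau a c n x) (at x)"
    by auto
  then show ?thesis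
    by (intro that[of F]) (simp add: has_real_derivative_iff_has_vector_derivative)
qed

text \<open>
  If $F$ is a primitive of the plateau function of $(a,m)$, then $F(t)-F(t-(m-a))$ is a smoothed tent
  over $(a,2m-a)$: its derivative is the plateau function on the left half minus its translate on the right
  half. The mean value theorem bounds it by $m-a$.
\<close>

lemma tent_exists:
  fixes a m :: real
  assumes "a < m"
  obtains T where "\<And>k. Ck k T" 
    "\<And>t. (T has_real_derivative plateau a m n t - plateau m (2 * m - a) n t) (at t)"
    "\<And>t. \<bar>T t\<bar> \<le> m - a" "\<And>t. t \<le> a \<or> 2 * m - a \<le> t \<Longrightarrow> T t = 0"
proof -
  obtain F where F: "\<And>t. (F has_real_derivative plateau a m n t) (at t)"
    using plateau_antiderivative[of a m n] by metis
  define \<delta> where "\<delta> = m - a"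
  have "\<delta> > 0" using assms by (simp add: \<delta>_def)
  define T where "T t = F t - F (t - \<delta>)" for t
  have MVT: "\<exists>z. s < z \<and> z < t \<and> F t - F s = (t - s) * plateau a m n z" if "s < t" for s t
    using MVT2[OF that, of F "plateau a m n"] F by auto
  have T': "(T has_real_derivative plateau a m n t - plateau m (2 * m - a) n t) (at t)" for t
  proof -
    have "plateau m (2 * m - a) n t = plateau a m n (t - \<delta>)"
      using plateau_translate[of a \<delta> m n t] by (simp add: \<delta>_def)
    moreover have "((\<lambda>t. F (t - \<delta>)) has_real_derivative plateau a m n (t - \<delta>)) (at t)"
      using DERIV_shift[of F "plateau a m n (t - \<delta>)" t "- \<delta>"] F by simp
    ultimately show ?thesis
      using F by (auto simp: T_def[abs_def] intro!: derivative_eq_intros)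
  qed
  show ?thesis
  proof
    show "Ck k T" for k
      using Ck_decrease Ck_Suc_real[OF T'] Ck_diff Ck_plateau by blast
    show "\<bar>T t\<bar> \<le> m - a" for t
    proof -
      obtain z where "F t - F (t - \<delta>) = \<delta> * plateau a m n z"
        using MVT[of "t - \<delta>" t] \<open>\<delta> > 0\<close> by auto
      then show ?thesis
        using plateau_range[where a=a and c=m and n=n and t=z] \<open>\<delta> > 0\<close>
        by (auto simp: T_def \<delta>_def[symmetric] mult_left_le)
    qed
    show "T t = 0" if "t \<le> a \<or> 2 * m - a \<le> t" for t
    proof -
      obtain z where "t - \<delta> < z" "z < t" "F t - F (t - \<delta>) = \<delta> * plateau a m n z"
        using MVT[of "t - \<delta>" t] \<open>\<delta> > 0\<close> by auto
      then show ?thesis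
        using that plateau_outside[of z a m n] by (auto simp: T_def \<delta>_def)
    qed
  qed (fact T')
qed

lemma directional_derivative:
  assumes "f differentiable (at x)"
  shows "((\<lambda>t. f (x + t *\<^sub>R b)) has_real_derivative frechet_derivative f (at x) b) (at 0)"
proof -
  have f: "(f has_derivative frechet_derivative f (at x)) (at (x + 0 *\<^sub>R b))"
    using assms frechet_derivative_works by auto
  have "((\<lambda>t. f (x + t *\<^sub>R b)) has_derivative (\<lambda>t. frechet_derivative f (at x) (t *\<^sub>R b))) (at 0)"
    by (rule has_derivative_compose[where f="\<lambda>t. x + t *\<^sub>R b" and g=f, OF _ f])
       (auto intro!: derivative_eq_intros)
  then show ?thesis
    using linear_cmul[OF linear_frechet_derivative[OF assms], of _ b]
    by (simp add: has_field_derivative_def mult.commute[of _ "frechet_derivative f (at x) b"])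
qed

lemma compact_closure_support:
  fixes \<phi> :: "'a::euclidean_space \<Rightarrow> real"
  assumes "\<And>x. \<phi> x \<noteq> 0 \<Longrightarrow> x \<in> K" "bounded K"
  shows "compact (closure {x. \<phi> x \<noteq> 0})"
  unfolding compact_closure by (rule bounded_subset[OF assms(2)], use assms(1) in auto)

section \<open>Dyadic cells\<close>

text \<open>
  The half-open dyadic box around a point, with side $2^{-l(b)}$ in the coordinate direction $b$.
  Different side lengths are allowed in order to halve a cube one direction at a time.
\<close>

definition dcell :: "('a::euclidean_space \<Rightarrow> nat) \<Rightarrow> 'a \<Rightarrow> 'a set" where
  "dcell l x = {y. \<forall>b\<in>Basis. \<lfloor>2 ^ l b * (y \<bullet> b)\<rfloor> = \<lfloor>2 ^ l b * (x \<bullet> b)\<rfloor>}"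

abbreviation cell :: "nat \<Rightarrow> 'a::euclidean_space \<Rightarrow> 'a set" where
  "cell j \<equiv> dcell (\<lambda>_. j)"

lemma mem_dcell_self [simp]: "x \<in> dcell l x"
  by (simp add: dcell_def)

lemma dcell_eq: "y \<in> dcell l x \<Longrightarrow> dcell l y = dcell l x"
  by (auto simp: dcell_def)

lemma dcell_sym: "y \<in> dcell l x \<longleftrightarrow> x \<in> dcell l y"
  by (auto simp: dcell_def)

lemma floor_pow2_mono:
  fixes s t :: real
  assumes "k \<le> l" "\<lfloor>2 ^ l * s\<rfloor> = \<lfloor>2 ^ l * t\<rfloor>"
  shows "\<lfloor>2 ^ k * s\<rfloor> = \<lfloor>2 ^ k * t\<rfloor>"
proof -
  have *: "\<lfloor>2 ^ k * r\<rfloor> = \<lfloor>2 ^ l * r\<rfloor> div 2 ^ (l - k)" for r :: real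
  proof -
    have "2 ^ k * r = 2 ^ l * r / of_int (2 ^ (l - k))"
      using assms(1) by (simp add: field_simps flip: power_add)
    then show ?thesis
      using floor_divide_real_eq_div[of "2 ^ (l - k)" "2 ^ l * r"] by simp
  qed
  show ?thesis
    unfolding * assms(2) ..
qed

lemma dcell_mono:
  assumes "\<And>b. b \<in> Basis \<Longrightarrow> k b \<le> l b"
  shows "dcell l x \<subseteq> dcell k x"
  using assms floor_pow2_mono unfolding dcell_def by blast

definition corner :: "('a::euclidean_space \<Rightarrow> nat) \<Rightarrow> 'a \<Rightarrow> 'a" where
  "corner l x = (\<Sum>b\<in>Basis. (of_int \<lfloor>2 ^ l b * (x \<bullet> b)\<rfloor> / 2 ^ l b) *\<^sub>R b)"

definition opp_corner :: "('a::euclidean_space \<Rightarrow> nat) \<Rightarrow> 'a \<Rightarrow> 'a" where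
  "opp_corner l x = (\<Sum>b\<in>Basis. (of_int \<lfloor>2 ^ l b * (x \<bullet> b)\<rfloor> / 2 ^ l b + 1 / 2 ^ l b) *\<^sub>R b)"

lemma corner_inner [simp]:
  assumes "b \<in> Basis"
  shows "corner l x \<bullet> b = of_int \<lfloor>2 ^ l b * (x \<bullet> b)\<rfloor> / 2 ^ l b"
    and "opp_corner l x \<bullet> b = of_int \<lfloor>2 ^ l b * (x \<bullet> b)\<rfloor> / 2 ^ l b + 1 / 2 ^ l b"
  using assms by (simp_all add: corner_def opp_corner_def inner_sum_left_Basis)

lemma floor_pow2_eq_iff:
  fixes t :: real and m :: int
  shows "\<lfloor>2 ^ l * t\<rfloor> = m \<longleftrightarrow> of_int m / 2 ^ l \<le> t \<and> t < of_int m / 2 ^ l + 1 / 2 ^ l"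
proof -
  have "\<lfloor>2 ^ l * t\<rfloor> = m \<longleftrightarrow> of_int m \<le> 2 ^ l * t \<and> 2 ^ l * t < of_int m + 1"
    by (rule floor_eq_iff)
  also have "\<dots> \<longleftrightarrow> of_int m / 2 ^ l \<le> t \<and> t < (of_int m + 1) / 2 ^ l"
    by (simp add: pos_divide_le_eq pos_less_divide_eq mult.commute)
  finally show ?thesis by (simp add: add_divide_distrib)
qed

lemma mem_dcell_iff:
  "y \<in> dcell l x \<longleftrightarrow> (\<forall>b\<in>Basis. corner l x \<bullet> b \<le> y \<bullet> b \<and> y \<bullet> b < opp_corner l x \<bullet> b)"
  unfolding dcell_def mem_Collect_eq
  by (intro ball_cong refl) (simp only: corner_inner floor_pow2_eq_iff)

lemma box_subset_dcell: "box (corner l x) (opp_corner l x) \<subseteq> dcell l x"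
  by (force simp: mem_dcell_iff mem_box)

lemma dcell_subset_cbox: "dcell l x \<subseteq> cbox (corner l x) (opp_corner l x)"
  by (force simp: mem_dcell_iff mem_box)

lemma dcell_borel [measurable]: "dcell l x \<in> sets borel"
  unfolding dcell_def by measurable

lemma dcell_AE_box: "AE y in lborel. y \<in> dcell l x \<longleftrightarrow> y \<in> box (corner l x) (opp_corner l x)"
proof -
  let ?D = "cbox (corner l x) (opp_corner l x) - box (corner l x) (opp_corner l x)"
  have "?D \<in> null_sets lebesgue"
    using negligible_frontier_interval negligible_iff_null_sets by blast
  then have "AE y in lebesgue. y \<notin> ?D"
    by (rule AE_not_in)
  then have "AE y in lebesgue. y \<in> dcell l x \<longleftrightarrow> y \<in> box (corner l x) (opp_corner l x)"
    by eventually_elim (use box_subset_dcell[of l x] dcell_subset_cbox[of l x] in blast)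
  then show ?thesis
    by (simp add: AE_completion_iff)
qed

lemma emeasure_dcell: "emeasure lborel (dcell l x) = ennreal (\<Prod>b\<in>Basis. 1 / 2 ^ l b)"
proof -
  have "emeasure lborel (dcell l x) = emeasure lborel (box (corner l x) (opp_corner l x))"
    using dcell_AE_box by (intro emeasure_eq_AE) auto
  also have "\<dots> = (\<Prod>b\<in>Basis. (opp_corner l x - corner l x) \<bullet> b)"
    by (rule emeasure_lborel_box) auto
  also have "(\<Prod>b\<in>Basis. (opp_corner l x - corner l x) \<bullet> b) = (\<Prod>b\<in>Basis. 1 / 2 ^ l b)"
    by (intro prod.cong) (auto simp: inner_diff_left)
  finally show ?thesis .
qed

lemma emeasure_cell: "emeasure lborel (cell j (x::'a::euclidean_space)) = ennreal (1 / 2 ^ (j * DIM('a)))"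
  by (simp add: emeasure_dcell power_mult power_one_over)

lemma cell_point_distance:
  fixes x :: "'a::euclidean_space"
  assumes "y \<in> cell j x"
  shows "norm (x - y) \<le> real DIM('a) / 2 ^ j"
proof -
  have "norm (x - y) \<le> (\<Sum>b\<in>Basis. \<bar>(x - y) \<bullet> b\<bar>)"
    by (rule norm_le_l1)
  also have "\<dots> \<le> (\<Sum>b\<in>(Basis::'a set). 1 / 2 ^ j)"
  proof (rule sum_mono)
    fix b :: 'a assume "b \<in> Basis"
    then have "\<bar>x \<bullet> b - y \<bullet> b\<bar> \<le> 1 / 2 ^ j"
      using bspec[OF mem_dcell_iff[THEN iffD1, OF assms], of b]
        bspec[OF mem_dcell_iff[THEN iffD1, OF mem_dcell_self], of b "\<lambda>_. j" x]
      by (simp del: One_nat_def) linarith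
    then show "\<bar>(x - y) \<bullet> b\<bar> \<le> 1 / 2 ^ j"
      by (simp add: inner_diff_left)
  qed
  finally show ?thesis by simp
qed

lemma dcell_eq_of_dense:
  fixes D :: "'a::euclidean_space set"
  assumes "\<And>X. open X \<Longrightarrow> X \<noteq> {} \<Longrightarrow> \<exists>d\<in>D. d \<in> X"
  shows "\<exists>d\<in>D. dcell l x = dcell l d"
proof -
  have "box (corner l x) (opp_corner l x) \<noteq> {}"
    by (simp add: box_ne_empty)
  then obtain d where "d \<in> D" "d \<in> box (corner l x) (opp_corner l x)"
    using assms[OF open_box] by blast
  then show ?thesis
    using box_subset_dcell dcell_eq by blast
qed

lemma countable_range_dcell: "countable (range (dcell l :: 'a::euclidean_space \<Rightarrow> _))"
proof -
  obtain D :: "'a set" where D: "countable D" "\<And>X. open X \<Longrightarrow> X \<noteq> {} \<Longrightarrow> \<exists>d\<in>D. d \<in> X"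
    by (erule countable_dense_setE)
  have "range (dcell l) \<subseteq> dcell l ` D"
  proof (rule image_subsetI)
    fix x :: 'a
    obtain d where "d \<in> D" "dcell l x = dcell l d"
      using dcell_eq_of_dense[OF D(2)] by blast
    then show "dcell l x \<in> dcell l ` D" by simp
  qed
  then show ?thesis
    by (rule countable_subset) (simp add: D(1))
qed

text \<open>
  There are only countably many cells, so any function that is constant on cells is measurable.
\<close>

lemma measurable_const_on_cells:
  fixes F :: "'a::euclidean_space \<Rightarrow> 'b"
  assumes "\<And>x y. y \<in> cell j x \<Longrightarrow> F y = F x" and "\<And>x. F x \<in> space M"
  shows "F \<in> borel \<rightarrow>\<^sub>M M"
proof (rule measurableI)
  fix A
  let ?C = "{C \<in> range (cell j :: 'a \<Rightarrow> _). C \<subseteq> F -` A}"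
  have "F -` A = \<Union>?C"
  proof safe
    fix x assume "F x \<in> A"
    then have "cell j x \<in> ?C" using assms(1) by auto
    then show "x \<in> \<Union>?C" by (meson UnionI mem_dcell_self)
  qed auto
  moreover have "\<Union>?C \<in> sets borel"
  proof (rule sets.countable_Union)
    show "countable ?C"
      by (rule countable_subset[OF _ countable_range_dcell[of "\<lambda>_. j"]]) blast
  qed auto
  ultimately show "F -` A \<inter> space borel \<in> sets borel" by simp
qed (use assms(2) in auto)

lemma enn2real_cancel:
  "a \<noteq> \<infinity> \<Longrightarrow> b \<noteq> \<infinity> \<Longrightarrow> enn2real a = enn2real b \<Longrightarrow> a = b"
  by (cases a; cases b) auto

text \<open>
  Cells of all generations, with the empty set, form a countable intersection-stable generator of the Borel sets,
  so the measures with densities $w^+$ and $w^-$ agree.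
\<close>

lemma integral_eq_zero_on_cells_imp_AE_zero:
  fixes w :: "'a::euclidean_space \<Rightarrow> real"
  assumes int: "integrable lebesgue w"
    and zero: "\<And>j x. (LINT y|lebesgue. indicator (cell j x) y * w y) = 0"
  shows "AE x in lebesgue. w x = 0"
proof -
  obtain w' where w'[measurable]: "w' \<in> borel_measurable lborel" and ae: "AE x in lborel. w x = w' x"
    using completion_ex_borel_measurable_real[of w lborel] int by auto
  have ae': "AE x in lebesgue. w x = w' x"
    using ae by (rule AE_completion)
  have mw'[measurable]: "w' \<in> borel_measurable lebesgue"
    using w' by (rule measurable_completion)
  have "integrable lebesgue w'"
    by (rule integrable_cong_AE_imp[OF int mw']) (use ae' in eventually_elim, simp)
  then have int': "integrable lborel w'"
    using integrable_completion[OF w'] by blast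
  define P where "P = density lborel (\<lambda>x. ennreal (w' x))"
  define Q where "Q = density lborel (\<lambda>x. ennreal (- w' x))"
  define E :: "'a set set" where "E = insert {} (\<Union>j. range (cell j))"
  have cellE: "cell j x \<in> E" for j x unfolding E_def by auto
  have finP: "(\<integral>\<^sup>+x. ennreal (w' x) \<partial>lborel) \<noteq> \<infinity>" and finQ: "(\<integral>\<^sup>+x. ennreal (- w' x) \<partial>lborel) \<noteq> \<infinity>"
    using int' by (auto simp: real_integrable_def)
  have eq: "emeasure P (cell j x) = emeasure Q (cell j x)" for j x
  proof -
    have i1: "integrable lborel (\<lambda>y. indicator (cell j x) y * w' y)"
      using integrable_mult_indicator[OF _ int', of "cell j x"] by simp
    have "(LINT y|lborel. indicator (cell j x) y * w' y) = (LINT y|lebesgue. indicator (cell j x) y * w' y)"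
      by (rule integral_completion[symmetric]) measurable
    also have "\<dots> = (LINT y|lebesgue. indicator (cell j x) y * w y)"
    proof (rule integral_cong_AE)
      show "AE y in lebesgue. indicator (cell j x) y * w' y = indicator (cell j x) y * w y"
        using ae' by eventually_elim simp
      have [measurable]: "w \<in> borel_measurable lebesgue" using int by simp
      have [measurable]: "cell j x \<in> sets lebesgue" by simp
      show "(\<lambda>y. indicator (cell j x) y * w' y) \<in> borel_measurable lebesgue"
        "(\<lambda>y. indicator (cell j x) y * w y) \<in> borel_measurable lebesgue"
        by measurable
    qed
    finally have "(LINT y|lborel. indicator (cell j x) y * w' y) = 0" using zero by simp
    then have "enn2real (\<integral>\<^sup>+y. ennreal (indicator (cell j x) y * w' y) \<partial>lborel)
        = enn2real (\<integral>\<^sup>+y. ennreal (- (indicator (cell j x) y * w' y)) \<partial>lborel)"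
      using real_lebesgue_integral_def[OF i1] by simp
    moreover have "(\<integral>\<^sup>+y. ennreal (indicator (cell j x) y * w' y) \<partial>lborel) \<noteq> \<infinity>"
        "(\<integral>\<^sup>+y. ennreal (- (indicator (cell j x) y * w' y)) \<partial>lborel) \<noteq> \<infinity>"
      using i1 by (auto simp: real_integrable_def)
    ultimately have "(\<integral>\<^sup>+y. ennreal (indicator (cell j x) y * w' y) \<partial>lborel)
        = (\<integral>\<^sup>+y. ennreal (- (indicator (cell j x) y * w' y)) \<partial>lborel)"
      by (intro enn2real_cancel)
    moreover have "(\<integral>\<^sup>+y. ennreal (s * (indicator (cell j x) y * w' y)) \<partial>lborel)
        = (\<integral>\<^sup>+y. ennreal (s * w' y) * indicator (cell j x) y \<partial>lborel)" for s
      by (intro nn_integral_cong) (auto split: split_indicator)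
    from this[of 1] this[of "-1"] calculation show ?thesis
      by (simp add: P_def Q_def emeasure_density)
  qed
  have "P = Q"
  proof (rule measure_eqI_generator_eq_countable[where \<Omega>=UNIV and E=E and A="range (cell 0)"])
    show "Int_stable E"
    proof (rule Int_stableI)
      fix A B assume "A \<in> E" "B \<in> E"
      have *: "cell i x \<inter> cell j y \<in> E" if "i \<le> j" for i j x y
      proof (cases "cell i x \<inter> cell j y = {}")
        case False
        then obtain z where "z \<in> cell i x" "z \<in> cell j y" by blast
        then have "cell i x = cell i z" "cell j y = cell j z"
          using dcell_eq by blast+
        moreover have "cell j z \<subseteq> cell i z"
          using that by (intro dcell_mono)
        ultimately show ?thesis
          using cellE[of j z] by (simp add: Int_absorb1)
      qed (simp add: E_def)
      show "A \<inter> B \<in> E"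
      proof (cases "A = {} \<or> B = {}")
        case True
        then show ?thesis by (auto simp: E_def)
      next
        case False
        then obtain i x j y where "A = cell i x" "B = cell j y"
          using \<open>A \<in> E\<close> \<open>B \<in> E\<close> by (auto simp: E_def)
        then show ?thesis
          using *[of i j x y] *[of j i y x] by (cases "i \<le> j") (auto simp: Int_commute)
      qed
    qed
    show "emeasure P X = emeasure Q X" if "X \<in> E" for X
      using that eq by (auto simp: E_def)
    have "sets (borel :: 'a measure) = sigma_sets UNIV E"
    proof
      have "sets (borel :: 'a measure) = sigma_sets UNIV {S. open S}"
        by (simp add: borel_def)
      also have "\<dots> \<subseteq> sigma_sets UNIV E"
      proof (rule sigma_sets_mono, clarsimp)
        fix S :: "'a set" assume "open S"
        let ?C = "{C \<in> E. C \<subseteq> S}"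
        have "S = \<Union>?C"
        proof safe
          fix x assume "x \<in> S"
          then obtain e where e: "e > 0" "ball x e \<subseteq> S"
            using \<open>open S\<close> open_contains_ball by blast
          obtain j where j: "(1 / 2) ^ j < e / real DIM('a)"
            using real_arch_pow_inv[of "e / real DIM('a)" "1/2"] e(1) by auto
          have "cell j x \<subseteq> ball x e"
          proof
            fix y assume "y \<in> cell j x"
            then have "norm (x - y) \<le> real DIM('a) * (1 / 2) ^ j"
              using cell_point_distance by (fastforce simp: power_one_over)
            also have "\<dots> < e" using j by (simp add: field_simps)
            finally show "y \<in> ball x e" by (simp add: dist_norm)
          qed
          then have "cell j x \<in> ?C"
            using e cellE by blast
          then show "x \<in> \<Union>?C" by (meson UnionI mem_dcell_self)
        qed auto
        moreover have "countable E"
          unfolding E_def by (intro countable_insert countable_UN countable_range_dcell) auto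
        then have "countable ?C" by (rule countable_subset[rotated]) auto
        then have "\<Union>?C \<in> sigma_sets UNIV E"
          by (rule sigma_sets_UNION) (simp add: sigma_sets.Basic)
        ultimately show "S \<in> sigma_sets UNIV E" by (rule ssubst)
      qed
      finally show "sets (borel :: 'a measure) \<subseteq> sigma_sets UNIV E" .
      have "E \<subseteq> sets borel" by (auto simp: E_def)
      then show "sigma_sets UNIV E \<subseteq> sets (borel :: 'a measure)"
        using sets.sigma_sets_subset[of E borel] by simp
    qed
    then show "sets P = sigma_sets UNIV E" "sets Q = sigma_sets UNIV E"
      by (simp_all add: P_def Q_def)
    show "range (cell 0) \<subseteq> E" using cellE by auto
    have "x \<in> \<Union>(range (cell 0))" for x :: 'a
      by (rule UnionI[of "cell 0 x"]) simp_all
    then show "\<Union>(range (cell 0)) = (UNIV :: 'a set)" by (intro equalityI subset_UNIV subsetI)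
    show "countable (range (cell 0 :: 'a \<Rightarrow> _))" by (rule countable_range_dcell)
    fix a :: "'a set"
    have "emeasure P a \<le> emeasure P (space P)" by (rule emeasure_space)
    also have "\<dots> = (\<integral>\<^sup>+x. ennreal (w' x) \<partial>lborel)"
      by (simp add: P_def emeasure_density)
    finally show "emeasure P a \<noteq> \<infinity>" using finP by (auto simp: top_unique)
  qed auto
  then have "AE x in lborel. ennreal (w' x) = ennreal (- w' x)"
    using finite_density_unique[of "\<lambda>x. ennreal (w' x)" lborel "\<lambda>x. ennreal (- w' x)"] finP
    by (simp add: P_def Q_def)
  then have "AE x in lborel. w' x = 0"
  proof eventually_elim
    fix x assume *: "ennreal (w' x) = ennreal (- w' x)"
    show "w' x = 0"
    proof (cases "w' x \<ge> 0")
      case True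
      then show ?thesis using * by (simp add: ennreal_neg)
    next
      case False
      then have "ennreal (w' x) = 0" by (simp add: ennreal_neg)
      then show ?thesis using * False by (simp add: ennreal_eq_0_iff)
    qed
  qed
  with ae have "AE x in lborel. w x = 0" by eventually_elim simp
  then show ?thesis by (rule AE_completion)
qed

section \<open>Weak gradients on boxes\<close>

text \<open>
  Localisation of the previous lemma: a finer cell either lies in a given unit cell or is disjoint from it.
\<close>

lemma AE_zero_if_zero_on_cells:
  fixes w :: "'a::euclidean_space \<Rightarrow> real"
  assumes int: "\<And>x. integrable lebesgue (\<lambda>y. indicator (cell 0 x) y * w y)"
    and zero: "\<And>j x. (LINT y|lebesgue. indicator (cell j x) y * w y) = 0"
  shows "AE x in lebesgue. w x = 0"
proof -
  have *: "AE y in lebesgue. indicator (cell 0 x) y * w y = 0" for x :: 'a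
  proof (rule integral_eq_zero_on_cells_imp_AE_zero[OF int])
    fix j and z :: 'a
    show "(LINT y|lebesgue. indicator (cell j z) y * (indicator (cell 0 x) y * w y)) = 0"
    proof (cases "cell j z \<subseteq> cell 0 x")
      case True
      then have "(\<lambda>y. indicator (cell j z) y * (indicator (cell 0 x) y * w y)) = (\<lambda>y. indicator (cell j z) y * w y)"
        by (auto simp: fun_eq_iff split: split_indicator)
      then show ?thesis using zero by simp
    next
      case False
      have "cell j z \<inter> cell 0 x = {}"
      proof (rule ccontr)
        assume "cell j z \<inter> cell 0 x \<noteq> {}"
        then obtain y where "y \<in> cell j z" "y \<in> cell 0 x" by blast
        then have "cell j z = cell j y" "cell 0 x = cell 0 y"
          using dcell_eq by blast+
        then show False
          using False dcell_mono[of "\<lambda>_. 0" "\<lambda>_. j" y] by simp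
      qed
      then have "(\<lambda>y. indicator (cell j z) y * (indicator (cell 0 x) y * w y)) = (\<lambda>y. 0)"
        by (auto simp: fun_eq_iff split: split_indicator)
      then show ?thesis by simp
    qed
  qed
  have "AE y in lebesgue. \<forall>C\<in>range (cell 0 :: 'a \<Rightarrow> _). indicator C y * w y = 0"
    by (rule AE_ball_countable'[OF _ countable_range_dcell]) (use * in auto)
  then show ?thesis
  proof eventually_elim
    fix y assume "\<forall>C\<in>range (cell 0). indicator C y * w y = 0"
    from bspec[OF this, of "cell 0 y"] show "w y = 0" by simp
  qed
qed

definition bump_product :: "'a::euclidean_space set \<Rightarrow> 'a \<Rightarrow> 'a \<Rightarrow> nat \<Rightarrow> 'a \<Rightarrow> real" where
  "bump_product B a c n x = (\<Prod>i\<in>B. plateau (a \<bullet> i) (c \<bullet> i) n (x \<bullet> i))"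

lemma Ck_bump_product: "Ck k (bump_product B a c n)"
  unfolding bump_product_def
  by (intro Ck_prod Ck_compose[OF Ck_plateau] Ck_inner_left)

lemma bump_product_range: "0 \<le> bump_product B a c n x" "bump_product B a c n x \<le> 1"
  unfolding bump_product_def by (auto intro!: prod_nonneg prod_le_1 simp: plateau_range)

lemma bump_product_nonzeroD:
  "finite B \<Longrightarrow> bump_product B a c n x \<noteq> 0 \<Longrightarrow> i \<in> B \<Longrightarrow> a \<bullet> i < x \<bullet> i \<and> x \<bullet> i < c \<bullet> i"
  unfolding bump_product_def by (metis plateau_outside prod_zero_iff linorder_not_less)

lemma bump_product_tendsto:
  assumes "finite B"
  shows "(\<lambda>n. bump_product B a c n x) \<longlonglongrightarrow> (if \<forall>i\<in>B. a \<bullet> i < x \<bullet> i \<and> x \<bullet> i < c \<bullet> i then 1 else 0)"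
proof -
  have "(\<lambda>n. bump_product B a c n x) \<longlonglongrightarrow> (\<Prod>i\<in>B. indicator {a \<bullet> i<..<c \<bullet> i} (x \<bullet> i))"
    unfolding bump_product_def by (intro tendsto_prod plateau_tendsto)
  also have "(\<Prod>i\<in>B. indicator {a \<bullet> i<..<c \<bullet> i} (x \<bullet> i)) =
      (if \<forall>i\<in>B. a \<bullet> i < x \<bullet> i \<and> x \<bullet> i < c \<bullet> i then 1 else 0 :: real)"
  proof (cases "\<forall>i\<in>B. a \<bullet> i < x \<bullet> i \<and> x \<bullet> i < c \<bullet> i")
    case False
    then obtain i where "i \<in> B" "indicator {a \<bullet> i<..<c \<bullet> i} (x \<bullet> i) = (0 :: real)"
      by auto
    then have "(\<Prod>i\<in>B. indicator {a \<bullet> i<..<c \<bullet> i} (x \<bullet> i)) = (0 :: real)"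
      using assms by (meson prod_zero)
    then show ?thesis using False by auto
  qed auto
  finally show ?thesis .
qed

lemma Ck_borel_measurable: "Ck k f \<Longrightarrow> f \<in> borel_measurable borel"
proof (induction k arbitrary: f)
  case 0
  then show ?case by (simp add: borel_measurable_continuous_onI)
next
  case (Suc k)
  then show ?case using Ck_decrease by blast
qed

lemma borel_imp_lebesgue: "f \<in> borel \<rightarrow>\<^sub>M M \<Longrightarrow> f \<in> lebesgue \<rightarrow>\<^sub>M M"
  by (rule measurable_completion) simp

lemma has_weak_gradientD:
  assumes "has_weak_gradient u g" "test_function \<phi>" "b \<in> Basis"
  shows "(LINT x|lebesgue. u x * frechet_derivative \<phi> (at x) b) = - (LINT x|lebesgue. (g x \<bullet> b) * \<phi> x)"
  using assms unfolding has_weak_gradient_def by blast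

lemma has_weak_gradient_integrable_cbox:
  assumes "has_weak_gradient u g"
  shows "integrable lebesgue (\<lambda>x. indicator (cbox a c) x * u x)"
    and "integrable lebesgue (\<lambda>x. indicator (cbox a c) x *\<^sub>R g x)"
  using assms unfolding has_weak_gradient_def locally_integrable_def set_integrable_def
  by (auto simp: compact_cbox)

lemma integral_bump_tendsto:
  fixes w :: "'a::euclidean_space \<Rightarrow> real"
  assumes int: "integrable lebesgue (\<lambda>x. indicator (cbox a c) x * w x)"
    and meas: "\<And>n. \<psi> n \<in> borel_measurable lebesgue" "\<Psi> \<in> borel_measurable lebesgue"
    and bound: "\<And>n x. \<bar>\<psi> n x\<bar> \<le> 1" and supp: "\<And>n x. x \<notin> cbox a c \<Longrightarrow> \<psi> n x = 0"
    and lim: "\<And>x. (\<lambda>n. \<psi> n x) \<longlonglongrightarrow> \<Psi> x"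
  shows "(\<lambda>n. LINT x|lebesgue. w x * \<psi> n x) \<longlonglongrightarrow> (LINT x|lebesgue. w x * \<Psi> x)"
proof -
  define w' where "w' x = indicator (cbox a c) x * w x" for x
  have int': "integrable lebesgue w'" using int by (simp add: w'_def[abs_def])
  then have [measurable]: "w' \<in> borel_measurable lebesgue" by simp
  note [measurable] = meas
  have supp': "\<Psi> x = 0" if "x \<notin> cbox a c" for x
    using lim[of x] supp[OF that] by (simp add: LIMSEQ_const_iff)
  have "(\<lambda>n. LINT x|lebesgue. w' x * \<psi> n x) \<longlonglongrightarrow> (LINT x|lebesgue. w' x * \<Psi> x)"
  proof (rule integral_dominated_convergence[where w="\<lambda>x. norm (w' x)"])
    show "AE x in lebesgue. (\<lambda>n. w' x * \<psi> n x) \<longlonglongrightarrow> w' x * \<Psi> x"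
      by (intro AE_I2 tendsto_mult tendsto_const lim)
    show "AE x in lebesgue. norm (w' x * \<psi> n x) \<le> norm (w' x)" for n
      using bound by (intro AE_I2) (auto simp: abs_mult intro: mult_left_le)
  qed (use int' in auto)
  moreover have "w' x * \<psi> n x = w x * \<psi> n x" "w' x * \<Psi> x = w x * \<Psi> x" for n x
    using supp supp' by (cases "x \<in> cbox a c"; simp add: w'_def)+
  ultimately show ?thesis by simp
qed

text \<open>
  Products of plateau functions are test functions that converge boundedly to the indicator function of
  a box, so two weak gradients have the same integral over every dyadic cell.
\<close>

lemma weak_gradient_unique:
  fixes u :: "'a::euclidean_space \<Rightarrow> real"
  assumes g: "has_weak_gradient u g" and h: "has_weak_gradient u h"
  shows "AE x in lebesgue. g x = h x"
proof -
  have "AE x in lebesgue. (g x - h x) \<bullet> b = 0" if b: "b \<in> Basis" for b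
  proof (rule AE_zero_if_zero_on_cells)
    have int: "integrable lebesgue (\<lambda>x. indicator (cbox a c) x * (f x \<bullet> b))"
      if "has_weak_gradient u f" for f and a c :: 'a
      using integrable_inner_left[OF has_weak_gradient_integrable_cbox(2)[OF that, of a c], of b] by simp
    have int2: "integrable lebesgue (\<lambda>x. indicator (cbox a c) x * ((g x - h x) \<bullet> b))" for a c :: 'a
      using Bochner_Integration.integrable_diff[OF int[OF g] int[OF h], of a c a c]
      by (simp add: algebra_simps inner_diff_left)
    show "integrable lebesgue (\<lambda>y. indicator (cell 0 x) y * ((g y - h y) \<bullet> b))" for x
    proof -
      have "integrable lebesgue (\<lambda>y. indicator (cell 0 x) y *\<^sub>R (indicator (cbox (corner (\<lambda>_. 0) x) (opp_corner (\<lambda>_. 0) x)) y * ((g y - h y) \<bullet> b)))"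
        by (rule integrable_mult_indicator) (auto simp: int2)
      then show ?thesis
        using dcell_subset_cbox[of "\<lambda>_. 0" x]
        by (elim back_subst[of "integrable lebesgue"]) (auto simp: fun_eq_iff split: split_indicator)
    qed
    fix j and x :: 'a
    define a c where "a = corner (\<lambda>_. j) x" and "c = opp_corner (\<lambda>_. j) x"
    define \<phi> where "\<phi> n = bump_product Basis a c n" for n
    have supp: "y \<in> cbox a c" if "\<phi> n y \<noteq> 0" for n y
      using bump_product_nonzeroD[of Basis a c n y] that unfolding \<phi>_def mem_box by (fastforce intro: less_imp_le)
    have supp0: "\<phi> n y = 0" if "y \<notin> cbox a c" for n y
      using supp that by blast
    have test: "test_function (\<phi> n)" for n
      unfolding test_function_def
      using Ck_bump_product compact_closure_support[OF supp] \<phi>_def by auto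
    have meas: "\<phi> n \<in> borel_measurable lebesgue" for n
      unfolding \<phi>_def by (rule borel_imp_lebesgue[OF Ck_borel_measurable[OF Ck_bump_product[of 0]]])
    have lim: "(\<lambda>n. \<phi> n y) \<longlonglongrightarrow> indicator (box a c) y" for y
    proof -
      have "(if \<forall>i\<in>Basis. a \<bullet> i < y \<bullet> i \<and> y \<bullet> i < c \<bullet> i then 1 else 0 :: real) = indicator (box a c) y"
        by (simp add: indicator_def mem_box)
      then show ?thesis
        using bump_product_tendsto[of Basis a c y] by (simp only: \<phi>_def finite_Basis)
    qed
    have bd: "\<bar>\<phi> n y\<bar> \<le> 1" for n y
      using bump_product_range[of Basis a c n y] by (simp add: \<phi>_def)
    have "(LINT x|lebesgue. ((g x - h x) \<bullet> b) * \<phi> n x) = 0" for n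
    proof -
      have eq: "(LINT x|lebesgue. (g x \<bullet> b) * \<phi> n x) = (LINT x|lebesgue. (h x \<bullet> b) * \<phi> n x)"
        using has_weak_gradientD[OF g test[of n] b] has_weak_gradientD[OF h test[of n] b] by simp
      have intf: "integrable lebesgue (\<lambda>x. (f x \<bullet> b) * \<phi> n x)" if "has_weak_gradient u f" for f
      proof (rule Bochner_Integration.integrable_bound[OF int[OF that, of a c]])
        have [measurable]: "(\<lambda>x. indicator (cbox a c) x * (f x \<bullet> b)) \<in> borel_measurable lebesgue" "\<phi> n \<in> borel_measurable lebesgue"
          using int[OF that, of a c] meas by auto
        have "(\<lambda>x. (indicator (cbox a c) x * (f x \<bullet> b)) * \<phi> n x) \<in> borel_measurable lebesgue"
          by measurable
        also have "(\<lambda>x. (indicator (cbox a c) x * (f x \<bullet> b)) * \<phi> n x) = (\<lambda>x. (f x \<bullet> b) * \<phi> n x)"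
          by (auto simp: fun_eq_iff supp0 split: split_indicator)
        finally show "(\<lambda>x. (f x \<bullet> b) * \<phi> n x) \<in> borel_measurable lebesgue" .
        show "AE x in lebesgue. norm ((f x \<bullet> b) * \<phi> n x) \<le> norm (indicator (cbox a c) x * (f x \<bullet> b))"
          using bd by (intro AE_I2) (auto simp: abs_mult supp0 intro!: mult_left_le split: split_indicator)
      qed
      show ?thesis
        using Bochner_Integration.integral_diff[OF intf[OF g] intf[OF h]] eq
        by (simp add: inner_diff_left left_diff_distrib)
    qed
    moreover have "(\<lambda>n. LINT x|lebesgue. ((g x - h x) \<bullet> b) * \<phi> n x) \<longlonglongrightarrow>
        (LINT x|lebesgue. ((g x - h x) \<bullet> b) * indicator (box a c) x)"
      by (rule integral_bump_tendsto[OF int2 meas _ bd _ lim]) (use supp0 in \<open>auto intro: borel_imp_lebesgue\<close>)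
    ultimately have "(LINT x|lebesgue. ((g x - h x) \<bullet> b) * indicator (box a c) x) = 0"
      by (simp add: LIMSEQ_const_iff)
    also have "(LINT x|lebesgue. ((g x - h x) \<bullet> b) * indicator (box a c) x)
        = (LINT y|lebesgue. indicator (cell j x) y * ((g y - h y) \<bullet> b))"
    proof (rule integral_cong_AE)
      have "AE y in lebesgue. y \<in> cell j x \<longleftrightarrow> y \<in> box a c"
        unfolding a_def c_def using dcell_AE_box by (rule AE_completion)
      then show "AE y in lebesgue. ((g y - h y) \<bullet> b) * indicator (box a c) y = indicator (cell j x) y * ((g y - h y) \<bullet> b)"
        by eventually_elim (auto split: split_indicator)
      have [measurable]: "(\<lambda>x. indicator (cbox a c) x * ((g x - h x) \<bullet> b)) \<in> borel_measurable lebesgue"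
        using int2[of a c] by simp
      have *: "(\<lambda>y. ((g y - h y) \<bullet> b) * indicator S y) \<in> borel_measurable lebesgue"
        if [measurable]: "S \<in> sets lebesgue" and "S \<subseteq> cbox a c" for S
      proof -
        have "(\<lambda>y. (indicator (cbox a c) y * ((g y - h y) \<bullet> b)) * indicator S y) \<in> borel_measurable lebesgue"
          by measurable
        also have "(\<lambda>y. (indicator (cbox a c) y * ((g y - h y) \<bullet> b)) * indicator S y) = (\<lambda>y. ((g y - h y) \<bullet> b) * indicator S y)"
          using that(2) by (auto simp: fun_eq_iff split: split_indicator)
        finally show ?thesis .
      qed
      show "(\<lambda>y. ((g y - h y) \<bullet> b) * indicator (box a c) y) \<in> borel_measurable lebesgue"
        by (rule *) (auto simp: box_subset_cbox)
      show "(\<lambda>y. indicator (cell j x) y * ((g y - h y) \<bullet> b)) \<in> borel_measurable lebesgue"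
        using *[of "cell j x"] dcell_subset_cbox[of "\<lambda>_. j" x] by (simp add: a_def c_def mult.commute)
    qed
    finally show "(LINT y|lebesgue. indicator (cell j x) y * ((g y - h y) \<bullet> b)) = 0" .
  qed
  then have "AE x in lebesgue. \<forall>b\<in>Basis. (g x - h x) \<bullet> b = 0"
    by (intro AE_finite_allI) auto
  then show ?thesis
    by eventually_elim (rule euclidean_eqI, simp add: inner_diff_left)
qed

text \<open>
  The product over the other coordinates is constant along lines in direction $b$.
\<close>

lemma frechet_derivative_tent_product:
  fixes b :: "'a::euclidean_space"
  assumes b: "b \<in> Basis" and T: "\<And>t. (T has_real_derivative T' t) (at t)" and CT: "\<And>k. Ck k T"
  shows "frechet_derivative (\<lambda>x. T (x \<bullet> b) * bump_product (Basis - {b}) a c n x) (at x) b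
    = T' (x \<bullet> b) * bump_product (Basis - {b}) a c n x"
proof -
  let ?P = "bump_product (Basis - {b}) a c n"
  have C: "Ck (Suc 0) (\<lambda>x. T (x \<bullet> b) * ?P x)"
    by (intro Ck_mult Ck_bump_product Ck_compose[OF CT] Ck_inner_left)
  have d1: "((\<lambda>t. T ((x + t *\<^sub>R b) \<bullet> b) * ?P (x + t *\<^sub>R b)) has_real_derivative
      frechet_derivative (\<lambda>x. T (x \<bullet> b) * ?P x) (at x) b) (at 0)"
    by (rule directional_derivative[OF Ck_differentiable[OF C]])
  have P: "?P (x + t *\<^sub>R b) = ?P x" for t
    unfolding bump_product_def using b
    by (intro prod.cong) (auto simp: inner_add_left inner_not_same_Basis)
  have d2: "((\<lambda>t. T (x \<bullet> b + t) * ?P x) has_real_derivative T' (x \<bullet> b) * ?P x) (at 0)"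
    using T[of "x \<bullet> b"] DERIV_shift[of T "T' (x \<bullet> b)" 0 "x \<bullet> b"]
    by (intro DERIV_cmult_right) (simp add: add.commute)
  have eq: "(\<lambda>t. T ((x + t *\<^sub>R b) \<bullet> b) * ?P (x + t *\<^sub>R b)) = (\<lambda>t. T (x \<bullet> b + t) * ?P x)"
    using b P by (simp add: inner_add_left)
  show ?thesis
    by (rule DERIV_unique[OF d1[unfolded eq] d2])
qed

text \<open>
  Test the weak gradient with (tent in direction $b$) $\times$ (plateau functions in the other directions). The
  derivative in direction $b$ tends to the difference of the indicator functions of the two halves,
  while the test function itself is bounded by half the side length and supported in the box.
\<close>

lemma weak_gradient_halving:
  fixes u :: "'a::euclidean_space \<Rightarrow> real"
  assumes wg: "has_weak_gradient u g" and b: "b \<in> Basis" and ac: "a \<bullet> b < c \<bullet> b"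
  defines "m \<equiv> (a \<bullet> b + c \<bullet> b) / 2"
  shows "\<bar>LINT x|lebesgue. u x * (indicator (box a c \<inter> {x. x \<bullet> b < m}) x - indicator (box a c \<inter> {x. m < x \<bullet> b}) x)\<bar>
     \<le> (c \<bullet> b - a \<bullet> b) / 2 * (LINT x|lebesgue. indicator (cbox a c) x * norm (g x))"
proof -
  define \<delta> where "\<delta> = (c \<bullet> b - a \<bullet> b) / 2"
  have m: "a \<bullet> b < m" "2 * m - a \<bullet> b = c \<bullet> b" "m - a \<bullet> b = \<delta>" and \<delta>: "\<delta> > 0"
    using ac by (auto simp: m_def \<delta>_def field_simps)
  define s where "s n t = plateau (a \<bullet> b) m n t - plateau m (c \<bullet> b) n t" for n t
  have "\<exists>T. (\<forall>k. Ck k T) \<and> (\<forall>t. (T has_real_derivative s n t) (at t)) \<and> (\<forall>t. \<bar>T t\<bar> \<le> \<delta>) \<and>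
      (\<forall>t. t \<le> a \<bullet> b \<or> c \<bullet> b \<le> t \<longrightarrow> T t = 0)" for n
  proof -
    obtain T where "\<And>k. Ck k T" "\<And>t. (T has_real_derivative s n t) (at t)" "\<And>t. \<bar>T t\<bar> \<le> \<delta>"
      "\<And>t. t \<le> a \<bullet> b \<or> c \<bullet> b \<le> t \<Longrightarrow> T t = 0"
      using tent_exists[OF m(1), of n thesis] unfolding m(2,3) s_def by blast
    then show ?thesis by blast
  qed
  then obtain T where T: "\<And>n k. Ck k (T n)" "\<And>n t. (T n has_real_derivative s n t) (at t)"
      "\<And>n t. \<bar>T n t\<bar> \<le> \<delta>" "\<And>n t. t \<le> a \<bullet> b \<or> c \<bullet> b \<le> t \<Longrightarrow> T n t = 0"
    by metis
  define P where "P n = bump_product (Basis - {b}) a c n" for n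
  define \<phi> where "\<phi> n x = T n (x \<bullet> b) * P n x" for n x
  have Psupp: "a \<bullet> i < x \<bullet> i \<and> x \<bullet> i < c \<bullet> i" if "P n x \<noteq> 0" "i \<in> Basis - {b}" for n x i
    using bump_product_nonzeroD[of "Basis - {b}" a c n x i] that by (simp add: P_def)
  have Prange: "0 \<le> P n x" "P n x \<le> 1" for n x
    using bump_product_range[of "Basis - {b}" a c n x] by (auto simp: P_def)
  have supp: "x \<in> cbox a c" if "\<phi> n x \<noteq> 0" for n x
  proof -
    have "P n x \<noteq> 0" "T n (x \<bullet> b) \<noteq> 0" using that by (auto simp: \<phi>_def)
    then have "a \<bullet> i < x \<bullet> i \<and> x \<bullet> i < c \<bullet> i" if "i \<in> Basis" for i
      using Psupp[of n x i] T(4)[of "x \<bullet> b" n] that by (cases "i = b") force+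
    then show ?thesis by (simp add: mem_box less_imp_le)
  qed
  have Ck\<phi>: "Ck k (\<phi> n)" for k n
    unfolding \<phi>_def P_def by (intro Ck_mult Ck_bump_product Ck_compose[OF T(1)] Ck_inner_left)
  have test: "test_function (\<phi> n)" for n
    unfolding test_function_def using Ck\<phi> compact_closure_support[OF supp] by auto
  define \<psi> where "\<psi> n x = s n (x \<bullet> b) * P n x" for n x
  have d: "frechet_derivative (\<phi> n) (at x) b = \<psi> n x" for n x
    unfolding \<phi>_def[abs_def] \<psi>_def P_def by (rule frechet_derivative_tent_product[OF b T(2,1)])
  define \<Psi> where "\<Psi> x = indicator (box a c \<inter> {x. x \<bullet> b < m}) x - (indicator (box a c \<inter> {x. m < x \<bullet> b}) x :: real)" for x
  have sbd: "\<bar>s n t\<bar> \<le> 1" for n t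
    using plateau_range[of "a \<bullet> b" m n t] plateau_range[of m "c \<bullet> b" n t] by (simp add: s_def)
  have bd: "\<bar>\<psi> n x\<bar> \<le> 1" for n x
    using sbd[of n "x \<bullet> b"] Prange[where n=n and x=x] mult_mono[of "\<bar>s n (x \<bullet> b)\<bar>" 1 "P n x" 1]
    by (simp add: \<psi>_def abs_mult)
  have \<psi>supp: "\<psi> n x = 0" if "x \<notin> cbox a c" for n x
  proof (rule ccontr)
    assume "\<psi> n x \<noteq> 0"
    then have "P n x \<noteq> 0" "s n (x \<bullet> b) \<noteq> 0" by (auto simp: \<psi>_def)
    then have "a \<bullet> i \<le> x \<bullet> i \<and> x \<bullet> i \<le> c \<bullet> i" if "i \<in> Basis" for i
    proof (cases "i = b")
      case True
      show ?thesis
      proof (rule ccontr)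
        assume "\<not> ?thesis"
        then have "x \<bullet> b \<le> a \<bullet> b \<or> c \<bullet> b \<le> x \<bullet> b" using True by auto
        then have "s n (x \<bullet> b) = 0"
          using m ac plateau_outside[of "x \<bullet> b" "a \<bullet> b" m n] plateau_outside[of "x \<bullet> b" m "c \<bullet> b" n] \<delta>
          by (auto simp: s_def)
        then show False using \<open>s n (x \<bullet> b) \<noteq> 0\<close> by simp
      qed
    qed (use Psupp[of n x i] that in auto)
    then show False using that by (simp add: mem_box)
  qed
  have lim: "(\<lambda>n. \<psi> n x) \<longlonglongrightarrow> \<Psi> x" for x
  proof -
    define L where "L = (indicator {a \<bullet> b<..<m} (x \<bullet> b) - indicator {m<..<c \<bullet> b} (x \<bullet> b)) *
        (if \<forall>i\<in>Basis - {b}. a \<bullet> i < x \<bullet> i \<and> x \<bullet> i < c \<bullet> i then 1 else (0 :: real))"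
    have "(\<lambda>n. \<psi> n x) \<longlonglongrightarrow> L"
      unfolding \<psi>_def s_def P_def L_def
      by (intro tendsto_mult tendsto_diff plateau_tendsto bump_product_tendsto) auto
    also have "L = \<Psi> x"
    proof (cases "\<forall>i\<in>Basis - {b}. a \<bullet> i < x \<bullet> i \<and> x \<bullet> i < c \<bullet> i")
      case True
      then have "x \<in> box a c \<longleftrightarrow> a \<bullet> b < x \<bullet> b \<and> x \<bullet> b < c \<bullet> b"
        using b by (auto simp: mem_box)
      then show ?thesis
        using True m \<delta> by (auto simp: \<Psi>_def L_def indicator_def)
    next
      case False
      then have "x \<notin> box a c" by (auto simp: mem_box)
      then show ?thesis using False by (auto simp: \<Psi>_def L_def)
    qed
    finally show ?thesis .
  qed
  have meas: "\<psi> n \<in> borel_measurable lebesgue" for n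
  proof -
    have "Ck 0 (\<psi> n)"
      unfolding \<psi>_def s_def P_def
      by (intro Ck_mult Ck_diff Ck_bump_product Ck_compose[OF Ck_plateau] Ck_inner_left)
    then show ?thesis by (rule borel_imp_lebesgue[OF Ck_borel_measurable])
  qed
  have lebm: "(\<lambda>x. x \<bullet> b) \<in> borel_measurable borel" by simp
  have sets: "box a c \<inter> {x. x \<bullet> b < m} \<in> sets borel" "box a c \<inter> {x. m < x \<bullet> b} \<in> sets borel"
    by (auto intro!: borel_open open_Int open_halfspace_component_lt open_halfspace_component_gt)
  have meas\<Psi>: "\<Psi> \<in> borel_measurable lebesgue"
    unfolding \<Psi>_def[abs_def] by (intro borel_imp_lebesgue) (use sets in measurable)
  note intu = has_weak_gradient_integrable_cbox(1)[OF wg, of a c]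
  have intg: "integrable lebesgue (\<lambda>x. indicator (cbox a c) x * norm (g x))"
    using integrable_norm[OF has_weak_gradient_integrable_cbox(2)[OF wg, of a c]] by simp
  have lim2: "(\<lambda>n. \<bar>LINT x|lebesgue. u x * \<psi> n x\<bar>) \<longlonglongrightarrow> \<bar>LINT x|lebesgue. u x * \<Psi> x\<bar>"
    by (intro tendsto_rabs integral_bump_tendsto[OF intu meas meas\<Psi> bd \<psi>supp lim])
  have "\<bar>LINT x|lebesgue. u x * \<psi> n x\<bar> \<le> \<delta> * (LINT x|lebesgue. indicator (cbox a c) x * norm (g x))" for n
  proof -
    have "(LINT x|lebesgue. u x * \<psi> n x) = - (LINT x|lebesgue. (g x \<bullet> b) * \<phi> n x)"
      using has_weak_gradientD[OF wg test[of n] b] by (simp add: d)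
    then have "\<bar>LINT x|lebesgue. u x * \<psi> n x\<bar> = \<bar>LINT x|lebesgue. (g x \<bullet> b) * \<phi> n x\<bar>" by simp
    also have "\<dots> \<le> (LINT x|lebesgue. \<delta> * (indicator (cbox a c) x * norm (g x)))"
    proof (rule integral_abs_bound[THEN order_trans], rule integral_mono')
      show "integrable lebesgue (\<lambda>x. \<delta> * (indicator (cbox a c) x * norm (g x)))"
        using intg by simp
      show "\<bar>(g x \<bullet> b) * \<phi> n x\<bar> \<le> \<delta> * (indicator (cbox a c) x * norm (g x))" for x
      proof (cases "\<phi> n x = 0")
        case False
        have "\<bar>\<phi> n x\<bar> \<le> \<delta> * 1"
          unfolding \<phi>_def abs_mult using T(3)[of n "x \<bullet> b"] Prange[where n=n and x=x] \<delta> by (intro mult_mono) auto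
        moreover have "\<bar>g x \<bullet> b\<bar> \<le> norm (g x)" by (rule Basis_le_norm[OF b])
        ultimately have "\<bar>g x \<bullet> b\<bar> * \<bar>\<phi> n x\<bar> \<le> norm (g x) * \<delta>"
          by (intro mult_mono) auto
        then show ?thesis using supp[OF False] by (simp add: abs_mult mult.commute)
      qed (use \<delta> in simp)
    qed (use \<delta> in auto)
    finally show ?thesis by simp
  qed
  then show ?thesis
    using LIMSEQ_le_const2[OF lim2] unfolding \<Psi>_def \<delta>_def by blast
qed

section \<open>Dyadic averages of weakly differentiable functions\<close>

lemma locally_integrable_measurable:
  fixes f :: "'a::euclidean_space \<Rightarrow> 'b::euclidean_space"
  assumes "locally_integrable f"
  shows "f \<in> borel_measurable lebesgue"
proof (rule borel_measurable_LIMSEQ_metric)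
  fix n
  show "(\<lambda>x. indicator (cball 0 (real n)) x *\<^sub>R f x) \<in> borel_measurable lebesgue"
    using assms unfolding locally_integrable_def set_integrable_def
    by (intro borel_measurable_integrable) (simp add: compact_cball)
next
  fix x :: 'a
  obtain N where N: "norm x \<le> real N" using real_arch_simple by blast
  have "eventually (\<lambda>n. f x = indicator (cball 0 (real n)) x *\<^sub>R f x) sequentially"
    using eventually_ge_at_top[of N] by eventually_elim (use N in auto)
  then show "(\<lambda>n. indicator (cball 0 (real n)) x *\<^sub>R f x) \<longlonglongrightarrow> f x"
    by (rule Lim_transform_eventually[OF tendsto_const])
qed

lemma has_weak_gradient_measurable:
  assumes "has_weak_gradient u g"
  shows "u \<in> borel_measurable lebesgue" "g \<in> borel_measurable lebesgue"
  using assms locally_integrable_measurable unfolding has_weak_gradient_def by blast+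

lemma integral_indicator_cong_AE:
  fixes u :: "'a::euclidean_space \<Rightarrow> real"
  assumes [measurable]: "u \<in> borel_measurable lebesgue" "S \<in> sets lebesgue" "T \<in> sets lebesgue"
    and "AE x in lebesgue. x \<in> S \<longleftrightarrow> x \<in> T"
  shows "(LINT x|lebesgue. indicator S x * u x) = (LINT x|lebesgue. indicator T x * u x)"
proof (rule integral_cong_AE)
  show "AE x in lebesgue. indicator S x * u x = indicator T x * u x"
    using assms(4) by eventually_elim (auto split: split_indicator)
qed measurable

lemma integrable_indicator_subset:
  fixes u :: "'a::euclidean_space \<Rightarrow> real"
  assumes "integrable lebesgue (\<lambda>x. indicator T x * u x)" "S \<subseteq> T" "S \<in> sets lebesgue"
  shows "integrable lebesgue (\<lambda>x. indicator S x * u x)"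
proof -
  have "integrable lebesgue (\<lambda>x. indicator S x *\<^sub>R (indicator T x * u x))"
    by (rule integrable_mult_indicator) (use assms in auto)
  also have "(\<lambda>x. indicator S x *\<^sub>R (indicator T x * u x)) = (\<lambda>x. indicator S x * u x)"
    using assms(2) by (auto simp: fun_eq_iff split: split_indicator)
  finally show ?thesis .
qed

lemma dcell_lebesgue [simp]: "dcell l x \<in> sets lebesgue"
  using dcell_borel by auto

lemma integrable_on_cell:
  fixes u :: "'a::euclidean_space \<Rightarrow> real"
  assumes "locally_integrable u"
  shows "integrable lebesgue (\<lambda>y. indicator (dcell l x) y * u y)"
proof (rule integrable_indicator_subset[OF _ dcell_subset_cbox])
  show "integrable lebesgue (\<lambda>y. indicator (cbox (corner l x) (opp_corner l x)) y * u y)"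
    using assms unfolding locally_integrable_def set_integrable_def by (auto simp: compact_cbox)
qed auto

lemma locally_integrable_norm:
  "locally_integrable g \<Longrightarrow> locally_integrable (\<lambda>x. norm (g x))"
  unfolding locally_integrable_def by (auto intro: absolutely_integrable_norm[unfolded o_def])

text \<open>
  The mean over a cell: the prefactor is the reciprocal of the volume of the cell.
\<close>

definition gavg :: "('a::euclidean_space \<Rightarrow> nat) \<Rightarrow> ('a \<Rightarrow> real) \<Rightarrow> 'a \<Rightarrow> real" where
  "gavg l u x = (\<Prod>b\<in>Basis. 2 ^ l b) * (LINT y|lebesgue. indicator (dcell l x) y * u y)"

abbreviation avg :: "nat \<Rightarrow> ('a::euclidean_space \<Rightarrow> real) \<Rightarrow> 'a \<Rightarrow> real" where
  "avg j \<equiv> gavg (\<lambda>_. j)"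

lemma floor_double: "\<lfloor>2 * s\<rfloor> = 2 * \<lfloor>s\<rfloor> + (if s < of_int \<lfloor>s\<rfloor> + 1 / 2 then 0 else 1)" for s :: real
proof (rule floor_unique)
qed (auto simp: split: if_splits, linarith+)

lemma mem_halved_dcell_iff:
  fixes l :: "'a::euclidean_space \<Rightarrow> nat" and x :: 'a
  assumes b: "b \<in> Basis"
  defines "m \<equiv> (corner l x \<bullet> b + opp_corner l x \<bullet> b) / 2"
  shows "y \<in> dcell (l(b := Suc (l b))) x \<longleftrightarrow> y \<in> dcell l x \<and> (y \<bullet> b < m \<longleftrightarrow> x \<bullet> b < m)"
proof -
  let ?F = "\<lambda>y b. \<lfloor>2 ^ l b * (y \<bullet> b)\<rfloor>"
  have m: "m = (of_int (?F x b) + 1 / 2) / 2 ^ l b"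
    using b by (simp add: m_def add_divide_distrib)
  have lt: "t < m \<longleftrightarrow> 2 ^ l b * t < of_int (?F x b) + 1 / 2" for t
    unfolding m by (simp add: pos_less_divide_eq mult.commute)
  have half: "\<lfloor>2 ^ Suc (l b) * (y \<bullet> b)\<rfloor> = \<lfloor>2 ^ Suc (l b) * (x \<bullet> b)\<rfloor> \<longleftrightarrow>
      ?F y b = ?F x b \<and> (y \<bullet> b < m \<longleftrightarrow> x \<bullet> b < m)"
  proof -
    have "\<lfloor>2 ^ Suc (l b) * (z \<bullet> b)\<rfloor> = 2 * ?F z b + (if 2 ^ l b * (z \<bullet> b) < of_int (?F z b) + 1 / 2 then 0 else 1)" for z
      using floor_double[of "2 ^ l b * (z \<bullet> b)"] by (simp add: mult.assoc)
    then show ?thesis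
      unfolding lt by (auto split: if_splits) presburger+
  qed
  have "y \<in> dcell (l(b := Suc (l b))) x \<longleftrightarrow>
      (\<forall>i\<in>Basis - {b}. ?F y i = ?F x i) \<and> \<lfloor>2 ^ Suc (l b) * (y \<bullet> b)\<rfloor> = \<lfloor>2 ^ Suc (l b) * (x \<bullet> b)\<rfloor>"
    using b unfolding dcell_def by auto
  also have "\<dots> \<longleftrightarrow> y \<in> dcell l x \<and> (y \<bullet> b < m \<longleftrightarrow> x \<bullet> b < m)"
    unfolding half using b unfolding dcell_def by auto
  finally show ?thesis .
qed

text \<open>
  The mean over one half differs from the mean over the whole box by half the difference of the means
  over the two halves.
\<close>

lemma gavg_halving:
  fixes u :: "'a::euclidean_space \<Rightarrow> real"
  assumes wg: "has_weak_gradient u g" and b: "b \<in> Basis"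
  shows "\<bar>gavg (l(b := Suc (l b))) u x - gavg l u x\<bar> \<le> 1 / 2 ^ l b * gavg l (\<lambda>y. norm (g y)) x"
proof -
  define a c where "a = corner l x" and "c = opp_corner l x"
  define m where "m = (a \<bullet> b + c \<bullet> b) / 2"
  define P where "P = (\<Prod>i\<in>(Basis::'a set). (2::real) ^ l i)"
  have P: "P > 0" by (auto simp: P_def intro: prod_pos)
  have P': "(\<Prod>i\<in>(Basis::'a set). (2::real) ^ (l(b := Suc (l b))) i) = 2 * P"
    using b unfolding P_def by (simp add: prod.remove[of Basis b])
  note [measurable] = has_weak_gradient_measurable[OF wg]
  let ?L = "box a c \<inter> {y. y \<bullet> b < m}" and ?R = "box a c \<inter> {y. m < y \<bullet> b}"
  define I where "I S = (LINT y|lebesgue. indicator S y * u y)" for S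
  have LR: "?L \<in> sets lebesgue" "?R \<in> sets lebesgue"
    by (auto intro!: borel_open open_Int open_halfspace_component_lt open_halfspace_component_gt)
  have int: "integrable lebesgue (\<lambda>y. indicator S y * u y)" if "S \<subseteq> box a c" "S \<in> sets lebesgue" for S
    by (rule integrable_indicator_subset[OF has_weak_gradient_integrable_cbox(1)[OF wg, of a c]])
       (use that box_subset_cbox[of a c] in auto)
  have "negligible {y. y \<bullet> b = m}" using b by (rule negligible_standard_hyperplane)
  then have "AE y in lebesgue. y \<notin> {y. y \<bullet> b = m}"
    by (intro AE_not_in) (simp add: negligible_iff_null_sets)
  moreover have "AE y in lebesgue. y \<in> dcell l x \<longleftrightarrow> y \<in> box a c"
    unfolding a_def c_def using dcell_AE_box by (rule AE_completion)
  ultimately have ae: "AE y in lebesgue. y \<bullet> b \<noteq> m \<and> (y \<in> dcell l x \<longleftrightarrow> y \<in> box a c)"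
    by eventually_elim simp
  have half: "y \<in> dcell (l(b := Suc (l b))) x \<longleftrightarrow> y \<in> dcell l x \<and> (y \<bullet> b < m \<longleftrightarrow> x \<bullet> b < m)" for y
    unfolding m_def a_def c_def by (rule mem_halved_dcell_iff[OF b])
  have whole: "I (dcell l x) = I ?L + I ?R"
  proof -
    have "I (dcell l x) = I (?L \<union> ?R)"
      unfolding I_def
    proof (intro integral_indicator_cong_AE)
      show "AE y in lebesgue. y \<in> dcell l x \<longleftrightarrow> y \<in> ?L \<union> ?R"
        using ae by eventually_elim auto
    qed (use LR in auto)
    also have "\<dots> = (LINT y|lebesgue. indicator ?L y * u y + indicator ?R y * u y)"
      unfolding I_def by (intro Bochner_Integration.integral_cong) (auto split: split_indicator)
    also have "\<dots> = I ?L + I ?R"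
      unfolding I_def by (rule Bochner_Integration.integral_add) (use int LR in auto)
    finally show ?thesis .
  qed
  have part: "I (dcell (l(b := Suc (l b))) x) = (if x \<bullet> b < m then I ?L else I ?R)"
  proof (cases "x \<bullet> b < m")
    case True
    have "I (dcell (l(b := Suc (l b))) x) = I ?L"
      unfolding I_def
    proof (intro integral_indicator_cong_AE)
      show "AE y in lebesgue. y \<in> dcell (l(b := Suc (l b))) x \<longleftrightarrow> y \<in> ?L"
        using ae by eventually_elim (auto simp: half True)
    qed (use LR in auto)
    then show ?thesis using True by simp
  next
    case False
    have "I (dcell (l(b := Suc (l b))) x) = I ?R"
      unfolding I_def
    proof (intro integral_indicator_cong_AE)
      show "AE y in lebesgue. y \<in> dcell (l(b := Suc (l b))) x \<longleftrightarrow> y \<in> ?R"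
        using ae by eventually_elim (auto simp: half False)
    qed (use LR in auto)
    then show ?thesis using False by simp
  qed
  have "\<bar>gavg (l(b := Suc (l b))) u x - gavg l u x\<bar> = \<bar>P * (I ?L - I ?R)\<bar>"
    unfolding gavg_def P' P_def[symmetric] I_def[symmetric] whole part
    by (auto simp: algebra_simps abs_minus_commute)
  also have "\<dots> = P * \<bar>I ?L - I ?R\<bar>" using P by (simp add: abs_mult)
  also have "I ?L - I ?R = (LINT y|lebesgue. indicator ?L y * u y - indicator ?R y * u y)"
    unfolding I_def using int LR by (intro Bochner_Integration.integral_diff[symmetric]) auto
  also have "\<dots> = (LINT y|lebesgue. u y * (indicator ?L y - indicator ?R y))"
    by (intro Bochner_Integration.integral_cong) (auto simp: algebra_simps)
  also have "\<bar>\<dots>\<bar> \<le> (c \<bullet> b - a \<bullet> b) / 2 * (LINT y|lebesgue. indicator (cbox a c) y * norm (g y))"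
    unfolding m_def by (rule weak_gradient_halving[OF wg b]) (use b in \<open>simp add: a_def c_def\<close>)
  also have "(LINT y|lebesgue. indicator (cbox a c) y * norm (g y)) = (LINT y|lebesgue. indicator (dcell l x) y * norm (g y))"
  proof (rule integral_indicator_cong_AE)
    have "negligible (cbox a c - box a c)" by (rule negligible_frontier_interval)
    then have "AE y in lebesgue. y \<notin> cbox a c - box a c"
      by (intro AE_not_in) (simp add: negligible_iff_null_sets)
    with ae show "AE y in lebesgue. y \<in> cbox a c \<longleftrightarrow> y \<in> dcell l x"
      by eventually_elim (use box_subset_cbox[of a c] in auto)
  qed auto
  also have "(c \<bullet> b - a \<bullet> b) / 2 = 1 / 2 ^ l b / 2"
    using b by (simp add: a_def c_def)
  also have "P * (1 / 2 ^ l b / 2 * (LINT y|lebesgue. indicator (dcell l x) y * norm (g y)))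
      = 1 / 2 ^ l b * gavg l (\<lambda>y. norm (g y)) x / 2"
    by (simp add: gavg_def P_def)
  also have "\<dots> \<le> 1 / 2 ^ l b * gavg l (\<lambda>y. norm (g y)) x"
  proof -
    have "0 \<le> 1 / 2 ^ l b * gavg l (\<lambda>y. norm (g y)) x"
      unfolding gavg_def by (intro mult_nonneg_nonneg Bochner_Integration.integral_nonneg prod_nonneg) auto
    moreover have "t / 2 \<le> t" if "0 \<le> t" for t :: real
      using that by simp
    ultimately show ?thesis by blast
  qed
  finally show ?thesis by this (use P in \<open>simp add: mult_left_mono\<close>)
qed

text \<open>
  A cube of generation $j+1$ arises from its parent by halving once in each of the $N$ directions; the
  intermediate boxes lie in the parent and have at least $2^{-N}$ of its volume.
\<close>

lemma avg_increment_le: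
  fixes u :: "'a::euclidean_space \<Rightarrow> real"
  assumes wg: "has_weak_gradient u g"
  shows "\<bar>avg (Suc j) u x - avg j u x\<bar> \<le> real DIM('a) * 2 ^ DIM('a) / 2 ^ j * avg j (\<lambda>y. norm (g y)) x"
proof -
  \<comment> \<open>the level function after halving in the directions of \<open>S\<close>\<close>
  define lev :: "'a set \<Rightarrow> 'a \<Rightarrow> nat" where "lev S b = (if b \<in> S then Suc j else j)" for S b
  define G where "G = avg j (\<lambda>y. norm (g y)) x"
  have lg: "locally_integrable (\<lambda>y. norm (g y))"
    using wg locally_integrable_norm unfolding has_weak_gradient_def by blast
  have G: "gavg (lev S) (\<lambda>y. norm (g y)) x \<le> 2 ^ DIM('a) * G" for S
  proof -
    have "(\<Prod>b\<in>(Basis::'a set). (2::real) ^ lev S b) \<le> (\<Prod>b\<in>(Basis::'a set). 2 * 2 ^ j)"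
      by (intro prod_mono) (auto simp: lev_def)
    moreover have "(LINT y|lebesgue. indicator (dcell (lev S) x) y * norm (g y))
        \<le> (LINT y|lebesgue. indicator (cell j x) y * norm (g y))"
    proof -
      have "dcell (lev S) x \<subseteq> cell j x"
        by (rule dcell_mono) (simp add: lev_def)
      then show ?thesis
        using integrable_on_cell[OF lg] by (intro integral_mono) (auto split: split_indicator)
    qed
    ultimately have "gavg (lev S) (\<lambda>y. norm (g y)) x \<le>
        (\<Prod>b\<in>(Basis::'a set). 2 * 2 ^ j) * (LINT y|lebesgue. indicator (cell j x) y * norm (g y))"
      unfolding gavg_def by (intro mult_mono) (auto intro: Bochner_Integration.integral_nonneg prod_nonneg)
    then show ?thesis
      by (simp add: G_def gavg_def power_mult_distrib mult.assoc)
  qed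
  have "\<bar>gavg (lev S) u x - avg j u x\<bar> \<le> real (card S) * (2 ^ DIM('a) / 2 ^ j * G)" if "finite S" "S \<subseteq> Basis" for S
    using that
  proof (induction S rule: finite_induct)
    case empty
    have "lev {} = (\<lambda>_. j)" by (simp add: lev_def fun_eq_iff)
    then show ?case by simp
  next
    case (insert b S)
    then have b: "b \<in> Basis" by simp
    have l: "lev (insert b S) = (lev S)(b := Suc (lev S b))" "lev S b = j"
      using insert.hyps by (auto simp: lev_def fun_eq_iff)
    have "\<bar>gavg (lev (insert b S)) u x - gavg (lev S) u x\<bar> \<le> 1 / 2 ^ j * gavg (lev S) (\<lambda>y. norm (g y)) x"
      using gavg_halving[OF wg b, of "lev S" x] unfolding l .
    also have "\<dots> \<le> 1 / 2 ^ j * (2 ^ DIM('a) * G)"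
      by (intro mult_left_mono G) auto
    finally have "\<bar>gavg (lev (insert b S)) u x - gavg (lev S) u x\<bar> \<le> 2 ^ DIM('a) / 2 ^ j * G" by simp
    moreover have "\<bar>gavg (lev S) u x - avg j u x\<bar> \<le> real (card S) * (2 ^ DIM('a) / 2 ^ j * G)"
      using insert by simp
    moreover have "real (card (insert b S)) * D = real (card S) * D + D" for D
      using insert.hyps by (simp add: algebra_simps)
    ultimately show ?case by (smt (verit))
  qed
  from this[of Basis] have "\<bar>gavg (lev Basis) u x - avg j u x\<bar> \<le> real DIM('a) * (2 ^ DIM('a) / 2 ^ j * G)"
    by simp
  moreover have "gavg (lev Basis) u x = avg (Suc j) u x"
  proof -
    have "dcell (lev Basis) x = cell (Suc j) x" by (auto simp: dcell_def lev_def)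
    then show ?thesis by (simp add: gavg_def lev_def)
  qed
  ultimately show ?thesis by (simp add: G_def)
qed

section \<open>Averages of nonnegative functions\<close>

text \<open>
  The same mean for functions with values in $[0,\infty]$, the form to which Tonelli applies.
\<close>

definition navg :: "nat \<Rightarrow> ('a::euclidean_space \<Rightarrow> ennreal) \<Rightarrow> 'a \<Rightarrow> ennreal" where
  "navg j f x = ennreal (2 ^ (j * DIM('a))) * (\<integral>\<^sup>+y. f y * indicator (cell j x) y \<partial>lborel)"

lemma navg_cong_AE:
  "AE y in lborel. f y = f' y \<Longrightarrow> navg j f x = navg j f' x"
  unfolding navg_def by (intro arg_cong2[where f="(*)"] refl nn_integral_cong_AE) (auto elim: eventually_mono)

lemma navg_mono_AE:
  "AE y in lborel. f y \<le> f' y \<Longrightarrow> navg j f x \<le> navg j f' x"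
  unfolding navg_def by (intro mult_left_mono nn_integral_mono_AE) (auto elim!: eventually_mono intro: mult_right_mono)

lemma navg_cell: "y \<in> cell j x \<Longrightarrow> navg j f y = navg j f x"
  by (simp add: navg_def dcell_eq)

lemma gavg_dcell: "y \<in> dcell l x \<Longrightarrow> gavg l f y = gavg l f x"
  by (simp add: gavg_def dcell_eq)

lemma navg_measurable [measurable]: "navg j f \<in> borel_measurable borel"
  by (rule measurable_const_on_cells[of j]) (auto simp: navg_cell)

lemma avg_measurable [measurable]: "avg j f \<in> borel_measurable borel"
  by (rule measurable_const_on_cells[of j]) (auto simp: gavg_dcell)

lemma lebesgue_measurable_Borel_version:
  fixes f :: "'a::euclidean_space \<Rightarrow> ennreal"
  assumes "f \<in> borel_measurable lebesgue"
  obtains f' where "f' \<in> borel_measurable borel" "AE x in lborel. f x = f' x"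
  using completion_ex_borel_measurable[OF assms] by auto

text \<open>
  Being in the same cell is a symmetric relation, so by Tonelli averaging is self-adjoint, and it fixes
  the constant function $1$.
\<close>

lemma nn_integral_navg:
  fixes f :: "'a::euclidean_space \<Rightarrow> ennreal"
  assumes "f \<in> borel_measurable lebesgue"
  shows "(\<integral>\<^sup>+x. navg j f x \<partial>lborel) = (\<integral>\<^sup>+x. f x \<partial>lborel)"
proof -
  obtain f' where f'[measurable]: "f' \<in> borel_measurable borel" and ae: "AE x in lborel. f x = f' x"
    using lebesgue_measurable_Borel_version[OF assms] .
  let ?c = "ennreal (2 ^ (j * DIM('a)))"
  have [measurable]: "Measurable.pred (lborel \<Otimes>\<^sub>M lborel) (\<lambda>p::'a \<times> 'a. snd p \<in> cell j (fst p))"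
    unfolding dcell_def by measurable
  have "(\<integral>\<^sup>+x. navg j f x \<partial>lborel) = (\<integral>\<^sup>+x. navg j f' x \<partial>lborel)"
    using navg_cong_AE[OF ae] by simp
  also have "\<dots> = ?c * (\<integral>\<^sup>+x. (\<integral>\<^sup>+y. f' y * indicator (cell j x) y \<partial>lborel) \<partial>lborel)"
    unfolding navg_def by (intro nn_integral_cmult) (simp add: indicator_def)
  also have "(\<integral>\<^sup>+x. (\<integral>\<^sup>+y. f' y * indicator (cell j x) y \<partial>lborel) \<partial>lborel)
      = (\<integral>\<^sup>+y. (\<integral>\<^sup>+x. f' y * indicator (cell j x) y \<partial>lborel) \<partial>lborel)"
    by (rule lborel_pair.Fubini'[symmetric]) (simp add: indicator_def split_beta')
  also have "\<dots> = (\<integral>\<^sup>+y. (\<integral>\<^sup>+x. f' y * indicator (cell j y) x \<partial>lborel) \<partial>lborel)"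
    by (intro nn_integral_cong) (auto simp: indicator_def dcell_sym)
  also have "\<dots> = (\<integral>\<^sup>+y. f' y * ennreal (1 / 2 ^ (j * DIM('a))) \<partial>lborel)"
    by (intro nn_integral_cong) (simp add: nn_integral_cmult_indicator emeasure_cell)
  also have "\<dots> = (\<integral>\<^sup>+y. f' y \<partial>lborel) * ennreal (1 / 2 ^ (j * DIM('a)))"
    by (rule nn_integral_multc) simp
  also have "?c * \<dots> = (\<integral>\<^sup>+y. f' y \<partial>lborel)"
    by (simp add: mult.left_commute flip: ennreal_mult)
  also have "\<dots> = (\<integral>\<^sup>+y. f y \<partial>lborel)"
    using ae by (intro nn_integral_cong_AE) (auto elim: eventually_mono)
  finally show ?thesis .
qed

lemma nn_integral_navg_saturated:
  fixes f :: "'a::euclidean_space \<Rightarrow> ennreal"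
  assumes f: "f \<in> borel_measurable lebesgue" and S: "S \<in> sets lebesgue"
    and sat: "\<And>x y. x \<in> S \<Longrightarrow> y \<in> cell j x \<Longrightarrow> y \<in> S"
  shows "(\<integral>\<^sup>+x. navg j f x * indicator S x \<partial>lborel) = (\<integral>\<^sup>+x. f x * indicator S x \<partial>lborel)"
proof -
  have "navg j f x * indicator S x = navg j (\<lambda>y. f y * indicator S y) x" for x
  proof (cases "x \<in> S")
    case True
    have "(\<lambda>y. f y * indicator S y * indicator (cell j x) y) = (\<lambda>y. f y * indicator (cell j x) y)"
      using sat[OF True] by (auto simp: fun_eq_iff split: split_indicator)
    then show ?thesis using True by (simp add: navg_def)
  next
    case False
    then have "y \<notin> S" if "y \<in> cell j x" for y
      using sat dcell_sym that by blast
    then have "(\<lambda>y. f y * indicator S y * indicator (cell j x) y) = (\<lambda>y. 0)"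
      by (auto simp: fun_eq_iff split: split_indicator)
    then show ?thesis using False by (simp add: navg_def)
  qed
  moreover have "(\<lambda>y. f y * indicator S y) \<in> borel_measurable lebesgue"
    using f S by measurable
  ultimately show ?thesis
    using nn_integral_navg by simp
qed

lemma nn_integral_indicator_eq_lint:
  fixes u :: "'a::euclidean_space \<Rightarrow> real"
  assumes "integrable lebesgue (\<lambda>y. indicator S y * u y)" "\<And>y. u y \<ge> 0"
  shows "(\<integral>\<^sup>+y. ennreal (u y) * indicator S y \<partial>lborel) = ennreal (LINT y|lebesgue. indicator S y * u y)"
proof -
  have "(\<integral>\<^sup>+y. ennreal (u y) * indicator S y \<partial>lborel) = (\<integral>\<^sup>+y. ennreal (u y) * indicator S y \<partial>lebesgue)"
    by (simp add: nn_integral_completion)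
  also have "\<dots> = (\<integral>\<^sup>+y. ennreal (indicator S y * u y) \<partial>lebesgue)"
    by (intro nn_integral_cong) (auto split: split_indicator)
  also have "\<dots> = ennreal (LINT y|lebesgue. indicator S y * u y)"
    by (rule nn_integral_eq_integral[OF assms(1)]) (use assms(2) in auto)
  finally show ?thesis .
qed

lemma navg_eq_avg:
  fixes u :: "'a::euclidean_space \<Rightarrow> real"
  assumes "locally_integrable u" "\<And>y. u y \<ge> 0"
  shows "navg j (\<lambda>y. ennreal (u y)) x = ennreal (avg j u x)"
proof -
  have "(LINT y|lebesgue. indicator (cell j x) y * u y) \<ge> 0"
    using assms(2) by (intro Bochner_Integration.integral_nonneg) auto
  then show ?thesis
    unfolding navg_def gavg_def
    using nn_integral_indicator_eq_lint[OF integrable_on_cell[OF assms(1)] assms(2)]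
    by (simp add: ennreal_mult power_mult)
qed

lemma powr_ge_tangent:
  fixes t m r :: real
  assumes "t \<ge> 0" "m \<ge> 0" "r \<ge> 1"
  shows "m powr r + r * m powr (r - 1) * t \<le> t powr r + r * m powr (r - 1) * m"
proof (cases "t = 0 \<or> m = 0")
  case True
  show ?thesis
  proof (cases "m = 0")
    case False
    then have "m powr (r - 1) * m = m powr r"
      using assms by (simp add: powr_diff)
    moreover have "m powr r \<le> r * m powr r"
      using assms mult_right_mono[of 1 r "m powr r"] by simp
    ultimately show ?thesis using True False by (simp add: mult.assoc)
  qed simp
next
  case False
  then have t: "t > 0" "m > 0" using assms by auto
  have "(\<lambda>x. x powr r) t - (\<lambda>x. x powr r) m \<ge> (r * m powr (r - 1)) * (t - m)"
  proof (rule convex_on_imp_above_tangent[where A="{0<..}"])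
    show "convex_on {0<..} (\<lambda>x::real. x powr r)" by (rule powr_convex[OF assms(3)])
    show "((\<lambda>x. x powr r) has_real_derivative r * m powr (r - 1)) (at m within {0<..})"
      using t by (auto intro!: derivative_eq_intros)
  qed (use t in \<open>auto simp: interior_open\<close>)
  then show ?thesis by (simp add: algebra_simps)
qed

text \<open>
  Jensen's inequality, by integrating the tangent inequality of $t\mapsto t^r$ at the mean value.
\<close>

lemma avg_powr_le:
  fixes u :: "'a::euclidean_space \<Rightarrow> real"
  assumes u: "locally_integrable u" and r: "r \<ge> 1"
  shows "ennreal (\<bar>avg j u x\<bar> powr r) \<le> navg j (\<lambda>y. ennreal (\<bar>u y\<bar> powr r)) x"
proof -
  define m where "m = \<bar>avg j u x\<bar>"
  define c where "c = r * m powr (r - 1)"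
  have m: "m \<ge> 0" and c: "c \<ge> 0" using r by (auto simp: m_def c_def)
  have [measurable]: "u \<in> borel_measurable lebesgue"
    using u by (rule locally_integrable_measurable)
  have [measurable]: "cell j x \<in> sets lebesgue" by simp
  have one: "navg j (\<lambda>y. ennreal k) x = ennreal k" for k
    by (simp add: navg_def nn_integral_cmult_indicator emeasure_cell mult.left_commute flip: ennreal_mult)
  have add: "navg j (\<lambda>y. f y + g y) x = navg j f x + navg j g x"
    if "f \<in> borel_measurable lebesgue" "g \<in> borel_measurable lebesgue" for f g
  proof -
    have "(\<integral>\<^sup>+y. (f y + g y) * indicator (cell j x) y \<partial>lebesgue)
      = (\<integral>\<^sup>+y. f y * indicator (cell j x) y \<partial>lebesgue) + (\<integral>\<^sup>+y. g y * indicator (cell j x) y \<partial>lebesgue)"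
      unfolding distrib_right
    proof (rule nn_integral_add)
      note [measurable] = that
      show "(\<lambda>y. f y * indicator (cell j x) y) \<in> borel_measurable lebesgue"
        "(\<lambda>y. g y * indicator (cell j x) y) \<in> borel_measurable lebesgue" by measurable
    qed
    then show ?thesis unfolding navg_def by (simp add: nn_integral_completion distrib_left)
  qed
  have cmult: "navg j (\<lambda>y. ennreal c * ennreal \<bar>u y\<bar>) x = ennreal c * navg j (\<lambda>y. ennreal \<bar>u y\<bar>) x"
  proof -
    have "(\<integral>\<^sup>+y. ennreal c * ennreal \<bar>u y\<bar> * indicator (cell j x) y \<partial>lebesgue)
      = ennreal c * (\<integral>\<^sup>+y. ennreal \<bar>u y\<bar> * indicator (cell j x) y \<partial>lebesgue)"
      unfolding mult.assoc by (rule nn_integral_cmult) measurable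
    then show ?thesis unfolding navg_def by (simp add: nn_integral_completion mult.left_commute)
  qed
  have lu: "locally_integrable (\<lambda>y. \<bar>u y\<bar>)" using locally_integrable_norm[OF u] by simp
  have A: "navg j (\<lambda>y. ennreal \<bar>u y\<bar>) x = ennreal (avg j (\<lambda>y. \<bar>u y\<bar>) x)"
    by (rule navg_eq_avg[OF lu]) simp
  have mA: "m \<le> avg j (\<lambda>y. \<bar>u y\<bar>) x"
  proof -
    have "\<bar>LINT y|lebesgue. indicator (cell j x) y * u y\<bar> \<le> (LINT y|lebesgue. indicator (cell j x) y * \<bar>u y\<bar>)"
      using integral_abs_bound[of lebesgue "\<lambda>y. indicator (cell j x) y * u y"] by (simp add: abs_mult)
    then show ?thesis
      unfolding m_def gavg_def abs_mult by (intro mult_mono) auto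
  qed
  have "ennreal (m powr r) + ennreal (c * m) \<le> ennreal (m powr r) + ennreal (c * avg j (\<lambda>y. \<bar>u y\<bar>) x)"
    using mA c by (intro add_left_mono ennreal_leI mult_left_mono)
  also have "\<dots> = navg j (\<lambda>y. ennreal (m powr r) + ennreal c * ennreal \<bar>u y\<bar>) x"
    using c mA m by (subst add) (auto simp: one cmult A ennreal_mult)
  also have "\<dots> \<le> navg j (\<lambda>y. ennreal (\<bar>u y\<bar> powr r) + ennreal (c * m)) x"
  proof (intro navg_mono_AE AE_I2)
    fix y
    show "ennreal (m powr r) + ennreal c * ennreal \<bar>u y\<bar> \<le> ennreal (\<bar>u y\<bar> powr r) + ennreal (c * m)"
      using powr_ge_tangent[of "\<bar>u y\<bar>" m r] m c r
      by (simp add: c_def flip: ennreal_mult ennreal_plus)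
  qed
  also have "\<dots> = navg j (\<lambda>y. ennreal (\<bar>u y\<bar> powr r)) x + ennreal (c * m)"
    by (subst add) (auto simp: one)
  finally show ?thesis
    by (simp add: m_def[symmetric])
qed

lemma locally_integrable_bound:
  fixes u v :: "'a::euclidean_space \<Rightarrow> real"
  assumes u: "locally_integrable u" and v [measurable]: "v \<in> borel_measurable lebesgue"
    and le: "\<And>y. \<bar>v y\<bar> \<le> \<bar>u y\<bar>"
  shows "locally_integrable v"
  unfolding locally_integrable_def set_integrable_def
proof (intro allI impI)
  fix K :: "'a set" assume K: "compact K"
  then have [measurable]: "K \<in> sets lebesgue" by (simp add: lmeasurable_compact fmeasurableD)
  show "integrable lebesgue (\<lambda>x. indicator K x *\<^sub>R v x)"
  proof (rule Bochner_Integration.integrable_bound)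
    show "integrable lebesgue (\<lambda>x. indicator K x *\<^sub>R u x)"
      using u K by (simp add: locally_integrable_def set_integrable_def)
    show "AE x in lebesgue. norm (indicator K x *\<^sub>R v x) \<le> norm (indicator K x *\<^sub>R u x)"
      using le by (intro AE_I2) (auto split: split_indicator)
  qed measurable
qed

text \<open>
  For $j\ge i$ a cell of generation $i$ is a union of cells of generation $j$; the nonnegative case is
  applied to the positive and negative parts.
\<close>

lemma integral_avg_over_cell:
  fixes u :: "'a::euclidean_space \<Rightarrow> real"
  assumes u: "locally_integrable u" and "i \<le> j"
  shows "integrable lebesgue (\<lambda>y. indicator (cell i x) y * avg j u y)"
    and "(LINT y|lebesgue. indicator (cell i x) y * avg j u y) = (LINT y|lebesgue. indicator (cell i x) y * u y)"
proof -
  let ?Q = "cell i x"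
  have sat: "z \<in> ?Q" if "y \<in> ?Q" "z \<in> cell j y" for y z
    using that dcell_mono[of "\<lambda>_. i" "\<lambda>_. j" y] dcell_eq[of y "\<lambda>_. i" x] assms(2) by auto
  have pos: "integrable lebesgue (\<lambda>y. indicator ?Q y * avg j v y) \<and>
      (LINT y|lebesgue. indicator ?Q y * avg j v y) = (LINT y|lebesgue. indicator ?Q y * v y)"
    if v: "locally_integrable v" "\<And>y. v y \<ge> 0" for v
  proof -
    have [measurable]: "v \<in> borel_measurable lebesgue" using v(1) by (rule locally_integrable_measurable)
    have A0: "avg j v y \<ge> 0" for y
      unfolding gavg_def using v(2) by (intro mult_nonneg_nonneg Bochner_Integration.integral_nonneg prod_nonneg) auto
    have "(\<integral>\<^sup>+y. ennreal (indicator ?Q y * avg j v y) \<partial>lebesgue) = (\<integral>\<^sup>+y. navg j (\<lambda>y. ennreal (v y)) y * indicator ?Q y \<partial>lborel)"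
      unfolding nn_integral_completion
      by (intro nn_integral_cong) (auto simp: navg_eq_avg[OF v] split: split_indicator)
    also have "\<dots> = (\<integral>\<^sup>+y. ennreal (v y) * indicator ?Q y \<partial>lborel)"
      by (rule nn_integral_navg_saturated) (use sat in auto)
    also have "\<dots> = ennreal (LINT y|lebesgue. indicator ?Q y * v y)"
      by (rule nn_integral_indicator_eq_lint[OF integrable_on_cell[OF v(1)] v(2)])
    finally have *: "(\<integral>\<^sup>+y. ennreal (indicator ?Q y * avg j v y) \<partial>lebesgue) = ennreal (LINT y|lebesgue. indicator ?Q y * v y)" .
    have m: "(\<lambda>y. indicator ?Q y * avg j v y) \<in> borel_measurable lebesgue"
      by (rule borel_imp_lebesgue) measurable
    have i: "integrable lebesgue (\<lambda>y. indicator ?Q y * avg j v y)"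
      using * m A0 by (intro integrableI_nonneg) auto
    moreover have "(LINT y|lebesgue. indicator ?Q y * avg j v y) = (LINT y|lebesgue. indicator ?Q y * v y)"
      using integral_eq_nn_integral[OF m] A0 v(2) unfolding *
      by (simp add: Bochner_Integration.integral_nonneg)
    ultimately show ?thesis by blast
  qed
  define up un where "up y = max (u y) 0" and "un y = max (- u y) 0" for y
  have lp: "locally_integrable up" and ln: "locally_integrable un"
  proof -
    have [measurable]: "u \<in> borel_measurable lebesgue" using u by (rule locally_integrable_measurable)
    have "up \<in> borel_measurable lebesgue" "un \<in> borel_measurable lebesgue"
      unfolding up_def[abs_def] un_def[abs_def] by measurable
    then show "locally_integrable up" "locally_integrable un"
      by (auto intro!: locally_integrable_bound[OF u] simp: up_def un_def)
  qed
  have uu: "u y = up y - un y" for y by (auto simp: up_def un_def)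
  have diff: "(LINT y|lebesgue. indicator (cell k z) y * u y) =
      (LINT y|lebesgue. indicator (cell k z) y * up y) - (LINT y|lebesgue. indicator (cell k z) y * un y)" for k z
    unfolding Bochner_Integration.integral_diff[OF integrable_on_cell[OF lp] integrable_on_cell[OF ln], symmetric]
    by (simp add: uu right_diff_distrib)
  have avgu: "avg j u y = avg j up y - avg j un y" for y
    unfolding gavg_def diff by (simp add: right_diff_distrib)
  have P: "up y \<ge> 0" "un y \<ge> 0" for y by (auto simp: up_def un_def)
  note P1 = pos[OF lp P(1)] and P2 = pos[OF ln P(2)]
  show "integrable lebesgue (\<lambda>y. indicator ?Q y * avg j u y)"
    unfolding avgu right_diff_distrib using P1 P2 by (intro Bochner_Integration.integrable_diff) auto
  have "(LINT y|lebesgue. indicator ?Q y * avg j u y) =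
      (LINT y|lebesgue. indicator ?Q y * avg j up y) - (LINT y|lebesgue. indicator ?Q y * avg j un y)"
    unfolding avgu right_diff_distrib using P1 P2 by (intro Bochner_Integration.integral_diff) auto
  then show "(LINT y|lebesgue. indicator ?Q y * avg j u y) = (LINT y|lebesgue. indicator ?Q y * u y)"
    unfolding diff using P1 P2 by simp
qed

section \<open>Almost everywhere convergence of dyadic averages\<close>

lemma convergent_of_geometric_increments:
  fixes a :: "nat \<Rightarrow> real"
  assumes d: "\<And>i. \<bar>a (Suc i) - a i\<bar> \<le> H * \<theta> ^ i" and \<theta>: "0 < \<theta>" "\<theta> < 1"
  shows "convergent a" and "\<bar>lim a - a 0\<bar> \<le> H / (1 - \<theta>)"
proof -
  have s: "summable (\<lambda>i. H * \<theta> ^ i)"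
    using \<theta> by (intro summable_mult summable_geometric) auto
  have abs: "summable (\<lambda>i. \<bar>a (Suc i) - a i\<bar>)"
    by (rule summable_comparison_test'[OF s, of 0]) (use d in auto)
  then have "summable (\<lambda>i. a (Suc i) - a i)" by (rule summable_rabs_cancel)
  then obtain L where "(\<lambda>n. \<Sum>i<n. a (Suc i) - a i) \<longlonglongrightarrow> L" 
    unfolding summable_def sums_def by blast
  then have "(\<lambda>n. (a n - a 0) + a 0) \<longlonglongrightarrow> L + a 0"
    unfolding sum_lessThan_telescope by (intro tendsto_intros)
  then have conv: "a \<longlonglongrightarrow> L + a 0" by simp
  then show "convergent a" by (rule convergentI)
  have "lim a - a 0 = L" using conv limI by fastforce
  moreover have "L = (\<Sum>i. a (Suc i) - a i)"
    using \<open>(\<lambda>n. \<Sum>i<n. a (Suc i) - a i) \<longlonglongrightarrow> L\<close> sums_def sums_unique by blast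
  moreover have "\<bar>\<Sum>i. a (Suc i) - a i\<bar> \<le> (\<Sum>i. \<bar>a (Suc i) - a i\<bar>)"
    by (rule summable_rabs[OF abs])
  moreover have "(\<Sum>i. \<bar>a (Suc i) - a i\<bar>) \<le> (\<Sum>i. H * \<theta> ^ i)"
    by (rule suminf_le[OF d abs s])
  moreover have "(\<Sum>i. H * \<theta> ^ i) = H / (1 - \<theta>)"
    using \<theta> by (simp add: suminf_mult summable_geometric suminf_geometric)
  ultimately show "\<bar>lim a - a 0\<bar> \<le> H / (1 - \<theta>)" by linarith
qed

text \<open>
  The factors come from the two geometric series of the next proof, in powers of $\rho^{1/(2q)}$ and of $\sqrt\rho$; the first
  one enters with the power $q$.
\<close>

definition telescope_const :: "real \<Rightarrow> real \<Rightarrow> real" where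
  "telescope_const q \<rho> = (1 / (1 - sqrt \<rho> powr (1 / q))) powr q / (1 - sqrt \<rho>)"

text \<open>
  With $d_i=|a_{i+1}-a_i|$ and $\sigma=\sqrt\rho$, the series $W_j=\sum_i d_{j+i}^q\sigma^{-i}$ has integral at
  most $C\rho^j/(1-\sigma)$. Where it is finite, $d_{j+i}\le W_j^{1/q}\sigma^{i/q}$, so $(a_i)$ converges and
  $|\lim a-a_j|$ is at most a constant times $W_j^{1/q}$. This replaces the triangle inequality in $L^q$.
\<close>

lemma telescope_Lq:
  fixes a :: "nat \<Rightarrow> 'x \<Rightarrow> real"
  assumes [measurable]: "\<And>j. a j \<in> borel_measurable M"
    and q: "q \<ge> 1" and \<rho>: "0 < \<rho>" "\<rho> < 1" and C: "C \<ge> 0"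
    and inc: "\<And>j. (\<integral>\<^sup>+x. ennreal (\<bar>a (Suc j) x - a j x\<bar> powr q) \<partial>M) \<le> ennreal (C * \<rho> ^ j)"
  shows "AE x in M. convergent (\<lambda>j. a j x)"
    and "(\<integral>\<^sup>+x. ennreal (\<bar>lim (\<lambda>i. a i x) - a j x\<bar> powr q) \<partial>M) \<le> ennreal (telescope_const q \<rho> * C * \<rho> ^ j)"
proof -
  define \<sigma> \<theta> where "\<sigma> = sqrt \<rho>" and "\<theta> = \<sigma> powr (1 / q)"
  have \<sigma>: "0 < \<sigma>" "\<sigma> < 1" "\<sigma> * \<sigma> = \<rho>" using \<rho> by (auto simp: \<sigma>_def)
  have \<theta>: "0 < \<theta>" "\<theta> < 1" "\<theta> powr q = \<sigma>"
    using \<sigma> q powr_less_mono2[of "1 / q" \<sigma> 1] by (auto simp: \<theta>_def powr_powr)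
  define d where "d i x = \<bar>a (Suc i) x - a i x\<bar> powr q" for i x
  define W where "W j x = (\<Sum>i. ennreal (d (j + i) x / \<sigma> ^ i))" for j x
  have dm [measurable]: "d i \<in> borel_measurable M" for i unfolding d_def by measurable
  have Wm [measurable]: "W j \<in> borel_measurable M" for j unfolding W_def by measurable
  have W: "(\<integral>\<^sup>+x. W j x \<partial>M) \<le> ennreal (C * \<rho> ^ j / (1 - \<sigma>))" for j
  proof -
    have "(\<integral>\<^sup>+x. W j x \<partial>M) = (\<Sum>i. \<integral>\<^sup>+x. ennreal (d (j + i) x / \<sigma> ^ i) \<partial>M)"
      unfolding W_def by (rule nn_integral_suminf) measurable
    also have "\<dots> \<le> (\<Sum>i. ennreal (C * \<rho> ^ j * \<sigma> ^ i))"
    proof (rule suminf_le)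
      fix i
      have "(\<integral>\<^sup>+x. ennreal (d (j + i) x / \<sigma> ^ i) \<partial>M) = (\<integral>\<^sup>+x. ennreal (1 / \<sigma> ^ i) * ennreal (d (j + i) x) \<partial>M)"
        using \<sigma> by (intro nn_integral_cong) (simp add: d_def flip: ennreal_mult)
      also have "\<dots> = ennreal (1 / \<sigma> ^ i) * (\<integral>\<^sup>+x. ennreal (d (j + i) x) \<partial>M)"
        by (rule nn_integral_cmult) measurable
      also have "\<dots> \<le> ennreal (1 / \<sigma> ^ i) * ennreal (C * \<rho> ^ (j + i))"
        unfolding d_def by (intro mult_left_mono inc) auto
      also have "\<dots> = ennreal (1 / \<sigma> ^ i * (C * \<rho> ^ (j + i)))"
        using \<sigma> C \<rho> by (simp flip: ennreal_mult)
      also have "1 / \<sigma> ^ i * (C * \<rho> ^ (j + i)) = C * \<rho> ^ j * \<sigma> ^ i"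
        using \<sigma> by (simp add: power_add power_mult_distrib flip: \<sigma>(3))
      finally show "(\<integral>\<^sup>+x. ennreal (d (j + i) x / \<sigma> ^ i) \<partial>M) \<le> ennreal (C * \<rho> ^ j * \<sigma> ^ i)" .
    qed auto
    also have "\<dots> = ennreal (\<Sum>i. C * \<rho> ^ j * \<sigma> ^ i)"
      using \<sigma> C \<rho> by (intro suminf_ennreal2 summable_mult summable_geometric) auto
    also have "(\<Sum>i. C * \<rho> ^ j * \<sigma> ^ i) = C * \<rho> ^ j / (1 - \<sigma>)"
      using \<sigma> by (simp add: suminf_mult summable_geometric suminf_geometric)
    finally show ?thesis .
  qed
  have fin: "AE x in M. W j x < \<infinity>" for j
  proof -
    have "(\<integral>\<^sup>+x. W j x \<partial>M) < \<infinity>"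
      using W[of j] by (rule le_less_trans) simp
    then have "AE x in M. W j x \<noteq> \<infinity>"
      by (intro nn_integral_PInf_AE) auto
    then show ?thesis by eventually_elim (simp add: less_top)
  qed
  have key: "convergent (\<lambda>i. a i x)" "\<bar>lim (\<lambda>i. a i x) - a j x\<bar> powr q \<le> (1 / (1 - \<theta>)) powr q * enn2real (W j x)"
    if "W j x < \<infinity>" for j x
  proof -
    define w where "w = enn2real (W j x)"
    have w: "w \<ge> 0" "W j x = ennreal w" using that by (auto simp: w_def)
    have "\<bar>a (j + Suc i) x - a (j + i) x\<bar> \<le> w powr (1 / q) * \<theta> ^ i" for i
    proof -
      have "ennreal (d (j + i) x / \<sigma> ^ i) \<le> W j x"
        using sum_le_suminf[of "\<lambda>i. ennreal (d (j + i) x / \<sigma> ^ i)" "{i}"] by (simp add: W_def)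
      then have "d (j + i) x / \<sigma> ^ i \<le> w" using w by simp
      then have "d (j + i) x \<le> w * \<sigma> ^ i" using \<sigma> by (simp add: pos_divide_le_eq)
      then have "d (j + i) x powr (1 / q) \<le> (w * \<sigma> ^ i) powr (1 / q)"
        using q by (intro powr_mono2) (auto simp: d_def)
      also have "(w * \<sigma> ^ i) powr (1 / q) = w powr (1 / q) * \<theta> ^ i"
        using w \<sigma> by (simp add: powr_mult \<theta>_def powr_power powr_powr flip: powr_realpow)
      finally show ?thesis using q by (simp add: d_def powr_powr)
    qed
    note c = convergent_of_geometric_increments[of "\<lambda>i. a (j + i) x", simplified, OF this[simplified] \<theta>(1,2)]
    obtain L where L: "(\<lambda>i. a (j + i) x) \<longlonglongrightarrow> L" using c(1) unfolding convergent_def by blast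
    then have "(\<lambda>i. a (i + j) x) \<longlonglongrightarrow> L" by (simp add: add.commute)
    then have L': "(\<lambda>i. a i x) \<longlonglongrightarrow> L" by (rule LIMSEQ_offset)
    then show "convergent (\<lambda>i. a i x)" by (rule convergentI)
    have "\<bar>L - a j x\<bar> \<le> w powr (1 / q) / (1 - \<theta>)"
      using c(2) limI[OF L] by simp
    then have "\<bar>L - a j x\<bar> powr q \<le> (w powr (1 / q) / (1 - \<theta>)) powr q"
      using q by (intro powr_mono2) auto
    also have "\<dots> = (1 / (1 - \<theta>)) powr q * w"
      using w q \<theta> by (simp add: powr_divide powr_powr)
    finally show "\<bar>lim (\<lambda>i. a i x) - a j x\<bar> powr q \<le> (1 / (1 - \<theta>)) powr q * enn2real (W j x)"
      using limI[OF L'] by (simp add: w_def)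
  qed
  show "AE x in M. convergent (\<lambda>j. a j x)"
    using fin[of 0] by eventually_elim (rule key(1))
  have "(\<integral>\<^sup>+x. ennreal (\<bar>lim (\<lambda>i. a i x) - a j x\<bar> powr q) \<partial>M)
      \<le> (\<integral>\<^sup>+x. ennreal ((1 / (1 - \<theta>)) powr q) * W j x \<partial>M)"
  proof (rule nn_integral_mono_AE)
    show "AE x in M. ennreal (\<bar>lim (\<lambda>i. a i x) - a j x\<bar> powr q) \<le> ennreal ((1 / (1 - \<theta>)) powr q) * W j x"
      using fin[of j]
    proof eventually_elim
      fix x assume "W j x < \<infinity>"
      from ennreal_leI[OF key(2)[OF this]] this
      show "ennreal (\<bar>lim (\<lambda>i. a i x) - a j x\<bar> powr q) \<le> ennreal ((1 / (1 - \<theta>)) powr q) * W j x"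
        by (simp add: ennreal_mult)
    qed
  qed
  also have "\<dots> = ennreal ((1 / (1 - \<theta>)) powr q) * (\<integral>\<^sup>+x. W j x \<partial>M)"
    by (rule nn_integral_cmult) measurable
  also have "\<dots> \<le> ennreal ((1 / (1 - \<theta>)) powr q) * ennreal (C * \<rho> ^ j / (1 - \<sigma>))"
    by (intro mult_left_mono W) auto
  also have "\<dots> = ennreal ((1 / (1 - \<theta>)) powr q * (C * \<rho> ^ j / (1 - \<sigma>)))"
    using C \<rho> \<sigma> by (simp flip: ennreal_mult)
  also have "(1 / (1 - \<theta>)) powr q * (C * \<rho> ^ j / (1 - \<sigma>)) = telescope_const q \<rho> * C * \<rho> ^ j"
    by (simp add: telescope_const_def \<sigma>_def \<theta>_def)
  finally show "(\<integral>\<^sup>+x. ennreal (\<bar>lim (\<lambda>i. a i x) - a j x\<bar> powr q) \<partial>M) \<le> ennreal (telescope_const q \<rho> * C * \<rho> ^ j)" .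
qed

lemma cell_saturated:
  assumes "i \<le> j" "y \<in> cell i x" "z \<in> cell j y"
  shows "z \<in> cell i x"
  using assms dcell_mono[of "\<lambda>_. i" "\<lambda>_. j" y] dcell_eq[of y "\<lambda>_. i" x] by auto

lemma avg_increment_le_navg:
  fixes u :: "'a::euclidean_space \<Rightarrow> real"
  assumes wg: "has_weak_gradient u g"
  shows "ennreal \<bar>avg (Suc j) u x - avg j u x\<bar> \<le>
    ennreal (real DIM('a) * 2 ^ DIM('a) / 2 ^ j) * navg j (\<lambda>y. ennreal (norm (g y))) x"
proof -
  have lg: "locally_integrable (\<lambda>y. norm (g y))"
    using wg locally_integrable_norm unfolding has_weak_gradient_def by blast
  have "avg j (\<lambda>y. norm (g y)) x \<ge> 0"
    unfolding gavg_def by (intro mult_nonneg_nonneg Bochner_Integration.integral_nonneg prod_nonneg) auto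
  then show ?thesis
    unfolding navg_eq_avg[OF lg norm_ge_zero] using ennreal_leI[OF avg_increment_le[OF wg, of j x]]
    by (simp flip: ennreal_mult)
qed

text \<open>
  The increments are summable in $L^1$ of every unit cell, so the averages converge to some $v$ there, almost everywhere and in
  $L^1$. Averages of later generations have the same integral as $u$ over a given cell; hence so has $v$,
  and $v=u$.
\<close>

lemma AE_avg_tendsto:
  fixes u :: "'a::euclidean_space \<Rightarrow> real"
  assumes wg: "has_weak_gradient u g"
  shows "AE x in lborel. (\<lambda>j. avg j u x) \<longlonglongrightarrow> u x"
proof -
  define v where "v x = lim (\<lambda>j. avg j u x)" for x
  have lu: "locally_integrable u" and lg: "locally_integrable (\<lambda>y. norm (g y))"
    using wg locally_integrable_norm unfolding has_weak_gradient_def by blast+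
  have vm [measurable]: "v \<in> borel_measurable borel"
    unfolding v_def[abs_def] by measurable
  have gm [measurable]: "g \<in> borel_measurable lebesgue" by (rule has_weak_gradient_measurable[OF wg])
  define G where "G x = (LINT y|lebesgue. indicator (cell 0 x) y * norm (g y))" for x
  define cN where "cN = real DIM('a) * 2 ^ DIM('a)"
  have G0: "G x \<ge> 0" for x unfolding G_def by (intro Bochner_Integration.integral_nonneg) auto
  have inc: "(\<integral>\<^sup>+y. ennreal (\<bar>avg (Suc j) u y - avg j u y\<bar> powr 1) \<partial>restrict_space lborel (cell 0 x)) \<le> ennreal (cN * G x * (1 / 2) ^ j)" for j x
  proof -
    have "(\<integral>\<^sup>+y. ennreal (\<bar>avg (Suc j) u y - avg j u y\<bar> powr 1) \<partial>restrict_space lborel (cell 0 x))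
        = (\<integral>\<^sup>+y. ennreal \<bar>avg (Suc j) u y - avg j u y\<bar> * indicator (cell 0 x) y \<partial>lborel)"
      by (subst nn_integral_restrict_space) auto
    also have "\<dots> \<le> (\<integral>\<^sup>+y. ennreal (cN / 2 ^ j) * (navg j (\<lambda>y. ennreal (norm (g y))) y * indicator (cell 0 x) y) \<partial>lborel)"
      using avg_increment_le_navg[OF wg, of j]
      by (intro nn_integral_mono) (auto simp: cN_def split: split_indicator)
    also have "\<dots> = ennreal (cN / 2 ^ j) * (\<integral>\<^sup>+y. navg j (\<lambda>y. ennreal (norm (g y))) y * indicator (cell 0 x) y \<partial>lborel)"
      by (rule nn_integral_cmult) measurable
    also have "(\<integral>\<^sup>+y. navg j (\<lambda>y. ennreal (norm (g y))) y * indicator (cell 0 x) y \<partial>lborel)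
        = (\<integral>\<^sup>+y. ennreal (norm (g y)) * indicator (cell 0 x) y \<partial>lborel)"
      by (rule nn_integral_navg_saturated) (auto intro: cell_saturated[of 0 j])
    also have "\<dots> = ennreal (G x)"
      unfolding G_def by (rule nn_integral_indicator_eq_lint[OF integrable_on_cell[OF lg]]) auto
    also have "ennreal (cN / 2 ^ j) * \<dots> = ennreal (cN * G x * (1 / 2) ^ j)"
      using G0[of x] by (simp add: cN_def power_one_over field_simps flip: ennreal_mult)
    finally show ?thesis .
  qed
  have CG: "0 \<le> cN * G x" for x using G0[of x] by (simp add: cN_def)
  have meas [measurable]: "avg j u \<in> borel_measurable (restrict_space lborel (cell 0 x))" for j x
    by (intro measurable_restrict_space1) simp
  have conv: "AE y in restrict_space lborel (cell 0 x). convergent (\<lambda>j. avg j u y)" for x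
    by (rule telescope_Lq(1)[where q=1 and \<rho>="1/2" and C="cN * G x"]) (use inc CG in auto)
  have L1: "(\<integral>\<^sup>+y. ennreal (\<bar>v y - avg j u y\<bar>) * indicator (cell 0 x) y \<partial>lborel) \<le> ennreal (telescope_const 1 (1/2) * (cN * G x) * (1/2) ^ j)" for j x
  proof -
    have "(\<integral>\<^sup>+y. ennreal (\<bar>v y - avg j u y\<bar> powr 1) \<partial>restrict_space lborel (cell 0 x)) \<le> ennreal (telescope_const 1 (1/2) * (cN * G x) * (1/2) ^ j)"
      unfolding v_def by (rule telescope_Lq(2)) (use inc CG in auto)
    then show ?thesis by (subst (asm) nn_integral_restrict_space) auto
  qed
  have int0: "integrable lebesgue (\<lambda>y. indicator (cell 0 x) y * (v y - avg j u y))"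
    and bd0: "(LINT y|lebesgue. indicator (cell 0 x) y * \<bar>v y - avg j u y\<bar>) \<le> telescope_const 1 (1/2) * (cN * G x) * (1/2) ^ j" for j x
  proof -
    have m: "(\<lambda>y. indicator (cell 0 x) y * (v y - avg j u y)) \<in> borel_measurable lebesgue"
      by (rule borel_imp_lebesgue) measurable
    have eq: "(\<integral>\<^sup>+y. ennreal (norm (indicator (cell 0 x) y * (v y - avg j u y))) \<partial>lebesgue)
        = (\<integral>\<^sup>+y. ennreal (\<bar>v y - avg j u y\<bar>) * indicator (cell 0 x) y \<partial>lborel)"
      unfolding nn_integral_completion by (intro nn_integral_cong) (auto simp: abs_mult split: split_indicator)
    then show i: "integrable lebesgue (\<lambda>y. indicator (cell 0 x) y * (v y - avg j u y))"
      using L1[of j x] m by (intro integrableI_bounded) (auto intro: le_less_trans)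
    have T0: "0 \<le> telescope_const 1 (1/2) * (cN * G x) * (1/2) ^ j"
      using CG[of x] by (auto simp: telescope_const_def real_sqrt_divide intro!: mult_nonneg_nonneg divide_nonneg_nonneg)
    have "ennreal (LINT y|lebesgue. norm (indicator (cell 0 x) y * (v y - avg j u y))) \<le> ennreal (telescope_const 1 (1/2) * (cN * G x) * (1/2) ^ j)"
      using nn_integral_eq_integral[OF integrable_norm[OF i]] eq L1[of j x] by simp
    then show "(LINT y|lebesgue. indicator (cell 0 x) y * \<bar>v y - avg j u y\<bar>) \<le> telescope_const 1 (1/2) * (cN * G x) * (1/2) ^ j"
      using T0 by (simp add: abs_mult)
  qed
  have intv: "integrable lebesgue (\<lambda>y. indicator (cell 0 x) y * v y)" for x
  proof -
    have "integrable lebesgue (\<lambda>y. indicator (cell 0 x) y * (v y - avg 0 u y) + indicator (cell 0 x) y * avg 0 u y)"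
      by (intro Bochner_Integration.integrable_add int0 integral_avg_over_cell(1)[OF lu]) simp
    then show ?thesis by (simp add: algebra_simps)
  qed
  have "AE x in lebesgue. v x - u x = 0"
  proof (rule AE_zero_if_zero_on_cells)
    show "integrable lebesgue (\<lambda>y. indicator (cell 0 x) y * (v y - u y))" for x
      using Bochner_Integration.integrable_diff[OF intv[of x] integrable_on_cell[OF lu, of "\<lambda>_. 0" x]]
      by (simp add: algebra_simps)
    fix i and x :: 'a
    have sub: "cell i x \<subseteq> cell 0 x" by (rule dcell_mono) simp
    have bound: "\<bar>LINT y|lebesgue. indicator (cell i x) y * (v y - u y)\<bar> \<le> telescope_const 1 (1/2) * (cN * G x) * (1/2) ^ j"
      if j: "j \<ge> i" for j
    proof -
      have iv: "integrable lebesgue (\<lambda>y. indicator (cell i x) y * v y)"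
        by (rule integrable_indicator_subset[OF intv sub]) simp
      have ia: "integrable lebesgue (\<lambda>y. indicator (cell i x) y * (v y - avg j u y))"
        by (rule integrable_indicator_subset[OF int0 sub]) simp
      have "(LINT y|lebesgue. indicator (cell i x) y * (v y - u y))
          = (LINT y|lebesgue. indicator (cell i x) y * v y) - (LINT y|lebesgue. indicator (cell i x) y * u y)"
        unfolding right_diff_distrib by (rule Bochner_Integration.integral_diff[OF iv integrable_on_cell[OF lu]])
      also have "\<dots> = (LINT y|lebesgue. indicator (cell i x) y * v y) - (LINT y|lebesgue. indicator (cell i x) y * avg j u y)"
        using integral_avg_over_cell(2)[OF lu j] by simp
      also have "\<dots> = (LINT y|lebesgue. indicator (cell i x) y * (v y - avg j u y))"
        unfolding right_diff_distrib
        by (rule Bochner_Integration.integral_diff[symmetric, OF iv integral_avg_over_cell(1)[OF lu j]])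
      finally have "\<bar>LINT y|lebesgue. indicator (cell i x) y * (v y - u y)\<bar> \<le> (LINT y|lebesgue. \<bar>indicator (cell i x) y * (v y - avg j u y)\<bar>)"
        by (simp only: integral_abs_bound)
      also have "\<dots> \<le> (LINT y|lebesgue. indicator (cell 0 x) y * \<bar>v y - avg j u y\<bar>)"
      proof (rule integral_mono)
        show "integrable lebesgue (\<lambda>y. indicator (cell 0 x) y * \<bar>v y - avg j u y\<bar>)"
          using integrable_abs[OF int0[of x j]] by (simp add: abs_mult)
        show "integrable lebesgue (\<lambda>y. \<bar>indicator (cell i x) y * (v y - avg j u y)\<bar>)"
          using ia by (rule integrable_abs)
      qed (use sub in \<open>auto simp: abs_mult split: split_indicator\<close>)
      finally show ?thesis using bd0[of x j] by linarith
    qed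
    have lim0: "(\<lambda>j. telescope_const 1 (1/2) * (cN * G x) * (1/2) ^ j) \<longlonglongrightarrow> telescope_const 1 (1/2) * (cN * G x) * 0"
      by (intro tendsto_intros LIMSEQ_power_zero) auto
    have "\<bar>LINT y|lebesgue. indicator (cell i x) y * (v y - u y)\<bar> \<le> telescope_const 1 (1/2) * (cN * G x) * 0"
      by (rule LIMSEQ_le_const[OF lim0]) (use bound in blast)
    then show "(LINT y|lebesgue. indicator (cell i x) y * (v y - u y)) = 0" by simp
  qed
  then have ae: "AE x in lborel. v x = u x" by (simp add: AE_completion_iff)
  have "AE y in lborel. \<forall>C\<in>range (cell 0 :: 'a \<Rightarrow> _). y \<in> C \<longrightarrow> convergent (\<lambda>j. avg j u y)"
  proof (rule AE_ball_countable'[OF _ countable_range_dcell])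
    fix C assume "C \<in> range (cell 0 :: 'a \<Rightarrow> _)"
    then obtain x :: 'a where "C = cell 0 x" by blast
    then show "AE y in lborel. y \<in> C \<longrightarrow> convergent (\<lambda>j. avg j u y)"
      using conv[of x] by (subst (asm) AE_restrict_space_iff) auto
  qed
  with ae show ?thesis
  proof eventually_elim
    fix y assume v: "v y = u y" and *: "\<forall>C\<in>range (cell 0). y \<in> C \<longrightarrow> convergent (\<lambda>j. avg j u y)"
    have "convergent (\<lambda>j. avg j u y)"
      using bspec[OF *, of "cell 0 y"] by simp
    then show "(\<lambda>j. avg j u y) \<longlonglongrightarrow> u y"
      using v by (simp add: v_def convergent_LIMSEQ_iff)
  qed
qed

section \<open>Riesz potentials dominate dyadic averages\<close>

lemma riesz_const_pos: "0 < \<beta> \<Longrightarrow> \<beta> < real N \<Longrightarrow> riesz_const N \<beta> > 0"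
  unfolding riesz_const_def by (intro divide_pos_pos mult_pos_pos Gamma_real_pos) auto

text \<open>
  Two points of the same cell have distance at most $N2^{-j}$, which bounds the kernel from below on the
  cell.
\<close>

lemma navg_le_riesz_potential:
  fixes f :: "'a::euclidean_space \<Rightarrow> real"
  assumes \<beta>: "0 < \<beta>" "\<beta> < real DIM('a)"
    and f: "f \<in> borel_measurable lebesgue" "\<And>y. f y \<ge> 0"
  shows "ennreal (riesz_const DIM('a) \<beta> * real DIM('a) powr (\<beta> - real DIM('a)) * 2 powr (- \<beta> * real j))
      * navg j (\<lambda>y. ennreal (f y)) x \<le> riesz_potential \<beta> f x"
proof -
  define N A where "N = real DIM('a)" and "A = riesz_const DIM('a) \<beta>"
  have A: "A > 0" unfolding A_def by (rule riesz_const_pos) (use \<beta> in auto)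
  have N: "N \<ge> 1" by (simp add: N_def DIM_ge_Suc0 Suc_leI)
  define k where "k = A * (N / 2 ^ j) powr (\<beta> - N)"
  have k: "k \<ge> 0" using A by (simp add: k_def)
  have "ennreal k * (\<integral>\<^sup>+y. ennreal (f y) * indicator (cell j x) y \<partial>lebesgue)
      = (\<integral>\<^sup>+y. ennreal k * (ennreal (f y) * indicator (cell j x) y) \<partial>lebesgue)"
  proof (rule nn_integral_cmult[symmetric])
    have [measurable]: "cell j x \<in> sets lebesgue" by simp
    note [measurable] = f(1)
    show "(\<lambda>y. ennreal (f y) * indicator (cell j x) y) \<in> borel_measurable lebesgue" by measurable
  qed
  also have "\<dots> \<le> riesz_potential \<beta> f x"
    unfolding riesz_potential_def
  proof (rule nn_integral_mono_AE)
    have "AE y in lborel. y \<noteq> x" by (rule AE_lborel_singleton)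
    then have "AE y in lebesgue. y \<noteq> x" by (rule AE_completion)
    then show "AE y in lebesgue. ennreal k * (ennreal (f y) * indicator (cell j x) y) \<le> ennreal (riesz_kernel \<beta> (x - y) * f y)"
    proof eventually_elim
      fix y assume y: "y \<noteq> x"
      show "ennreal k * (ennreal (f y) * indicator (cell j x) y) \<le> ennreal (riesz_kernel \<beta> (x - y) * f y)"
      proof (cases "y \<in> cell j x")
        case True
        have "norm (x - y) \<le> N / 2 ^ j" using cell_point_distance[OF True] by (simp add: N_def)
        then have "(N / 2 ^ j) powr (\<beta> - N) \<le> norm (x - y) powr (\<beta> - N)"
          using y \<beta> by (intro powr_mono2') (auto simp: N_def)
        then have "k \<le> riesz_kernel \<beta> (x - y)"
          using A by (simp add: k_def riesz_kernel_def A_def N_def)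
        then show ?thesis
          using True k f(2)[of y] by (simp add: ennreal_leI mult_right_mono flip: ennreal_mult)
      qed simp
    qed
  qed
  finally have *: "ennreal k * (\<integral>\<^sup>+y. ennreal (f y) * indicator (cell j x) y \<partial>lborel) \<le> riesz_potential \<beta> f x"
    by (simp add: nn_integral_completion)
  have "A * N powr (\<beta> - N) * 2 powr (- \<beta> * real j) * 2 ^ (j * DIM('a)) = k"
  proof -
    have p1: "(2::real) ^ (j * DIM('a)) = 2 powr (real j * N)"
      by (simp add: N_def powr_realpow[symmetric])
    have p2: "(2 ^ j) powr (\<beta> - N) = (2::real) powr (real j * (\<beta> - N))"
      by (simp add: powr_powr flip: powr_realpow)
    have "- \<beta> * real j + real j * N = - (real j * (\<beta> - N))" by (simp add: algebra_simps)
    then have "(2::real) powr (- \<beta> * real j) * 2 ^ (j * DIM('a)) = 1 / (2 ^ j) powr (\<beta> - N)"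
      unfolding p1 p2 by (simp only: powr_add[symmetric] powr_minus_divide)
    then show ?thesis using N by (simp add: k_def powr_divide mult.assoc)
  qed
  then show ?thesis
    using * A unfolding navg_def A_def[symmetric] N_def[symmetric]
    by (simp add: mult.assoc[symmetric] flip: ennreal_mult)
qed

lemma nn_integral_navg_square_le_energy:
  fixes \<alpha> p :: real
  assumes \<alpha>: "0 < \<alpha>" "\<alpha> < real DIM('a::euclidean_space)"
  obtains k where "k > 0"
    "\<And>(u :: 'a \<Rightarrow> real) j E. u \<in> borel_measurable lebesgue \<Longrightarrow> coulomb_energy \<alpha> p u \<le> ennreal E \<Longrightarrow> E \<ge> 0 \<Longrightarrow>
      (\<integral>\<^sup>+x. (navg j (\<lambda>y. ennreal (\<bar>u y\<bar> powr p)) x)\<^sup>2 \<partial>lborel) \<le> ennreal (E * k * 2 powr (\<alpha> * real j))"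
proof -
  define N where "N = DIM('a)"
  define c where "c = riesz_const N (\<alpha> / 2) * real N powr (\<alpha> / 2 - real N)"
  have "N > 0" by (simp add: N_def)
  then have c: "c > 0" using riesz_const_pos[of "\<alpha> / 2" N] \<alpha> by (auto simp: c_def N_def)
  show thesis
  proof
    show "1 / c\<^sup>2 > 0" using c by simp
    fix u :: "'a \<Rightarrow> real" and j E
    assume [measurable]: "u \<in> borel_measurable lebesgue" and E: "coulomb_energy \<alpha> p u \<le> ennreal E" "E \<ge> 0"
    define d where "d = c * 2 powr (- (\<alpha> / 2) * real j)"
    have d: "d > 0" using c by (simp add: d_def)
    let ?A = "\<lambda>x. navg j (\<lambda>y. ennreal (\<bar>u y\<bar> powr p)) x"
    have "ennreal (d\<^sup>2) * (\<integral>\<^sup>+x. (?A x)\<^sup>2 \<partial>lborel) = (\<integral>\<^sup>+x. (ennreal d * ?A x)\<^sup>2 \<partial>lborel)"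
      using d by (subst nn_integral_cmult[symmetric]) (auto simp: power_mult_distrib ennreal_power)
    also have "\<dots> \<le> (\<integral>\<^sup>+x. (riesz_potential (\<alpha> / 2) (\<lambda>y. \<bar>u y\<bar> powr p) x)\<^sup>2 \<partial>lborel)"
    proof (intro nn_integral_mono power_mono)
      show "ennreal d * ?A x \<le> riesz_potential (\<alpha> / 2) (\<lambda>y. \<bar>u y\<bar> powr p) x" for x
        unfolding d_def c_def N_def by (rule navg_le_riesz_potential) (use \<alpha> in auto)
    qed simp
    also have "\<dots> \<le> ennreal E"
      using E(1) by (simp add: coulomb_energy_def nn_integral_completion)
    finally have "ennreal (1 / d\<^sup>2) * (ennreal (d\<^sup>2) * (\<integral>\<^sup>+x. (?A x)\<^sup>2 \<partial>lborel)) \<le> ennreal (1 / d\<^sup>2) * ennreal E"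
      by (intro mult_left_mono) auto
    then have "(\<integral>\<^sup>+x. (?A x)\<^sup>2 \<partial>lborel) \<le> ennreal (1 / d\<^sup>2 * E)"
      using d E(2) by (simp add: mult.assoc[symmetric] flip: ennreal_mult)
    also have "1 / d\<^sup>2 * E = E * (1 / c\<^sup>2) * 2 powr (\<alpha> * real j)"
      by (simp add: d_def power_mult_distrib powr_minus field_simps power2_eq_square flip: powr_add)
    finally show "(\<integral>\<^sup>+x. (?A x)\<^sup>2 \<partial>lborel) \<le> ennreal (E * (1 / c\<^sup>2) * 2 powr (\<alpha> * real j))" .
  qed
qed

text \<open>
  One of the two terms on the right already suffices, according to whether $t\le s$ or not. This is the
  real interpolation used below in place of Hoelder's inequality.
\<close>

lemma powr_interpolation_le:
  fixes t s :: real
  assumes "t \<ge> 0" "s > 0" "a \<le> q" "q \<le> b"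
  shows "t powr q \<le> s powr (q - a) * t powr a + s powr (q - b) * t powr b"
proof (cases "t = 0")
  case False
  then have t: "t > 0" using assms by simp
  show ?thesis
  proof (cases "t \<le> s")
    case True
    have "t powr q = t powr (q - a) * t powr a" using t by (simp flip: powr_add)
    also have "\<dots> \<le> s powr (q - a) * t powr a"
      using True t assms by (intro mult_right_mono powr_mono2) auto
    finally show ?thesis by (simp add: add_increasing2)
  next
    case False
    have "t powr q = t powr (q - b) * t powr b" using t by (simp flip: powr_add)
    also have "\<dots> \<le> s powr (q - b) * t powr b"
      using False t assms by (intro mult_right_mono powr_mono2') auto
    finally show ?thesis by (simp add: add_increasing)
  qed
qed (use assms in auto)

text \<open>
  Choose the threshold $s=2^{\sigma j}$ in the previous inequality. The sign condition says exactly that some $\sigma$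
  makes both terms decay.
\<close>

lemma interpolation_decay:
  fixes a b q xa xb Ca Cb :: real
  assumes ab: "a < q" "q < b" and x: "(b - q) * xa + (q - a) * xb < 0" and C: "Ca \<ge> 0" "Cb \<ge> 0"
  obtains C \<rho> where "C \<ge> 0" "0 < \<rho>" "\<rho> < 1"
    "\<And>(M :: 'x measure) f j. f \<in> borel_measurable M \<Longrightarrow>
      (\<integral>\<^sup>+x. ennreal (\<bar>f x\<bar> powr a) \<partial>M) \<le> ennreal (Ca * 2 powr (xa * real j)) \<Longrightarrow>
      (\<integral>\<^sup>+x. ennreal (\<bar>f x\<bar> powr b) \<partial>M) \<le> ennreal (Cb * 2 powr (xb * real j)) \<Longrightarrow>
      (\<integral>\<^sup>+x. ennreal (\<bar>f x\<bar> powr q) \<partial>M) \<le> ennreal (C * \<rho> ^ j)"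
proof -
  have lt: "xb / (b - q) < - xa / (q - a)"
    using ab x by (simp add: divide_simps) (simp add: algebra_simps)
  then obtain \<sigma> where \<sigma>: "xb / (b - q) < \<sigma>" "\<sigma> < - xa / (q - a)" using dense by blast
  have "xb < \<sigma> * (b - q)" "\<sigma> * (q - a) < - xa"
    using iffD1[OF pos_divide_less_eq \<sigma>(1)] iffD1[OF pos_less_divide_eq \<sigma>(2)] ab by simp_all
  then have s: "\<sigma> * (q - a) + xa < 0" "\<sigma> * (q - b) + xb < 0"
    by (simp_all add: algebra_simps)
  define e where "e = max (\<sigma> * (q - a) + xa) (\<sigma> * (q - b) + xb)"
  have e: "e < 0" using s by (simp add: e_def)
  show thesis
  proof
    show "Ca + Cb \<ge> 0" using C by simp
    show "0 < (2::real) powr e" by simp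
    show "2 powr e < (1::real)" using powr_less_mono[OF e, of 2] by simp
    fix M :: "'x measure" and f j
    assume [measurable]: "f \<in> borel_measurable M"
      and A: "(\<integral>\<^sup>+x. ennreal (\<bar>f x\<bar> powr a) \<partial>M) \<le> ennreal (Ca * 2 powr (xa * real j))"
      and B: "(\<integral>\<^sup>+x. ennreal (\<bar>f x\<bar> powr b) \<partial>M) \<le> ennreal (Cb * 2 powr (xb * real j))"
    define s where "s = (2::real) powr (\<sigma> * real j)"
    have "(\<integral>\<^sup>+x. ennreal (\<bar>f x\<bar> powr q) \<partial>M) \<le>
        (\<integral>\<^sup>+x. ennreal (s powr (q - a)) * ennreal (\<bar>f x\<bar> powr a) + ennreal (s powr (q - b)) * ennreal (\<bar>f x\<bar> powr b) \<partial>M)"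
      using powr_interpolation_le[of "\<bar>f _\<bar>" s a q b] ab
      by (intro nn_integral_mono) (simp add: s_def flip: ennreal_mult ennreal_plus)
    also have "\<dots> = ennreal (s powr (q - a)) * (\<integral>\<^sup>+x. ennreal (\<bar>f x\<bar> powr a) \<partial>M)
        + ennreal (s powr (q - b)) * (\<integral>\<^sup>+x. ennreal (\<bar>f x\<bar> powr b) \<partial>M)"
      by (subst nn_integral_add) (auto simp: nn_integral_cmult)
    also have "\<dots> \<le> ennreal (s powr (q - a)) * ennreal (Ca * 2 powr (xa * real j))
        + ennreal (s powr (q - b)) * ennreal (Cb * 2 powr (xb * real j))"
      by (intro add_mono mult_left_mono A B) auto
    also have "\<dots> = ennreal (Ca * 2 powr (real j * (\<sigma> * (q - a) + xa)) + Cb * 2 powr (real j * (\<sigma> * (q - b) + xb)))"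
    proof -
      have eq: "s powr r * (c * 2 powr (x * real j)) = c * 2 powr (real j * (\<sigma> * r + x))" for r c x
        by (simp add: s_def powr_powr distrib_left mult_ac powr_add)
      show ?thesis using C by (simp add: eq flip: ennreal_mult ennreal_plus)
    qed
    also have "\<dots> \<le> ennreal (Ca * (2 powr e) ^ j + Cb * (2 powr e) ^ j)"
    proof (intro ennreal_leI add_mono mult_left_mono C)
      have p: "(2 powr e) ^ j = (2::real) powr (real j * e)" by (simp add: powr_powr mult.commute flip: powr_realpow)
      show "2 powr (real j * (\<sigma> * (q - a) + xa)) \<le> (2 powr e) ^ j" "2 powr (real j * (\<sigma> * (q - b) + xb)) \<le> (2 powr e) ^ j"
        unfolding p by (auto simp: e_def intro!: mult_left_mono)
    qed
    finally show "(\<integral>\<^sup>+x. ennreal (\<bar>f x\<bar> powr q) \<partial>M) \<le> ennreal ((Ca + Cb) * (2 powr e) ^ j)"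
      by (simp add: algebra_simps)
  qed
qed

lemma powr_abs_diff_le:
  fixes a b r :: real
  assumes "r \<ge> 0"
  shows "\<bar>a - b\<bar> powr r \<le> 2 powr r * (\<bar>a\<bar> powr r + \<bar>b\<bar> powr r)"
proof -
  have "\<bar>a - b\<bar> powr r \<le> (2 * max \<bar>a\<bar> \<bar>b\<bar>) powr r"
    using assms by (intro powr_mono2) auto
  also have "\<dots> = 2 powr r * max \<bar>a\<bar> \<bar>b\<bar> powr r" by (simp add: powr_mult)
  also have "\<dots> \<le> 2 powr r * (\<bar>a\<bar> powr r + \<bar>b\<bar> powr r)"
    by (intro mult_left_mono) (auto simp: max_def)
  finally show ?thesis .
qed

lemma avg_increment_square_le:
  fixes u :: "'a::euclidean_space \<Rightarrow> real"
  assumes wg: "has_weak_gradient u g"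
  shows "ennreal (\<bar>avg (Suc j) u x - avg j u x\<bar> powr 2) \<le>
    ennreal ((real DIM('a) * 2 ^ DIM('a))\<^sup>2 / 4 ^ j) * navg j (\<lambda>y. ennreal ((norm (g y))\<^sup>2)) x"
proof -
  have lg: "locally_integrable (\<lambda>y. norm (g y))"
    using wg locally_integrable_norm unfolding has_weak_gradient_def by blast
  define c where "c = real DIM('a) * 2 ^ DIM('a) / 2 ^ j"
  have c: "c \<ge> 0" by (simp add: c_def)
  define G where "G = avg j (\<lambda>y. norm (g y)) x"
  have G: "G \<ge> 0"
    unfolding G_def gavg_def by (intro mult_nonneg_nonneg Bochner_Integration.integral_nonneg prod_nonneg) auto
  have "\<bar>avg (Suc j) u x - avg j u x\<bar> powr 2 \<le> (c * G)\<^sup>2"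
    using power_mono[OF avg_increment_le[OF wg, of j x] abs_ge_zero, of 2]
    by (simp only: c_def G_def powr_numeral abs_ge_zero)
  then have "ennreal (\<bar>avg (Suc j) u x - avg j u x\<bar> powr 2) \<le> ennreal (c\<^sup>2) * ennreal (\<bar>G\<bar> powr 2)"
    using G c by (simp add: power_mult_distrib ennreal_leI flip: ennreal_mult)
  also have "\<dots> \<le> ennreal (c\<^sup>2) * navg j (\<lambda>y. ennreal (\<bar>norm (g y)\<bar> powr 2)) x"
    unfolding G_def by (intro mult_left_mono avg_powr_le[OF lg]) auto
  also have "c\<^sup>2 = (real DIM('a) * 2 ^ DIM('a))\<^sup>2 / 4 ^ j"
  proof -
    have "(2 ^ j)\<^sup>2 = (4::real) ^ j" by (simp add: power2_eq_square flip: power_mult_distrib)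
    then show ?thesis by (simp add: c_def power_divide)
  qed
  finally show ?thesis by simp
qed

section \<open>Estimates for consecutive averages\<close>

text \<open>
  A finite union of unit cells, hence invariant under all the averaging operators; these sets exhaust
  the space.
\<close>

definition lattice_box :: "nat \<Rightarrow> 'a::euclidean_space set" where
  "lattice_box m = {x. \<forall>b\<in>Basis. - int m \<le> \<lfloor>x \<bullet> b\<rfloor> \<and> \<lfloor>x \<bullet> b\<rfloor> < int m}"

lemma lattice_box_borel [measurable]: "lattice_box m \<in> sets borel"
  unfolding lattice_box_def by measurable

lemma lattice_box_lebesgue [simp]: "lattice_box m \<in> sets lebesgue"
  using lattice_box_borel by auto

lemma lattice_box_saturated: "x \<in> lattice_box m \<Longrightarrow> y \<in> cell j x \<Longrightarrow> y \<in> lattice_box m"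
  using dcell_mono[of "\<lambda>_. 0" "\<lambda>_. j" x] by (fastforce simp: lattice_box_def dcell_def)

lemma bounded_subset_lattice_box:
  fixes S :: "'a::euclidean_space set"
  assumes "bounded S"
  obtains m where "S \<subseteq> lattice_box m"
proof -
  obtain B where B: "\<And>x. x \<in> S \<Longrightarrow> norm x \<le> B" using assms unfolding bounded_iff by blast
  obtain m :: nat where m: "B < real m" using reals_Archimedean2 by blast
  have "x \<in> lattice_box m" if x: "x \<in> S" for x
    unfolding lattice_box_def
  proof (intro CollectI ballI)
    fix b :: 'a assume "b \<in> Basis"
    then have "\<bar>x \<bullet> b\<bar> < real m" using Basis_le_norm[of b x] B[OF x] m by linarith
    then show "- int m \<le> \<lfloor>x \<bullet> b\<rfloor> \<and> \<lfloor>x \<bullet> b\<rfloor> < int m" by linarith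
  qed
  then show ?thesis by (intro that[of m]) auto
qed

lemma emeasure_lattice_box_finite: "emeasure lborel (lattice_box m :: 'a::euclidean_space set) < \<infinity>"
proof -
  have "(lattice_box m :: 'a set) \<subseteq> cbox (- real m *\<^sub>R One) (real m *\<^sub>R One)"
  proof
    fix x :: 'a assume "x \<in> lattice_box m"
    then have "- real m \<le> x \<bullet> b \<and> x \<bullet> b \<le> real m" if "b \<in> Basis" for b
      using that unfolding lattice_box_def le_floor_iff floor_less_iff by (auto intro: less_imp_le)
    then show "x \<in> cbox (- real m *\<^sub>R One) (real m *\<^sub>R One)"
      by (simp add: mem_box)
  qed
  then have "emeasure lborel (lattice_box m :: 'a set) \<le> emeasure lborel (cbox (- real m *\<^sub>R One) (real m *\<^sub>R One) :: 'a set)"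
    by (intro emeasure_mono) auto
  also have "\<dots> < \<infinity>" by (rule emeasure_lborel_cbox_finite)
  finally show ?thesis .
qed

lemma nn_integral_lebesgue_on:
  assumes "S \<in> sets lebesgue"
  shows "(\<integral>\<^sup>+x. f x \<partial>lebesgue_on S) = (\<integral>\<^sup>+x. f x * indicator S x \<partial>lborel)"
  using assms by (subst nn_integral_restrict_space) (auto simp: nn_integral_completion)

lemma nn_integral_lebesgue_on_le:
  assumes "S \<in> sets lebesgue"
  shows "(\<integral>\<^sup>+x. f x \<partial>lebesgue_on S) \<le> (\<integral>\<^sup>+x. f x \<partial>lborel)"
  unfolding nn_integral_lebesgue_on[OF assms]
  by (intro nn_integral_mono) (auto split: split_indicator)

lemma lebesgue_on_measurable [intro]:
  "f \<in> borel_measurable lebesgue \<Longrightarrow> f \<in> borel_measurable (lebesgue_on S)"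
  by (rule measurable_restrict_space1)

lemma avg_measurable_lebesgue_on [measurable]:
  "avg j u \<in> borel_measurable (lebesgue_on S)"
  by (intro lebesgue_on_measurable borel_imp_lebesgue avg_measurable)

text \<open>
  Both estimates follow from $|\Delta_j|^2\le C4^{-j}A_j(|g|^2)$: averaging preserves the integral of
  $|g|^2$, and a mean over a cell is at most $2^{jN}$ times the integral.
\<close>

lemma gradient_increment_L2:
  fixes u :: "'a::euclidean_space \<Rightarrow> real"
  assumes wg: "has_weak_gradient u g" and G: "(\<integral>\<^sup>+y. ennreal ((norm (g y))\<^sup>2) \<partial>lborel) \<le> ennreal G" "G \<ge> 0"
  shows "(\<integral>\<^sup>+x. ennreal (\<bar>avg (Suc j) u x - avg j u x\<bar> powr 2) \<partial>lborel) \<le>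
      ennreal ((real DIM('a) * 2 ^ DIM('a))\<^sup>2 * G * 2 powr (- 2 * real j))"
    and "\<bar>avg (Suc j) u x - avg j u x\<bar> powr 2 \<le> (real DIM('a) * 2 ^ DIM('a))\<^sup>2 * G * 2 powr ((real DIM('a) - 2) * real j)"
proof -
  define c where "c = (real DIM('a) * 2 ^ DIM('a))\<^sup>2"
  have c: "c \<ge> 0" by (simp add: c_def)
  let ?h = "\<lambda>y. ennreal ((norm (g y))\<^sup>2)"
  note [measurable] = has_weak_gradient_measurable[OF wg]
  have pw: "1 / 4 ^ j = (2::real) powr (- 2 * real j)"
    by (simp add: powr_minus_divide powr_powr[of 2 2, symmetric] powr_realpow)
  have pw2: "1 / 4 ^ j * 2 ^ (j * DIM('a)) = (2::real) powr ((real DIM('a) - 2) * real j)"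
  proof -
    have "(2::real) ^ (j * DIM('a)) = 2 powr (real j * real DIM('a))"
      by (simp add: powr_realpow[symmetric])
    then show ?thesis unfolding pw by (simp add: algebra_simps flip: powr_add)
  qed
  have inc: "ennreal (\<bar>avg (Suc j) u x - avg j u x\<bar> powr 2) \<le> ennreal (c / 4 ^ j) * navg j ?h x" for x
    using avg_increment_square_le[OF wg, of j x] by (simp add: c_def)
  have "(\<integral>\<^sup>+x. ennreal (\<bar>avg (Suc j) u x - avg j u x\<bar> powr 2) \<partial>lborel) \<le>
      (\<integral>\<^sup>+x. ennreal (c / 4 ^ j) * navg j ?h x \<partial>lborel)"
    by (intro nn_integral_mono inc)
  also have "\<dots> = ennreal (c / 4 ^ j) * (\<integral>\<^sup>+x. ?h x \<partial>lborel)"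
    by (subst nn_integral_cmult) (auto intro!: arg_cong2[where f="(*)"] nn_integral_navg)
  also have "\<dots> \<le> ennreal (c / 4 ^ j) * ennreal G" by (intro mult_left_mono G) auto
  also have "\<dots> = ennreal (c * G * (1 / 4 ^ j))" using c G(2) by (simp flip: ennreal_mult)
  finally show "(\<integral>\<^sup>+x. ennreal (\<bar>avg (Suc j) u x - avg j u x\<bar> powr 2) \<partial>lborel) \<le>
      ennreal ((real DIM('a) * 2 ^ DIM('a))\<^sup>2 * G * 2 powr (- 2 * real j))"
    unfolding pw c_def .
  have "navg j ?h x \<le> ennreal (2 ^ (j * DIM('a))) * ennreal G"
    unfolding navg_def
  proof (intro mult_left_mono)
    have "(\<integral>\<^sup>+y. ?h y * indicator (cell j x) y \<partial>lborel) \<le> (\<integral>\<^sup>+y. ?h y \<partial>lborel)"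
      by (intro nn_integral_mono) (auto split: split_indicator)
    then show "(\<integral>\<^sup>+y. ?h y * indicator (cell j x) y \<partial>lborel) \<le> ennreal G"
      using G(1) by (rule order_trans)
  qed simp
  then have "ennreal (\<bar>avg (Suc j) u x - avg j u x\<bar> powr 2) \<le> ennreal (c / 4 ^ j) * (ennreal (2 ^ (j * DIM('a))) * ennreal G)"
    by (intro order_trans[OF inc] mult_left_mono) auto
  also have "\<dots> = ennreal (c * G * (1 / 4 ^ j * 2 ^ (j * DIM('a))))"
    using c G(2) by (simp add: mult_ac flip: ennreal_mult)
  finally show "\<bar>avg (Suc j) u x - avg j u x\<bar> powr 2 \<le> (real DIM('a) * 2 ^ DIM('a))\<^sup>2 * G * 2 powr ((real DIM('a) - 2) * real j)"
    unfolding pw2 c_def using G(2) by (simp add: ennreal_le_iff)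
qed

lemma avg_powr_2p_le:
  fixes u :: "'a::euclidean_space \<Rightarrow> real"
  assumes u: "locally_integrable u" and p: "p \<ge> 1"
  shows "(\<integral>\<^sup>+x. ennreal (\<bar>avg j u x\<bar> powr (2 * p)) \<partial>lborel)
      \<le> (\<integral>\<^sup>+x. (navg j (\<lambda>y. ennreal (\<bar>u y\<bar> powr p)) x)\<^sup>2 \<partial>lborel)"
proof (rule nn_integral_mono)
  fix x
  have "\<bar>avg j u x\<bar> powr (2 * p) = (\<bar>avg j u x\<bar> powr p)\<^sup>2"
    by (simp add: power2_eq_square flip: powr_add)
  then have "ennreal (\<bar>avg j u x\<bar> powr (2 * p)) = (ennreal (\<bar>avg j u x\<bar> powr p))\<^sup>2"
    by (simp add: ennreal_power)
  also have "\<dots> \<le> (navg j (\<lambda>y. ennreal (\<bar>u y\<bar> powr p)) x)\<^sup>2"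
    by (intro power_mono avg_powr_le[OF u p]) simp
  finally show "ennreal (\<bar>avg j u x\<bar> powr (2 * p)) \<le> (navg j (\<lambda>y. ennreal (\<bar>u y\<bar> powr p)) x)\<^sup>2" .
qed

text \<open>
  Averaging preserves integrals over unions of unit cells, so the $L^p$ bound at all generations follows
  from the one at generation $0$, where $a\le 1+a^2$ brings in the energy.
\<close>

lemma avg_powr_p_local_le:
  fixes u :: "'a::euclidean_space \<Rightarrow> real"
  assumes u: "locally_integrable u" and p: "p \<ge> 1"
  shows "(\<integral>\<^sup>+x. ennreal (\<bar>avg j u x\<bar> powr p) \<partial>lebesgue_on (lattice_box m))
      \<le> emeasure lborel (lattice_box m :: 'a set) + (\<integral>\<^sup>+x. (navg 0 (\<lambda>y. ennreal (\<bar>u y\<bar> powr p)) x)\<^sup>2 \<partial>lborel)"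
proof -
  let ?f = "\<lambda>y. ennreal (\<bar>u y\<bar> powr p)" and ?K = "lattice_box m :: 'a set"
  have [measurable]: "u \<in> borel_measurable lebesgue" using u by (rule locally_integrable_measurable)
  have "(\<integral>\<^sup>+x. ennreal (\<bar>avg j u x\<bar> powr p) \<partial>lebesgue_on ?K) \<le> (\<integral>\<^sup>+x. navg j ?f x * indicator ?K x \<partial>lborel)"
    unfolding nn_integral_lebesgue_on[OF lattice_box_lebesgue]
    by (intro nn_integral_mono mult_right_mono avg_powr_le[OF u p]) auto
  also have "\<dots> = (\<integral>\<^sup>+x. ?f x * indicator ?K x \<partial>lborel)"
    by (rule nn_integral_navg_saturated) (auto intro: lattice_box_saturated)
  also have "\<dots> = (\<integral>\<^sup>+x. navg 0 ?f x * indicator ?K x \<partial>lborel)"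
    by (rule nn_integral_navg_saturated[symmetric]) (auto intro: lattice_box_saturated)
  also have "\<dots> \<le> (\<integral>\<^sup>+x. indicator ?K x + (navg 0 ?f x)\<^sup>2 \<partial>lborel)"
  proof (rule nn_integral_mono)
    have *: "a \<le> 1 + a\<^sup>2" for a :: ennreal
    proof (cases "a \<le> 1")
      case False
      then have "a * 1 \<le> a * a" by (intro mult_left_mono) auto
      then show ?thesis by (simp add: power2_eq_square add_increasing)
    qed (simp add: add_increasing2)
    show "navg 0 ?f x * indicator ?K x \<le> indicator ?K x + (navg 0 ?f x)\<^sup>2" for x
      using *[of "navg 0 ?f x"] by (auto split: split_indicator)
  qed
  also have "\<dots> = emeasure lborel ?K + (\<integral>\<^sup>+x. (navg 0 ?f x)\<^sup>2 \<partial>lborel)"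
    by (subst nn_integral_add) auto
  finally show ?thesis .
qed

lemma nn_integral_powr_diff_le:
  fixes f h :: "'x \<Rightarrow> real"
  assumes [measurable]: "f \<in> borel_measurable M" "h \<in> borel_measurable M" and r: "r \<ge> 0"
  shows "(\<integral>\<^sup>+x. ennreal (\<bar>f x - h x\<bar> powr r) \<partial>M)
    \<le> ennreal (2 powr r) * ((\<integral>\<^sup>+x. ennreal (\<bar>f x\<bar> powr r) \<partial>M) + (\<integral>\<^sup>+x. ennreal (\<bar>h x\<bar> powr r) \<partial>M))"
proof -
  have "(\<integral>\<^sup>+x. ennreal (\<bar>f x - h x\<bar> powr r) \<partial>M)
      \<le> (\<integral>\<^sup>+x. ennreal (2 powr r) * (ennreal (\<bar>f x\<bar> powr r) + ennreal (\<bar>h x\<bar> powr r)) \<partial>M)"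
    using powr_abs_diff_le[OF r] by (intro nn_integral_mono) (simp flip: ennreal_mult ennreal_plus)
  also have "\<dots> = ennreal (2 powr r) * ((\<integral>\<^sup>+x. ennreal (\<bar>f x\<bar> powr r) \<partial>M) + (\<integral>\<^sup>+x. ennreal (\<bar>h x\<bar> powr r) \<partial>M))"
    by (subst nn_integral_cmult) (auto simp: nn_integral_add)
  finally show ?thesis .
qed

lemma nn_integral_powr_diff_leI:
  fixes f h :: "'x \<Rightarrow> real"
  assumes "f \<in> borel_measurable M" "h \<in> borel_measurable M" and r: "r \<ge> 0"
    and "(\<integral>\<^sup>+x. ennreal (\<bar>f x\<bar> powr r) \<partial>M) \<le> ennreal A" "(\<integral>\<^sup>+x. ennreal (\<bar>h x\<bar> powr r) \<partial>M) \<le> ennreal B"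
    and "A \<ge> 0" "B \<ge> 0"
  shows "(\<integral>\<^sup>+x. ennreal (\<bar>f x - h x\<bar> powr r) \<partial>M) \<le> ennreal (2 powr r * (A + B))"
proof -
  have "(\<integral>\<^sup>+x. ennreal (\<bar>f x - h x\<bar> powr r) \<partial>M) \<le> ennreal (2 powr r) * (ennreal A + ennreal B)"
    by (rule order_trans[OF nn_integral_powr_diff_le[OF assms(1-3)]]) (intro mult_left_mono add_mono assms zero_le)
  also have "\<dots> = ennreal (2 powr r * (A + B))"
    using assms by (simp flip: ennreal_mult ennreal_plus)
  finally show ?thesis .
qed

text \<open>
  The three alternatives in the hypothesis interpolate the $L^2$ estimate of the increments with the
  uniform estimate, with the local $L^p$ estimate, and with the $L^{2p}$ estimate. For $q<2$ the measure of
  the bounded set takes the place of the second norm.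
\<close>

lemma increments_Lq_decay:
  fixes \<alpha> p q E G :: real and m :: nat
  assumes \<alpha>: "0 < \<alpha>" "\<alpha> < real DIM('a::euclidean_space)" and p: "p \<ge> 1" and q: "q \<ge> 1"
    and EG: "E \<ge> 0" "G \<ge> 0"
    and cond: "1 / q > 1 / 2 - 1 / real DIM('a) \<or> 1 / q > 1 / p \<or> 1 / q > (2 + \<alpha>) / (2 * (2 * p + \<alpha>))"
  obtains C \<rho> where "C \<ge> 0" "0 < \<rho>" "\<rho> < 1"
    "\<And>(u :: 'a \<Rightarrow> real) g j. has_weak_gradient u g \<Longrightarrow> coulomb_energy \<alpha> p u \<le> ennreal E \<Longrightarrow>
      (\<integral>\<^sup>+y. ennreal ((norm (g y))\<^sup>2) \<partial>lborel) \<le> ennreal G \<Longrightarrow>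
      (\<integral>\<^sup>+x. ennreal (\<bar>avg (Suc j) u x - avg j u x\<bar> powr q) \<partial>lebesgue_on (lattice_box m)) \<le> ennreal (C * \<rho> ^ j)"
proof -
  define admissible where "admissible u g \<longleftrightarrow> has_weak_gradient u g \<and> coulomb_energy \<alpha> p u \<le> ennreal E \<and>
      (\<integral>\<^sup>+y. ennreal ((norm (g y))\<^sup>2) \<partial>lborel) \<le> ennreal G" for u :: "'a \<Rightarrow> real" and g
  define N where "N = real DIM('a)"
  define \<Delta> where "\<Delta> j u x = avg (Suc j) u x - avg j u x" for j and u :: "'a \<Rightarrow> real" and x
  let ?M = "lebesgue_on (lattice_box m :: 'a set)"
  have N: "N > 0" by (simp add: N_def)
  have \<Delta>m: "\<Delta> j u \<in> borel_measurable ?M" for j u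
    unfolding \<Delta>_def[abs_def] by measurable
  obtain k where k: "k > 0" and energy: "\<And>(u :: 'a \<Rightarrow> real) j E. u \<in> borel_measurable lebesgue \<Longrightarrow> coulomb_energy \<alpha> p u \<le> ennreal E \<Longrightarrow> E \<ge> 0 \<Longrightarrow>
      (\<integral>\<^sup>+x. (navg j (\<lambda>y. ennreal (\<bar>u y\<bar> powr p)) x)\<^sup>2 \<partial>lborel) \<le> ennreal (E * k * 2 powr (\<alpha> * real j))"
    using nn_integral_navg_square_le_energy[OF \<alpha>, of p] by metis
  define V where "V = measure lborel (lattice_box m :: 'a set)"
  have V: "V \<ge> 0" "emeasure lborel (lattice_box m :: 'a set) = ennreal V"
    using emeasure_lattice_box_finite[of m, where 'a='a] by (auto simp: V_def emeasure_eq_ennreal_measure)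
  define c where "c = (real DIM('a) * 2 ^ DIM('a))\<^sup>2 * G"
  have c: "c \<ge> 0" using EG by (simp add: c_def)
  have loc: "locally_integrable u" and meas: "u \<in> borel_measurable lebesgue" if "admissible u g" for u g
    using that has_weak_gradient_measurable(1) unfolding admissible_def has_weak_gradient_def by blast+
  have X2: "(\<integral>\<^sup>+x. ennreal (\<bar>\<Delta> j u x\<bar> powr 2) \<partial>?M) \<le> ennreal (c * 2 powr (- 2 * real j))" if "admissible u g" for j u g
    unfolding \<Delta>_def
    by (rule order_trans[OF nn_integral_lebesgue_on_le[OF lattice_box_lebesgue]])
       (use that EG gradient_increment_L2(1)[of u g G j] in \<open>simp add: c_def admissible_def\<close>)
  have Xsup: "\<bar>\<Delta> j u x\<bar> powr 2 \<le> c * 2 powr ((N - 2) * real j)" if "admissible u g" for j u g x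
    using that EG gradient_increment_L2(2)[of u g G j x] by (simp add: c_def admissible_def \<Delta>_def N_def)
  have X0: "(\<integral>\<^sup>+x. ennreal (\<bar>\<Delta> j u x\<bar> powr 0) \<partial>?M) \<le> ennreal (V * 2 powr (0 * real j))" for j u
  proof -
    have "(\<integral>\<^sup>+x. ennreal (\<bar>\<Delta> j u x\<bar> powr 0) \<partial>?M) \<le> (\<integral>\<^sup>+x. indicator (lattice_box m :: 'a set) x \<partial>lborel)"
      unfolding nn_integral_lebesgue_on[OF lattice_box_lebesgue]
      by (intro nn_integral_mono) (auto split: split_indicator)
    then show ?thesis using V by simp
  qed
  have Xp: "(\<integral>\<^sup>+x. ennreal (\<bar>\<Delta> j u x\<bar> powr p) \<partial>?M) \<le> ennreal (2 powr p * ((V + E * k) + (V + E * k)) * 2 powr (0 * real j))"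
    if "admissible u g" for j u g
  proof -
    have "(\<integral>\<^sup>+x. ennreal (\<bar>avg i u x\<bar> powr p) \<partial>?M) \<le> ennreal (V + E * k)" for i
    proof -
      have "(\<integral>\<^sup>+x. ennreal (\<bar>avg i u x\<bar> powr p) \<partial>?M) \<le> ennreal V + ennreal (E * k * 2 powr (\<alpha> * real 0))"
        unfolding V(2)[symmetric]
        by (rule order_trans[OF avg_powr_p_local_le[OF loc[OF that] p]], intro add_left_mono energy meas[OF that])
           (use that EG in \<open>auto simp: admissible_def\<close>)
      then show ?thesis using V EG k by (simp flip: ennreal_plus)
    qed
    then have "(\<integral>\<^sup>+x. ennreal (\<bar>\<Delta> j u x\<bar> powr p) \<partial>?M) \<le> ennreal (2 powr p * ((V + E * k) + (V + E * k)))"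
      unfolding \<Delta>_def using p V EG k
      by (intro nn_integral_powr_diff_leI avg_measurable_lebesgue_on) auto
    then show ?thesis by simp
  qed
  have X2p: "(\<integral>\<^sup>+x. ennreal (\<bar>\<Delta> j u x\<bar> powr (2 * p)) \<partial>?M) \<le> ennreal (2 powr (2 * p) * (E * k * 2 powr \<alpha> + E * k) * 2 powr (\<alpha> * real j))"
    if "admissible u g" for j u g
  proof -
    have A: "(\<integral>\<^sup>+x. ennreal (\<bar>avg i u x\<bar> powr (2 * p)) \<partial>?M) \<le> ennreal (E * k * 2 powr (\<alpha> * real i))" for i
      using that EG
      by (intro order_trans[OF nn_integral_lebesgue_on_le[OF lattice_box_lebesgue]]
          order_trans[OF avg_powr_2p_le[OF loc[OF that] p]] energy meas[OF that]) (auto simp: admissible_def)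
    have "(\<integral>\<^sup>+x. ennreal (\<bar>\<Delta> j u x\<bar> powr (2 * p)) \<partial>?M) \<le>
        ennreal (2 powr (2 * p) * (E * k * 2 powr (\<alpha> * real (Suc j)) + E * k * 2 powr (\<alpha> * real j)))"
      unfolding \<Delta>_def using p EG k
      by (intro nn_integral_powr_diff_leI avg_measurable_lebesgue_on A) auto
    also have "2 powr (\<alpha> * real (Suc j)) = 2 powr \<alpha> * 2 powr (\<alpha> * real j)"
      by (simp add: distrib_left powr_add)
    finally show ?thesis by (simp add: algebra_simps)
  qed
  have "\<exists>C \<rho>. C \<ge> 0 \<and> 0 < \<rho> \<and> \<rho> < 1 \<and> (\<forall>u g j. admissible u g \<longrightarrow>
      (\<integral>\<^sup>+x. ennreal (\<bar>\<Delta> j u x\<bar> powr q) \<partial>?M) \<le> ennreal (C * \<rho> ^ j))"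
  proof -
    consider (small) "q < 2" | (grad) "q \<ge> 2" "1 / q > 1 / 2 - 1 / N"
      | (loc) "q > 2" "1 / q > 1 / p" | (coul) "q > 2" "1 / q > (2 + \<alpha>) / (2 * (2 * p + \<alpha>))"
    proof (cases "q = 2")
      case True
      then show thesis using that(2) N by simp
    qed (use cond N_def that in \<open>fastforce\<close>)
    then show ?thesis
    proof cases
      case small
      obtain C \<rho> where "C \<ge> 0" "0 < \<rho>" "\<rho> < 1"
        "\<And>(M :: 'a measure) f j. f \<in> borel_measurable M \<Longrightarrow>
          (\<integral>\<^sup>+x. ennreal (\<bar>f x\<bar> powr 0) \<partial>M) \<le> ennreal (V * 2 powr (0 * real j)) \<Longrightarrow>
          (\<integral>\<^sup>+x. ennreal (\<bar>f x\<bar> powr 2) \<partial>M) \<le> ennreal (c * 2 powr (- 2 * real j)) \<Longrightarrow>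
          (\<integral>\<^sup>+x. ennreal (\<bar>f x\<bar> powr q) \<partial>M) \<le> ennreal (C * \<rho> ^ j)"
        by (rule interpolation_decay[of 0 q 2 0 "-2" V c]) (use small q V c in auto)
      then show ?thesis using X0 X2 \<Delta>m by blast
    next
      case loc
      then have "q < p" using q p by (simp add: divide_simps split: if_splits)
      then have "(p - q) * (- 2) + (q - 2) * 0 < 0" by simp
      moreover have "2 powr p * ((V + E * k) + (V + E * k)) \<ge> 0" using V EG k by simp
      ultimately obtain C \<rho> where "C \<ge> 0" "0 < \<rho>" "\<rho> < 1"
        "\<And>(M :: 'a measure) f j. f \<in> borel_measurable M \<Longrightarrow>
          (\<integral>\<^sup>+x. ennreal (\<bar>f x\<bar> powr 2) \<partial>M) \<le> ennreal (c * 2 powr (- 2 * real j)) \<Longrightarrow>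
          (\<integral>\<^sup>+x. ennreal (\<bar>f x\<bar> powr p) \<partial>M) \<le> ennreal (2 powr p * ((V + E * k) + (V + E * k)) * 2 powr (0 * real j)) \<Longrightarrow>
          (\<integral>\<^sup>+x. ennreal (\<bar>f x\<bar> powr q) \<partial>M) \<le> ennreal (C * \<rho> ^ j)"
        using interpolation_decay[OF loc(1) \<open>q < p\<close> _ c] by blast
      then show ?thesis using X2 Xp \<Delta>m by blast
    next
      case coul
      have lt: "q * (2 + \<alpha>) < 2 * (2 * p + \<alpha>)"
        using coul(2) q p \<alpha> by (simp add: divide_simps split: if_splits) (simp add: algebra_simps)
      have "2 * (2 * p + \<alpha>) \<le> 2 * p * (2 + \<alpha>)" using p \<alpha> mult_right_mono[of 1 p \<alpha>] by (simp add: algebra_simps)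
      then have "q * (2 + \<alpha>) < 2 * p * (2 + \<alpha>)" using lt by linarith
      then have q2p: "q < 2 * p" using \<alpha> by (simp add: mult_less_cancel_right)
      have "(2 * p - q) * (- 2) + (q - 2) * \<alpha> < 0" using lt by (simp add: algebra_simps)
      moreover have "2 powr (2 * p) * (E * k * 2 powr \<alpha> + E * k) \<ge> 0" using EG k by simp
      ultimately obtain C \<rho> where "C \<ge> 0" "0 < \<rho>" "\<rho> < 1"
        "\<And>(M :: 'a measure) f j. f \<in> borel_measurable M \<Longrightarrow>
          (\<integral>\<^sup>+x. ennreal (\<bar>f x\<bar> powr 2) \<partial>M) \<le> ennreal (c * 2 powr (- 2 * real j)) \<Longrightarrow>
          (\<integral>\<^sup>+x. ennreal (\<bar>f x\<bar> powr (2 * p)) \<partial>M) \<le> ennreal (2 powr (2 * p) * (E * k * 2 powr \<alpha> + E * k) * 2 powr (\<alpha> * real j)) \<Longrightarrow>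
          (\<integral>\<^sup>+x. ennreal (\<bar>f x\<bar> powr q) \<partial>M) \<le> ennreal (C * \<rho> ^ j)"
        using interpolation_decay[OF coul(1) q2p _ c] by blast
      then show ?thesis using X2 X2p \<Delta>m by blast
    next
      case grad
      \<comment> \<open>the exponent of $2^j$ in $\sup|\Delta_j|^{q-2}\int|\Delta_j|^2$\<close>
      define e where "e = (N - 2) / 2 * (q - 2) - 2"
      have e: "e < 0"
      proof -
        have "2 * q * N * (1 / 2 - 1 / N) < 2 * q * N * (1 / q)"
          using grad q N by (intro mult_strict_left_mono) auto
        then have "q * N - 2 * q < 2 * N" using q N by (simp add: algebra_simps)
        then show ?thesis by (simp add: e_def algebra_simps)
      qed
      define C where "C = c powr ((q - 2) / 2) * c"
      have main: "(\<integral>\<^sup>+x. ennreal (\<bar>\<Delta> j u x\<bar> powr q) \<partial>?M) \<le> ennreal (C * (2 powr e) ^ j)" if ad: "admissible u g" for u g j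
      proof -
        define S where "S = (c * 2 powr ((N - 2) * real j)) powr ((q - 2) / 2)"
        have "\<bar>\<Delta> j u x\<bar> powr q \<le> S * \<bar>\<Delta> j u x\<bar> powr 2" for x
        proof -
          have "\<bar>\<Delta> j u x\<bar> powr q = (\<bar>\<Delta> j u x\<bar> powr 2) powr ((q - 2) / 2) * \<bar>\<Delta> j u x\<bar> powr 2"
            unfolding powr_powr powr_add[symmetric] by (simp add: field_simps)
          also have "\<dots> \<le> S * \<bar>\<Delta> j u x\<bar> powr 2"
            unfolding S_def using Xsup[OF ad] grad(1) by (intro mult_right_mono powr_mono2) auto
          finally show ?thesis .
        qed
        then have "(\<integral>\<^sup>+x. ennreal (\<bar>\<Delta> j u x\<bar> powr q) \<partial>?M) \<le> (\<integral>\<^sup>+x. ennreal S * ennreal (\<bar>\<Delta> j u x\<bar> powr 2) \<partial>?M)"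
          by (intro nn_integral_mono) (simp add: S_def flip: ennreal_mult)
        also have "\<dots> = ennreal S * (\<integral>\<^sup>+x. ennreal (\<bar>\<Delta> j u x\<bar> powr 2) \<partial>?M)"
          using \<Delta>m by (intro nn_integral_cmult) measurable
        also have "\<dots> \<le> ennreal S * ennreal (c * 2 powr (- 2 * real j))"
          by (intro mult_left_mono X2[OF ad]) auto
        also have "\<dots> = ennreal (S * (c * 2 powr (- 2 * real j)))"
          using c by (simp add: S_def flip: ennreal_mult)
        also have "S * (c * 2 powr (- 2 * real j)) = C * (2 powr e) ^ j"
        proof -
          have "(2 powr e) ^ j = (2::real) powr (e * real j)" by (simp add: powr_powr flip: powr_realpow)
          also have "e * real j = (N - 2) * real j * ((q - 2) / 2) + - 2 * real j"
            unfolding e_def by (simp add: field_simps)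
          finally have p: "(2 powr e) ^ j = 2 powr ((N - 2) * real j * ((q - 2) / 2)) * (2::real) powr (- 2 * real j)"
            by (simp only: powr_add)
          show ?thesis unfolding p S_def C_def using c by (simp add: powr_mult powr_powr)
        qed
        finally show ?thesis .
      qed
      have "2 powr e < (1::real)" using powr_less_mono[OF e, of 2] by simp
      then show ?thesis using main c by (intro exI[of _ C] exI[of _ "2 powr e"]) (auto simp: C_def)
    qed
  qed
  then show thesis
    using that unfolding admissible_def \<Delta>_def by blast
qed

section \<open>Compactness in the subcritical range\<close>

lemma coulomb_sobolevD:
  fixes u :: "'a::euclidean_space \<Rightarrow> real"
  assumes u: "u \<in> coulomb_sobolev \<alpha> p" and B: "coulomb_sobolev_norm \<alpha> p u \<le> B" and p: "p \<ge> 1"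
  shows "has_weak_gradient u (weak_gradient u)"
    and "coulomb_energy \<alpha> p u \<le> ennreal ((B\<^sup>2) powr p)"
    and "(\<integral>\<^sup>+y. ennreal ((norm (weak_gradient u y))\<^sup>2) \<partial>lborel) \<le> ennreal (B\<^sup>2)"
proof -
  have wd: "weakly_differentiable u" and en: "coulomb_energy \<alpha> p u < \<infinity>"
    and gi: "integrable lebesgue (\<lambda>x. (norm (weak_gradient u x))\<^sup>2)"
    using u by (auto simp: coulomb_sobolev_def)
  show "has_weak_gradient u (weak_gradient u)"
    using wd unfolding weakly_differentiable_def weak_gradient_def by (rule someI_ex)
  define I where "I = (LINT x|lebesgue. (norm (weak_gradient u x))\<^sup>2)"
  define e where "e = enn2real (coulomb_energy \<alpha> p u)"
  have I: "I \<ge> 0" unfolding I_def by (intro Bochner_Integration.integral_nonneg) auto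
  have e: "e \<ge> 0" "coulomb_energy \<alpha> p u = ennreal e" using en by (auto simp: e_def)
  have "sqrt (I + e powr (1 / p)) \<le> B" using B by (simp add: coulomb_sobolev_norm_def I_def e_def)
  then have sum: "I + e powr (1 / p) \<le> B\<^sup>2"
    by (rule sqrt_le_D)
  then have "e powr (1 / p) \<le> B\<^sup>2" using I by linarith
  then have "(e powr (1 / p)) powr p \<le> (B\<^sup>2) powr p" using p by (intro powr_mono2) auto
  then show "coulomb_energy \<alpha> p u \<le> ennreal ((B\<^sup>2) powr p)"
    using e p by (simp add: powr_powr ennreal_leI)
  have "(\<integral>\<^sup>+y. ennreal ((norm (weak_gradient u y))\<^sup>2) \<partial>lborel) = ennreal I"
    unfolding I_def by (subst nn_integral_eq_integral[OF gi, symmetric]) (auto simp: nn_integral_completion)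
  moreover have "I \<le> B\<^sup>2" using sum powr_ge_zero[of e "1 / p"] by linarith
  ultimately show "(\<integral>\<^sup>+y. ennreal ((norm (weak_gradient u y))\<^sup>2) \<partial>lborel) \<le> ennreal (B\<^sup>2)"
    by (simp add: ennreal_leI)
qed

text \<open>
  On a cell the average is constant, so its value is controlled by its $L^{2p}$ norm and the volume of the
  cell.
\<close>

lemma avg_bounded:
  fixes \<alpha> p E :: real
  assumes \<alpha>: "0 < \<alpha>" "\<alpha> < real DIM('a::euclidean_space)" and p: "p \<ge> 1" and E: "E \<ge> 0"
  obtains b where "\<And>(u :: 'a \<Rightarrow> real) j x. locally_integrable u \<Longrightarrow> coulomb_energy \<alpha> p u \<le> ennreal E \<Longrightarrow>
      \<bar>avg j u x\<bar> \<le> b j"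
proof -
  obtain k where k: "k > 0" and energy: "\<And>(u :: 'a \<Rightarrow> real) j E. u \<in> borel_measurable lebesgue \<Longrightarrow> coulomb_energy \<alpha> p u \<le> ennreal E \<Longrightarrow> E \<ge> 0 \<Longrightarrow>
      (\<integral>\<^sup>+x. (navg j (\<lambda>y. ennreal (\<bar>u y\<bar> powr p)) x)\<^sup>2 \<partial>lborel) \<le> ennreal (E * k * 2 powr (\<alpha> * real j))"
    using nn_integral_navg_square_le_energy[OF \<alpha>, of p thesis] by blast
  define b where "b j = (E * k * 2 powr (\<alpha> * real j) * 2 ^ (j * DIM('a))) powr (1 / (2 * p))" for j
  have "\<bar>avg j u x\<bar> \<le> b j" if u: "locally_integrable u" "coulomb_energy \<alpha> p u \<le> ennreal E" for u :: "'a \<Rightarrow> real" and j x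
  proof -
    define A where "A = \<bar>avg j u x\<bar> powr (2 * p)"
    have "ennreal A * ennreal (1 / 2 ^ (j * DIM('a))) = (\<integral>\<^sup>+y. ennreal A * indicator (cell j x) y \<partial>lborel)"
      by (simp add: nn_integral_cmult_indicator emeasure_cell)
    also have "\<dots> \<le> (\<integral>\<^sup>+y. ennreal (\<bar>avg j u y\<bar> powr (2 * p)) \<partial>lborel)"
      by (intro nn_integral_mono) (auto simp: A_def gavg_dcell split: split_indicator)
    also have "\<dots> \<le> ennreal (E * k * 2 powr (\<alpha> * real j))"
      by (rule order_trans[OF avg_powr_2p_le[OF u(1) p]])
         (rule energy[OF locally_integrable_measurable[OF u(1)] u(2) E])
    finally have "A * (1 / 2 ^ (j * DIM('a))) \<le> E * k * 2 powr (\<alpha> * real j)"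
      using E k by (simp add: A_def flip: ennreal_mult)
    then have "A \<le> E * k * 2 powr (\<alpha> * real j) * 2 ^ (j * DIM('a))"
      by (simp add: pos_divide_le_eq)
    then have "A powr (1 / (2 * p)) \<le> b j"
      unfolding b_def using p by (intro powr_mono2) (auto simp: A_def)
    then show ?thesis using p by (simp add: A_def powr_powr)
  qed
  then show thesis using that by blast
qed

lemma nn_integral_triangle3:
  fixes f g h w :: "'x \<Rightarrow> real"
  assumes m: "f \<in> borel_measurable M" "g \<in> borel_measurable M" "h \<in> borel_measurable M" "w \<in> borel_measurable M"
    and q: "q \<ge> 0"
  shows "(\<integral>\<^sup>+x. ennreal (\<bar>f x - w x\<bar> powr q) \<partial>M) \<le> ennreal (4 powr q) *
    ((\<integral>\<^sup>+x. ennreal (\<bar>f x - g x\<bar> powr q) \<partial>M) + (\<integral>\<^sup>+x. ennreal (\<bar>g x - h x\<bar> powr q) \<partial>M)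
     + (\<integral>\<^sup>+x. ennreal (\<bar>w x - h x\<bar> powr q) \<partial>M))"
proof -
  note [measurable] = m
  have "ennreal (\<bar>f x - w x\<bar> powr q) \<le> ennreal (4 powr q) *
      (ennreal (\<bar>f x - g x\<bar> powr q) + ennreal (\<bar>g x - h x\<bar> powr q) + ennreal (\<bar>w x - h x\<bar> powr q))" for x
  proof -
    let ?a = "\<bar>f x - g x\<bar> powr q" and ?b = "\<bar>g x - h x\<bar> powr q" and ?c = "\<bar>w x - h x\<bar> powr q"
    have "\<bar>f x - w x\<bar> powr q = \<bar>(f x - g x) - ((w x - h x) - (g x - h x))\<bar> powr q" by (simp add: algebra_simps)
    also have "\<dots> \<le> 2 powr q * (?a + \<bar>(w x - h x) - (g x - h x)\<bar> powr q)" by (rule powr_abs_diff_le[OF q])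
    also have "\<dots> \<le> 2 powr q * (2 powr q * ?a + 2 powr q * (?c + ?b))"
    proof (intro mult_left_mono add_mono powr_abs_diff_le[OF q])
      have "1 \<le> (2::real) powr q" using q ge_one_powr_ge_zero[of 2 q] by simp
      then show "?a \<le> 2 powr q * ?a" by (simp add: mult_right_mono[of 1 "2 powr q" ?a, simplified])
    qed auto
    also have "\<dots> = (2 powr q * 2 powr q) * (?a + ?b + ?c)" by (simp add: algebra_simps)
    also have "2 powr q * 2 powr q = (4::real) powr q" by (simp flip: powr_mult)
    finally show ?thesis by (simp add: ennreal_leI flip: ennreal_mult ennreal_plus)
  qed
  then have "(\<integral>\<^sup>+x. ennreal (\<bar>f x - w x\<bar> powr q) \<partial>M) \<le> (\<integral>\<^sup>+x. ennreal (4 powr q) *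
      (ennreal (\<bar>f x - g x\<bar> powr q) + ennreal (\<bar>g x - h x\<bar> powr q) + ennreal (\<bar>w x - h x\<bar> powr q)) \<partial>M)"
    by (rule nn_integral_mono)
  also have "\<dots> = ennreal (4 powr q) *
    ((\<integral>\<^sup>+x. ennreal (\<bar>f x - g x\<bar> powr q) \<partial>M) + (\<integral>\<^sup>+x. ennreal (\<bar>g x - h x\<bar> powr q) \<partial>M)
     + (\<integral>\<^sup>+x. ennreal (\<bar>w x - h x\<bar> powr q) \<partial>M))"
    by (subst nn_integral_cmult) (auto simp: nn_integral_add)
  finally show ?thesis .
qed

lemma mem_Lq_onI:
  assumes v: "v \<in> borel_measurable lebesgue" and K: "K \<in> sets lebesgue" "K \<subseteq> L" and L: "L \<in> sets lebesgue"
    and fin: "(\<integral>\<^sup>+x. ennreal (\<bar>v x\<bar> powr q) \<partial>lebesgue_on L) < \<infinity>"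
  shows "v \<in> Lq_on q K"
proof -
  have vm [measurable]: "v \<in> borel_measurable (lebesgue_on K)" using v by (rule lebesgue_on_measurable)
  have "(\<integral>\<^sup>+x. ennreal (\<bar>v x\<bar> powr q) \<partial>lebesgue_on K) \<le> (\<integral>\<^sup>+x. ennreal (\<bar>v x\<bar> powr q) \<partial>lebesgue_on L)"
    unfolding nn_integral_lebesgue_on[OF K(1)] nn_integral_lebesgue_on[OF L]
    using K(2) by (intro nn_integral_mono) (auto split: split_indicator)
  then have "(\<integral>\<^sup>+x. ennreal (norm (\<bar>v x\<bar> powr q)) \<partial>lebesgue_on K) < \<infinity>"
    using fin by (simp add: le_less_trans)
  then have "integrable (lebesgue_on K) (\<lambda>x. \<bar>v x\<bar> powr q)"
    by (intro integrableI_bounded) measurable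
  then show ?thesis using vm by (simp add: Lq_on_def)
qed

lemma Lq_norm_tendsto_zeroI:
  assumes f: "\<And>n. f n \<in> borel_measurable lebesgue" and K: "K \<in> sets lebesgue" "K \<subseteq> L" and L: "L \<in> sets lebesgue"
    and q: "q \<ge> 1" and lim: "(\<lambda>n. \<integral>\<^sup>+x. ennreal (\<bar>f n x\<bar> powr q) \<partial>lebesgue_on L) \<longlonglongrightarrow> 0"
  shows "(\<lambda>n. Lq_norm q K (f n)) \<longlonglongrightarrow> 0"
proof -
  have le: "(\<integral>\<^sup>+x. ennreal (\<bar>f n x\<bar> powr q) \<partial>lebesgue_on K) \<le> (\<integral>\<^sup>+x. ennreal (\<bar>f n x\<bar> powr q) \<partial>lebesgue_on L)" for n
    unfolding nn_integral_lebesgue_on[OF K(1)] nn_integral_lebesgue_on[OF L]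
    using K(2) by (intro nn_integral_mono) (auto split: split_indicator)
  have "(\<lambda>n. \<integral>\<^sup>+x. ennreal (\<bar>f n x\<bar> powr q) \<partial>lebesgue_on K) \<longlonglongrightarrow> 0"
    by (rule tendsto_sandwich[OF _ _ tendsto_const lim]) (use le in auto)
  then have "(\<lambda>n. enn2real (\<integral>\<^sup>+x. ennreal (\<bar>f n x\<bar> powr q) \<partial>lebesgue_on K)) \<longlonglongrightarrow> 0"
    by (intro tendsto_enn2real) auto
  moreover have "(LINT x|lebesgue_on K. \<bar>f n x\<bar> powr q) = enn2real (\<integral>\<^sup>+x. ennreal (\<bar>f n x\<bar> powr q) \<partial>lebesgue_on K)" for n
  proof (rule integral_eq_nn_integral)
    have [measurable]: "f n \<in> borel_measurable (lebesgue_on K)" using f by (rule lebesgue_on_measurable)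
    show "(\<lambda>x. \<bar>f n x\<bar> powr q) \<in> borel_measurable (lebesgue_on K)" by measurable
  qed simp
  ultimately have "(\<lambda>n. LINT x|lebesgue_on K. \<bar>f n x\<bar> powr q) \<longlonglongrightarrow> 0" by simp
  then show ?thesis
    unfolding Lq_norm_def using q by (intro tendsto_zero_powrI[where b="1 / q"]) auto
qed

text \<open>
  In $L^q$ of a bounded set, $u_n$ is close to $A_ju_n$ uniformly in $n$. Along a subsequence all values of
  all averages converge, $A_ju_n\to a_j$, and by Fatou the $a_j$ inherit the decay of increments. Their limit $v$
  is the limit of the subsequence.
\<close>

theorem compactly_embedded_of_subcritical:
  fixes \<alpha> p q :: real
  assumes \<alpha>: "0 < \<alpha>" "\<alpha> < real DIM('a::euclidean_space)" and p: "1 \<le> p" and q: "1 \<le> q"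
    and cond: "1 / q > 1 / 2 - 1 / real DIM('a) \<or> 1 / q > 1 / p \<or> 1 / q > (2 + \<alpha>) / (2 * (2 * p + \<alpha>))"
  shows "compactly_embedded_Lq_loc (coulomb_sobolev \<alpha> p :: ('a \<Rightarrow> real) set) (coulomb_sobolev_norm \<alpha> p) q"
proof -
  let ?E = "coulomb_sobolev \<alpha> p :: ('a \<Rightarrow> real) set"
  have meas: "u \<in> borel_measurable lebesgue" if "u \<in> ?E" for u
    using that by (simp add: coulomb_sobolev_def)
  have loc: "locally_integrable u" if "u \<in> ?E" for u
    using coulomb_sobolevD(1)[OF that order_refl p] by (simp add: has_weak_gradient_def)
  have inc: "\<exists>C \<rho>. C \<ge> 0 \<and> 0 < \<rho> \<and> \<rho> < 1 \<and> (\<forall>u j. u \<in> ?E \<longrightarrow> coulomb_sobolev_norm \<alpha> p u \<le> B \<longrightarrow>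
      (\<integral>\<^sup>+x. ennreal (\<bar>avg (Suc j) u x - avg j u x\<bar> powr q) \<partial>lebesgue_on (lattice_box m)) \<le> ennreal (C * \<rho> ^ j))" for B m
  proof (rule increments_Lq_decay[OF \<alpha> p q _ _ cond, of "(B\<^sup>2) powr p" "B\<^sup>2" m])
    fix C \<rho> :: real
    assume C: "C \<ge> 0" "0 < \<rho>" "\<rho> < 1" and
      *: "\<And>(u :: 'a \<Rightarrow> real) g j. has_weak_gradient u g \<Longrightarrow> coulomb_energy \<alpha> p u \<le> ennreal ((B\<^sup>2) powr p) \<Longrightarrow>
        (\<integral>\<^sup>+y. ennreal ((norm (g y))\<^sup>2) \<partial>lborel) \<le> ennreal (B\<^sup>2) \<Longrightarrow>
        (\<integral>\<^sup>+x. ennreal (\<bar>avg (Suc j) u x - avg j u x\<bar> powr q) \<partial>lebesgue_on (lattice_box m)) \<le> ennreal (C * \<rho> ^ j)"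
    show ?thesis
    proof (rule exI[of _ C], rule exI[of _ \<rho>], intro conjI allI impI C)
      fix u :: "'a \<Rightarrow> real" and j assume u: "u \<in> ?E" "coulomb_sobolev_norm \<alpha> p u \<le> B"
      show "(\<integral>\<^sup>+x. ennreal (\<bar>avg (Suc j) u x - avg j u x\<bar> powr q) \<partial>lebesgue_on (lattice_box m)) \<le> ennreal (C * \<rho> ^ j)"
        by (rule *[OF coulomb_sobolevD[OF u p]])
    qed
  qed auto
  have approx: "(\<integral>\<^sup>+x. ennreal (\<bar>u x - avg j u x\<bar> powr q) \<partial>lebesgue_on (lattice_box m)) \<le> ennreal (telescope_const q \<rho> * C * \<rho> ^ j)"
    if C: "C \<ge> 0" "0 < \<rho>" "\<rho> < 1" and u: "u \<in> ?E"
      and inc: "\<And>j. (\<integral>\<^sup>+x. ennreal (\<bar>avg (Suc j) u x - avg j u x\<bar> powr q) \<partial>lebesgue_on (lattice_box m)) \<le> ennreal (C * \<rho> ^ j)"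
    for u C \<rho> m j
  proof -
    have ae: "AE x in lebesgue. (\<lambda>j. avg j u x) \<longlonglongrightarrow> u x"
      by (rule AE_completion[OF AE_avg_tendsto[OF coulomb_sobolevD(1)[OF u order_refl p]]])
    then have "AE x in lebesgue_on (lattice_box m). (\<lambda>j. avg j u x) \<longlonglongrightarrow> u x"
      by (subst AE_restrict_space_iff) auto
    then have "(\<integral>\<^sup>+x. ennreal (\<bar>u x - avg j u x\<bar> powr q) \<partial>lebesgue_on (lattice_box m))
        = (\<integral>\<^sup>+x. ennreal (\<bar>lim (\<lambda>i. avg i u x) - avg j u x\<bar> powr q) \<partial>lebesgue_on (lattice_box m))"
      by (intro nn_integral_cong_AE) (auto elim!: eventually_mono simp: limI)
    also have "\<dots> \<le> ennreal (telescope_const q \<rho> * C * \<rho> ^ j)"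
      by (rule telescope_Lq(2)[OF _ q C(2,3,1) inc]) simp
    finally show ?thesis .
  qed
  have bdd: "\<exists>b. \<forall>u j x. u \<in> ?E \<longrightarrow> coulomb_sobolev_norm \<alpha> p u \<le> B \<longrightarrow> \<bar>avg j u x\<bar> \<le> b j" for B
  proof (rule avg_bounded[OF \<alpha> p, of "(B\<^sup>2) powr p"])
    fix b assume *: "\<And>(u :: 'a \<Rightarrow> real) j x. locally_integrable u \<Longrightarrow> coulomb_energy \<alpha> p u \<le> ennreal ((B\<^sup>2) powr p) \<Longrightarrow> \<bar>avg j u x\<bar> \<le> b j"
    show ?thesis
    proof (rule exI[of _ b], intro allI impI)
      fix u :: "'a \<Rightarrow> real" and j x assume u: "u \<in> ?E" "coulomb_sobolev_norm \<alpha> p u \<le> B"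
      show "\<bar>avg j u x\<bar> \<le> b j"
        by (rule *[OF loc[OF u(1)] coulomb_sobolevD(2)[OF u p]])
    qed
  qed auto
  have Kfin: "emeasure (lebesgue_on (lattice_box m :: 'a set)) (lattice_box m) < \<infinity>" for m
    using emeasure_lattice_box_finite[of m, where 'a='a] by (subst emeasure_restrict_space) auto
  have bound_int: "(\<integral>\<^sup>+x. ennreal (\<bar>f x\<bar> powr q) \<partial>lebesgue_on (lattice_box m :: 'a set)) < \<infinity>"
    if "\<And>x. \<bar>f x\<bar> \<le> b" for f :: "'a \<Rightarrow> real" and b m
  proof -
    have "(\<integral>\<^sup>+x. ennreal (\<bar>f x\<bar> powr q) \<partial>lebesgue_on (lattice_box m :: 'a set)) \<le> (\<integral>\<^sup>+x. ennreal (b powr q) \<partial>lebesgue_on (lattice_box m :: 'a set))"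
      using that q by (intro nn_integral_mono ennreal_leI powr_mono2) auto
    also have "\<dots> < \<infinity>" using Kfin[of m] by (simp add: ennreal_mult_less_top space_restrict_space)
    finally show ?thesis .
  qed
  have Lq: "v \<in> Lq_on q K" if K: "compact K" and v: "v \<in> borel_measurable lebesgue"
      and a: "\<And>x. \<bar>a x\<bar> \<le> b" "a \<in> borel_measurable lebesgue"
      and fin: "\<And>m. (\<integral>\<^sup>+x. ennreal (\<bar>v x - a x\<bar> powr q) \<partial>lebesgue_on (lattice_box m)) < \<infinity>"
    for v a :: "'a \<Rightarrow> real" and b K
  proof -
    obtain m where m: "K \<subseteq> lattice_box m" using bounded_subset_lattice_box[OF compact_imp_bounded[OF K]] .
    have "(\<integral>\<^sup>+x. ennreal (\<bar>(v x - a x) - (- a x)\<bar> powr q) \<partial>lebesgue_on (lattice_box m)) \<le>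
        ennreal (2 powr q) * ((\<integral>\<^sup>+x. ennreal (\<bar>v x - a x\<bar> powr q) \<partial>lebesgue_on (lattice_box m)) + (\<integral>\<^sup>+x. ennreal (\<bar>- a x\<bar> powr q) \<partial>lebesgue_on (lattice_box m)))"
    proof (rule nn_integral_powr_diff_le)
      have [measurable]: "v \<in> borel_measurable (lebesgue_on (lattice_box m))" "a \<in> borel_measurable (lebesgue_on (lattice_box m))"
        using v a(2) by (auto intro: lebesgue_on_measurable)
      show "(\<lambda>x. v x - a x) \<in> borel_measurable (lebesgue_on (lattice_box m))" "(\<lambda>x. - a x) \<in> borel_measurable (lebesgue_on (lattice_box m))"
        by measurable
    qed (use q in simp)
    also have "\<dots> < \<infinity>"
      using fin[of m] bound_int[of a b m, OF a(1)] by (simp add: ennreal_mult_less_top)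
    finally have "(\<integral>\<^sup>+x. ennreal (\<bar>v x\<bar> powr q) \<partial>lebesgue_on (lattice_box m)) < \<infinity>" by simp
    then show ?thesis
      by (intro mem_Lq_onI[OF v _ m]) (use K in \<open>auto simp: lmeasurable_compact fmeasurableD\<close>)
  qed
  have "u \<in> Lq_loc q" if u: "u \<in> ?E" for u
  proof -
    obtain b where b: "\<And>x. \<bar>avg 0 u x\<bar> \<le> b" using bdd[of "coulomb_sobolev_norm \<alpha> p u"] u by blast
    have "(\<integral>\<^sup>+x. ennreal (\<bar>u x - avg 0 u x\<bar> powr q) \<partial>lebesgue_on (lattice_box m)) < \<infinity>" for m
    proof -
      obtain C \<rho> where C: "C \<ge> 0" "0 < \<rho>" "\<rho> < 1" and
        *: "\<And>j. (\<integral>\<^sup>+x. ennreal (\<bar>avg (Suc j) u x - avg j u x\<bar> powr q) \<partial>lebesgue_on (lattice_box m)) \<le> ennreal (C * \<rho> ^ j)"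
        using inc[of "coulomb_sobolev_norm \<alpha> p u" m] u by blast
      show ?thesis by (rule le_less_trans[OF approx[OF C u *, of 0]]) simp
    qed
    then show ?thesis
      using Lq[OF _ meas[OF u] b borel_imp_lebesgue[OF avg_measurable]] meas[OF u] by (simp add: Lq_loc_def)
  qed
  moreover have "\<exists>r. strict_mono r \<and> (\<forall>K. compact K \<longrightarrow> converges_in_Lq q K (\<lambda>n. u (r n)))"
    if u: "\<And>n. u n \<in> ?E" and B: "\<And>n. coulomb_sobolev_norm \<alpha> p (u n) \<le> B" for u :: "nat \<Rightarrow> 'a \<Rightarrow> real" and B
  proof -
    obtain b where b: "\<And>n j x. \<bar>avg j (u n) x\<bar> \<le> b j" using bdd[of B] u B by blast
    have b0: "b j \<ge> 0" for j using b[of j 0 0] by linarith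
    obtain D :: "'a set" where D: "countable D" "\<And>X. open X \<Longrightarrow> X \<noteq> {} \<Longrightarrow> \<exists>d\<in>D. d \<in> X"
      by (erule countable_dense_setE)
    \<comment> \<open>dividing by the bound of generation \<open>j\<close> makes the family uniformly bounded\<close>
    define F where "F n = (\<lambda>(j, d). avg j (u n) d / (b j + 1))" for n
    have c: "countable ((UNIV :: nat set) \<times> D)" using D(1) by simp
    have F1: "norm (F n z) \<le> 1" for n z
      using b[of "fst z" n "snd z"] b0[of "fst z"] by (simp add: F_def split_beta divide_le_eq)
    obtain r where r: "strict_mono (r :: nat \<Rightarrow> nat)" "\<And>z. z \<in> UNIV \<times> D \<Longrightarrow> \<exists>l. (\<lambda>n. F (r n) z) \<longlonglongrightarrow> l"
      by (rule function_convergent_subsequence[of "UNIV \<times> D" F 1, OF c F1]) blast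
    have conv: "\<exists>l. (\<lambda>n. avg j (u (r n)) x) \<longlonglongrightarrow> l" for j x
    proof -
      obtain d where d: "d \<in> D" "cell j x = cell j d" using dcell_eq_of_dense[OF D(2)] by blast
      obtain l where "(\<lambda>n. F (r n) (j, d)) \<longlonglongrightarrow> l" using r(2)[of "(j, d)"] d(1) by auto
      then have "(\<lambda>n. F (r n) (j, d) * (b j + 1)) \<longlonglongrightarrow> l * (b j + 1)" by (intro tendsto_intros)
      moreover have "F (r n) (j, d) * (b j + 1) = avg j (u (r n)) x" for n
        using b0[of j] d(2) by (simp add: F_def gavg_def)
      ultimately show ?thesis by auto
    qed
    define a where "a j x = lim (\<lambda>n. avg j (u (r n)) x)" for j x
    have a: "(\<lambda>n. avg j (u (r n)) x) \<longlonglongrightarrow> a j x" for j x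
      using conv[of j x] by (auto simp: a_def limI)
    have am: "a j \<in> borel_measurable lebesgue" for j
      unfolding a_def[abs_def] by (intro borel_imp_lebesgue) measurable
    have amK [measurable]: "a j \<in> borel_measurable (lebesgue_on S)" for j S
      by (rule lebesgue_on_measurable[OF am])
    have ab: "\<bar>a j x\<bar> \<le> b j" for j x
      using LIMSEQ_le_const2[OF tendsto_rabs[OF a[of j x]]] b by blast
    define v where "v x = lim (\<lambda>j. a j x)" for x
    have vm: "v \<in> borel_measurable lebesgue"
      unfolding v_def[abs_def] using am by (rule borel_measurable_lim_metric)
    have main: "(\<lambda>n. \<integral>\<^sup>+x. ennreal (\<bar>u (r n) x - v x\<bar> powr q) \<partial>lebesgue_on (lattice_box m)) \<longlonglongrightarrow> 0"
      and vfin: "(\<integral>\<^sup>+x. ennreal (\<bar>v x - a 0 x\<bar> powr q) \<partial>lebesgue_on (lattice_box m)) < \<infinity>" for m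
    proof -
      let ?M = "lebesgue_on (lattice_box m :: 'a set)"
      obtain C \<rho> where C: "C \<ge> 0" "0 < \<rho>" "\<rho> < 1" and
        *: "\<And>n j. (\<integral>\<^sup>+x. ennreal (\<bar>avg (Suc j) (u n) x - avg j (u n) x\<bar> powr q) \<partial>?M) \<le> ennreal (C * \<rho> ^ j)"
        using inc[of B m] u B by blast
      have inca: "(\<integral>\<^sup>+x. ennreal (\<bar>a (Suc j) x - a j x\<bar> powr q) \<partial>?M) \<le> ennreal (C * \<rho> ^ j)" for j
      proof -
        have lim: "(\<lambda>n. ennreal (\<bar>avg (Suc j) (u (r n)) x - avg j (u (r n)) x\<bar> powr q)) \<longlonglongrightarrow> ennreal (\<bar>a (Suc j) x - a j x\<bar> powr q)" for x
          using q by (intro tendsto_ennrealI tendsto_powr' tendsto_rabs tendsto_diff a tendsto_const) auto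
        have "(\<integral>\<^sup>+x. ennreal (\<bar>a (Suc j) x - a j x\<bar> powr q) \<partial>?M)
            = (\<integral>\<^sup>+x. liminf (\<lambda>n. ennreal (\<bar>avg (Suc j) (u (r n)) x - avg j (u (r n)) x\<bar> powr q)) \<partial>?M)"
          using lim_imp_Liminf[OF _ lim] by simp
        also have "\<dots> \<le> liminf (\<lambda>n. \<integral>\<^sup>+x. ennreal (\<bar>avg (Suc j) (u (r n)) x - avg j (u (r n)) x\<bar> powr q) \<partial>?M)"
          by (rule nn_integral_liminf) measurable
        also have "\<dots> \<le> liminf (\<lambda>n. ennreal (C * \<rho> ^ j))"
          by (intro Liminf_mono always_eventually allI *)
        finally show ?thesis by (simp add: Liminf_const)
      qed
      define T where "T = telescope_const q \<rho> * C"
      have va: "(\<integral>\<^sup>+x. ennreal (\<bar>v x - a j x\<bar> powr q) \<partial>?M) \<le> ennreal (T * \<rho> ^ j)" for j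
        unfolding v_def T_def by (rule telescope_Lq(2)[OF _ q C(2,3,1) inca]) measurable
      then show "(\<integral>\<^sup>+x. ennreal (\<bar>v x - a 0 x\<bar> powr q) \<partial>?M) < \<infinity>"
        by (rule le_less_trans) simp
      have au: "(\<lambda>n. \<integral>\<^sup>+x. ennreal (\<bar>avg j (u (r n)) x - a j x\<bar> powr q) \<partial>?M) \<longlonglongrightarrow> 0" for j
      proof -
        have "(\<lambda>n. \<integral>\<^sup>+x. ennreal (\<bar>avg j (u (r n)) x - a j x\<bar> powr q) \<partial>?M) \<longlonglongrightarrow> (\<integral>\<^sup>+x. ennreal 0 \<partial>?M)"
        proof (rule nn_integral_dominated_convergence[where w="\<lambda>x. ennreal ((2 * b j) powr q)"])
          show "AE x in ?M. ennreal (\<bar>avg j (u (r n)) x - a j x\<bar> powr q) \<le> ennreal ((2 * b j) powr q)" for n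
          proof (intro AE_I2 ennreal_leI powr_mono2)
            show "\<bar>avg j (u (r n)) x - a j x\<bar> \<le> 2 * b j" for x using b[of j "r n" x] ab[of j x] by linarith
          qed (use q in auto)
          have "((\<lambda>n. \<bar>avg j (u (r n)) x - a j x\<bar> powr q) \<longlonglongrightarrow> 0)" for x
          proof (rule tendsto_zero_powrI[where b=q])
            show "(\<lambda>n. \<bar>avg j (u (r n)) x - a j x\<bar>) \<longlonglongrightarrow> 0"
              using tendsto_rabs_zero[OF LIM_zero[OF a[of j x]]] .
          qed (use q in auto)
          then show "AE x in ?M. (\<lambda>n. ennreal (\<bar>avg j (u (r n)) x - a j x\<bar> powr q)) \<longlonglongrightarrow> ennreal 0"
            by (intro AE_I2 tendsto_ennrealI)
          show "(\<integral>\<^sup>+x. ennreal ((2 * b j) powr q) \<partial>?M) < \<infinity>"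
            using Kfin[of m] by (simp add: ennreal_mult_less_top space_restrict_space)
        qed measurable
        then show ?thesis by simp
      qed
      have uM: "u n \<in> borel_measurable ?M" for n by (rule lebesgue_on_measurable[OF meas[OF u]])
      show "(\<lambda>n. \<integral>\<^sup>+x. ennreal (\<bar>u (r n) x - v x\<bar> powr q) \<partial>?M) \<longlonglongrightarrow> 0"
      proof (rule order_tendstoI)
        fix e :: ennreal assume e: "0 < e"
        define T' where "T' = 4 powr q * T"
        have T: "T \<ge> 0" using C by (auto simp: T_def telescope_const_def intro!: mult_nonneg_nonneg divide_nonneg_nonneg)
        then have T': "T' \<ge> 0" by (simp add: T'_def)
        obtain \<epsilon> where \<epsilon>: "\<epsilon> > 0" "ennreal (3 * \<epsilon>) < e"
        proof -
          obtain c where c: "0 < c" "c < e" using dense[OF e] by blast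
          then have "c < top" using less_le_trans[OF c(2) top_greatest] by simp
          then have "c = ennreal (enn2real c)" "enn2real c > 0"
            using c(1) by (simp_all add: enn2real_positive_iff)
          then show ?thesis using that[of "enn2real c / 3"] c by simp
        qed
        have "(\<lambda>j. T' * \<rho> ^ j) \<longlonglongrightarrow> T' * 0"
          using C by (intro tendsto_intros LIMSEQ_power_zero) auto
        then have "eventually (\<lambda>j. T' * \<rho> ^ j < \<epsilon>) sequentially"
          using \<epsilon>(1) by (simp add: order_tendstoD)
        then obtain j where j: "T' * \<rho> ^ j < \<epsilon>" by (auto simp: eventually_sequentially)
        have "(\<lambda>n. ennreal (4 powr q) * (\<integral>\<^sup>+x. ennreal (\<bar>avg j (u (r n)) x - a j x\<bar> powr q) \<partial>?M)) \<longlonglongrightarrow> ennreal (4 powr q) * 0"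
          by (intro ennreal_tendsto_cmult au) simp
        then have "eventually (\<lambda>n. ennreal (4 powr q) * (\<integral>\<^sup>+x. ennreal (\<bar>avg j (u (r n)) x - a j x\<bar> powr q) \<partial>?M) < ennreal \<epsilon>) sequentially"
          using \<epsilon>(1) by (intro order_tendstoD(2)) auto
        then show "eventually (\<lambda>n. (\<integral>\<^sup>+x. ennreal (\<bar>u (r n) x - v x\<bar> powr q) \<partial>?M) < e) sequentially"
        proof eventually_elim
          fix n assume n: "ennreal (4 powr q) * (\<integral>\<^sup>+x. ennreal (\<bar>avg j (u (r n)) x - a j x\<bar> powr q) \<partial>?M) < ennreal \<epsilon>"
          have "(\<integral>\<^sup>+x. ennreal (\<bar>u (r n) x - v x\<bar> powr q) \<partial>?M) \<le> ennreal (4 powr q) *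
              ((\<integral>\<^sup>+x. ennreal (\<bar>u (r n) x - avg j (u (r n)) x\<bar> powr q) \<partial>?M) + (\<integral>\<^sup>+x. ennreal (\<bar>avg j (u (r n)) x - a j x\<bar> powr q) \<partial>?M)
               + (\<integral>\<^sup>+x. ennreal (\<bar>v x - a j x\<bar> powr q) \<partial>?M))"
            using q by (intro nn_integral_triangle3 uM amK avg_measurable_lebesgue_on lebesgue_on_measurable[OF vm]) auto
          also have "\<dots> \<le> ennreal (4 powr q) * ennreal (T * \<rho> ^ j) + ennreal \<epsilon> + ennreal (4 powr q) * ennreal (T * \<rho> ^ j)"
            unfolding distrib_left
            by (intro add_mono mult_left_mono va less_imp_le[OF n])
               (use approx[OF C u *] in \<open>auto simp: T_def\<close>)
          also have "\<dots> = ennreal (T' * \<rho> ^ j + \<epsilon> + T' * \<rho> ^ j)"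
            using T C \<epsilon>(1) by (simp add: T'_def mult.assoc flip: ennreal_mult ennreal_plus)
          also have "\<dots> \<le> ennreal (3 * \<epsilon>)" using j by (intro ennreal_leI) linarith
          finally show "(\<integral>\<^sup>+x. ennreal (\<bar>u (r n) x - v x\<bar> powr q) \<partial>?M) < e" using \<epsilon>(2) by (rule le_less_trans)
        qed
      qed simp
    qed
    have "converges_in_Lq q K (\<lambda>n. u (r n))" if K: "compact K" for K
    proof -
      obtain m where m: "K \<subseteq> lattice_box m" using bounded_subset_lattice_box[OF compact_imp_bounded[OF K]] .
      have "v \<in> Lq_on q K" by (rule Lq[OF K vm ab am vfin])
      moreover have "(\<lambda>n. Lq_norm q K (\<lambda>x. u (r n) x - v x)) \<longlonglongrightarrow> 0"
      proof (rule Lq_norm_tendsto_zeroI[OF _ _ m _ q main])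
        note [measurable] = meas[OF u] vm
        show "(\<lambda>x. u (r n) x - v x) \<in> borel_measurable lebesgue" for n by measurable
      qed (use K in \<open>auto simp: lmeasurable_compact fmeasurableD\<close>)
      ultimately show ?thesis by (auto simp: converges_in_Lq_def)
    qed
    then show ?thesis using r(1) by blast
  qed
  ultimately show ?thesis
    unfolding compactly_embedded_Lq_loc_def by blast
qed

section \<open>Classical gradients are weak gradients\<close>

lemma integral_lborel_translate:
  fixes h :: "'a::euclidean_space \<Rightarrow> real"
  assumes [measurable]: "h \<in> borel_measurable borel"
  shows "(LINT x|lborel. h (c + x)) = (LINT x|lborel. h x)"
proof -
  have "(LINT x|lborel. h x) = (LINT x|distr lborel borel ((+) c). h x)"
    by (subst lborel_distr_plus) simp
  also have "\<dots> = (LINT x|lborel. h (c + x))"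
    by (rule integral_distr) auto
  finally show ?thesis ..
qed

lemma integrable_continuous_compact_support:
  fixes h :: "'a::euclidean_space \<Rightarrow> 'b::{banach, second_countable_topology}"
  assumes "continuous_on UNIV h" "\<And>x. x \<notin> cball 0 R \<Longrightarrow> h x = 0"
  shows "integrable lborel h"
proof -
  have "integrable lborel (\<lambda>x. indicator (cball 0 R) x *\<^sub>R h x)"
    by (rule borel_integrable_compact) (auto intro: continuous_on_subset[OF assms(1)])
  moreover have "(\<lambda>x. indicator (cball 0 R) x *\<^sub>R h x) = h"
    using assms(2) by (auto simp: fun_eq_iff split: split_indicator)
  ultimately show ?thesis by simp
qed

text \<open>
  The integral is the limit of integrals of difference quotients, which vanish by translation invariance.
\<close>

lemma integral_directional_derivative_eq_zero:
  fixes h :: "'a::euclidean_space \<Rightarrow> real"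
  assumes h: "\<And>x. (h has_derivative h' x) (at x)" and cont: "continuous_on UNIV (\<lambda>x. h' x b)"
    and supp: "\<And>x. x \<notin> cball 0 R \<Longrightarrow> h x = 0" and R: "R \<ge> 0"
  shows "(LINT x|lborel. h' x b) = 0"
proof -
  have hc: "continuous_on UNIV h"
    using has_derivative_continuous[OF h] by (simp add: continuous_on_eq_continuous_at)
  have [measurable]: "h \<in> borel_measurable borel" "(\<lambda>x. h' x b) \<in> borel_measurable borel"
    using hc cont by (auto intro: borel_measurable_continuous_onI)
  have line: "((\<lambda>t. h (x + t *\<^sub>R b)) has_real_derivative h' (x + t *\<^sub>R b) b) (at t)" for x t
  proof -
    have "((\<lambda>t. h (x + t *\<^sub>R b)) has_derivative (\<lambda>s. h' (x + t *\<^sub>R b) (s *\<^sub>R b))) (at t)"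
      by (rule has_derivative_compose[where g=h and f="\<lambda>t. x + t *\<^sub>R b", OF _ h]) (auto intro!: derivative_eq_intros)
    moreover have "h' (x + t *\<^sub>R b) (s *\<^sub>R b) = h' (x + t *\<^sub>R b) b * s" for s
      using linear_cmul[OF bounded_linear.linear[OF has_derivative_bounded_linear[OF h]], of "x + t *\<^sub>R b" s b] by simp
    ultimately show ?thesis by (simp add: has_field_derivative_def)
  qed
  define R' where "R' = R + norm b"
  have "compact ((\<lambda>x. h' x b) ` cball 0 (R' + norm b))"
    by (intro compact_continuous_image continuous_on_subset[OF cont]) auto
  then have "bounded ((\<lambda>x. h' x b) ` cball 0 (R' + norm b))" by (rule compact_imp_bounded)
  then obtain D where "\<forall>y\<in>(\<lambda>x. h' x b) ` cball 0 (R' + norm b). \<bar>y\<bar> \<le> D"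
    unfolding bounded_iff real_norm_def by blast
  then have D: "\<And>x. x \<in> cball 0 (R' + norm b) \<Longrightarrow> \<bar>h' x b\<bar> \<le> D" by blast
  have D0: "D \<ge> 0" using D[of 0] R by (simp add: R'_def)
  define q where "q n x = (h (x + (1 / real (Suc n)) *\<^sub>R b) - h x) * real (Suc n)" for n x
  have int: "integrable lborel h" by (rule integrable_continuous_compact_support[OF hc supp])
  have qz: "(LINT x|lborel. q n x) = 0" for n
  proof -
    define c where "c = (1 / real (Suc n)) *\<^sub>R b"
    have hc': "continuous_on UNIV (\<lambda>x. h (c + x))"
      by (intro continuous_on_compose2[OF hc] continuous_intros) auto
    have cn: "norm c \<le> norm b" using mult_right_mono[of "1 / real (Suc n)" 1 "norm b"] by (simp add: c_def)
    have "h (c + x) = 0" if "x \<notin> cball 0 R'" for x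
    proof (rule supp)
      have "norm x \<le> norm (c + x) + norm c" using norm_triangle_ineq4[of "c + x" c] by simp
      then show "c + x \<notin> cball 0 R" using that cn by (simp add: R'_def)
    qed
    then have int': "integrable lborel (\<lambda>x. h (c + x))"
      by (rule integrable_continuous_compact_support[OF hc'])
    have "(LINT x|lborel. q n x) = ((LINT x|lborel. h (c + x)) - (LINT x|lborel. h x)) * real (Suc n)"
      unfolding q_def c_def[symmetric] add.commute[of _ c]
      by (simp only: integral_mult_left_zero Bochner_Integration.integral_diff[OF int' int])
    then show ?thesis by (simp add: integral_lborel_translate)
  qed
  have "(\<lambda>n. LINT x|lborel. q n x) \<longlonglongrightarrow> (LINT x|lborel. h' x b)"
  proof (rule integral_dominated_convergence[where w="\<lambda>x. D * indicator (cball 0 R') x"])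
    show "integrable lborel (\<lambda>x::'a. D * indicator (cball 0 R') x)"
    proof -
      have "emeasure lborel (cball (0::'a) R') < \<infinity>" by (rule emeasure_bounded_finite) simp
      then show ?thesis by (intro integrable_mult_right integrable_real_indicator) auto
    qed
    show "AE x in lborel. (\<lambda>n. q n x) \<longlonglongrightarrow> h' x b"
    proof (rule AE_I2)
      fix x
      have "((\<lambda>t. (h (x + t *\<^sub>R b) - h x) / t) \<longlongrightarrow> h' x b) (at 0)"
        using line[of x 0] by (simp add: DERIV_def)
      moreover have "filterlim (\<lambda>n. 1 / real (Suc n)) (at 0) sequentially"
        unfolding filterlim_at using LIMSEQ_Suc[OF lim_1_over_n] by (auto simp del: of_nat_Suc)
      ultimately have "(\<lambda>n. (h (x + (1 / real (Suc n)) *\<^sub>R b) - h x) / (1 / real (Suc n))) \<longlonglongrightarrow> h' x b"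
        by (rule filterlim_compose)
      then show "(\<lambda>n. q n x) \<longlonglongrightarrow> h' x b" by (simp add: q_def)
    qed
    show "AE x in lborel. norm (q n x) \<le> D * indicator (cball 0 R') x" for n
    proof (rule AE_I2)
      fix x
      define e where "e = 1 / real (Suc n)"
      have e: "0 < e" "e \<le> 1" by (auto simp: e_def)
      obtain t where t: "0 < t" "t < e" "h (x + e *\<^sub>R b) - h (x + 0 *\<^sub>R b) = (e - 0) * h' (x + t *\<^sub>R b) b"
        using MVT2[OF e(1), of "\<lambda>t. h (x + t *\<^sub>R b)" "\<lambda>t. h' (x + t *\<^sub>R b) b"] line by blast
      have q: "q n x = h' (x + t *\<^sub>R b) b" using t(3) e by (simp add: q_def e_def)
      show "norm (q n x) \<le> D * indicator (cball 0 R') x"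
      proof (cases "x \<in> cball 0 R'")
        case True
        have "norm (x + t *\<^sub>R b) \<le> norm x + \<bar>t\<bar> * norm b" using norm_triangle_ineq[of x "t *\<^sub>R b"] by simp
        also have "\<dots> \<le> R' + norm b" using True t e by (intro add_mono mult_left_le_one_le) auto
        finally show ?thesis using D[of "x + t *\<^sub>R b"] True by (simp add: q)
      next
        case False
        have "x + e *\<^sub>R b \<notin> cball 0 R"
        proof
          assume "x + e *\<^sub>R b \<in> cball 0 R"
          moreover have "norm x \<le> norm (x + e *\<^sub>R b) + norm (e *\<^sub>R b)" using norm_triangle_ineq4[of "x + e *\<^sub>R b" "e *\<^sub>R b"] by simp
          moreover have "norm (e *\<^sub>R b) \<le> norm b" using e by (simp add: mult_left_le_one_le)
          ultimately show False using False by (simp add: R'_def)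
        qed
        moreover have "x \<notin> cball 0 R" using False by (auto simp: R'_def intro: order_trans)
        ultimately show ?thesis using supp False by (simp add: q_def e_def)
      qed
    qed
    show "q n \<in> borel_measurable lborel" for n unfolding q_def by measurable
  qed auto
  then show ?thesis using qz by (simp add: LIMSEQ_const_iff)
qed

lemma test_function_support:
  fixes \<phi> :: "'a::euclidean_space \<Rightarrow> real"
  assumes "test_function \<phi>"
  obtains R where "R \<ge> 0" "\<And>x. x \<notin> cball 0 R \<Longrightarrow> \<phi> x = 0"
proof -
  have "bounded (closure {x. \<phi> x \<noteq> 0})" using assms by (simp add: test_function_def compact_imp_bounded)
  then obtain R where R: "\<And>x. x \<in> closure {x. \<phi> x \<noteq> 0} \<Longrightarrow> norm x \<le> R" unfolding bounded_iff by blast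
  show thesis
  proof (rule that[of "max R 0"])
    fix x :: 'a assume "x \<notin> cball 0 (max R 0)"
    then show "\<phi> x = 0" using R[of x] closure_subset[of "{x. \<phi> x \<noteq> 0}"] by fastforce
  qed simp
qed

lemma continuous_imp_locally_integrable:
  fixes f :: "'a::euclidean_space \<Rightarrow> 'b::euclidean_space"
  assumes "continuous_on UNIV f"
  shows "locally_integrable f"
  unfolding locally_integrable_def set_integrable_def
proof (intro allI impI)
  fix K :: "'a set" assume K: "compact K"
  have i: "integrable lborel (\<lambda>x. indicator K x *\<^sub>R f x)"
    by (rule borel_integrable_compact[OF K continuous_on_subset[OF assms]]) simp
  then show "integrable lebesgue (\<lambda>x. indicator K x *\<^sub>R f x)"
    by (subst integrable_completion) auto
qed

lemma classical_gradient_is_weak: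
  fixes u :: "'a::euclidean_space \<Rightarrow> real"
  assumes u: "\<And>x. (u has_derivative (\<lambda>v. g x \<bullet> v)) (at x)" and g: "continuous_on UNIV g"
  shows "has_weak_gradient u g"
  unfolding has_weak_gradient_def
proof (intro conjI allI impI ballI)
  have uc: "continuous_on UNIV u"
    using has_derivative_continuous[OF u] by (simp add: continuous_on_eq_continuous_at)
  show "locally_integrable u" "locally_integrable g"
    by (rule continuous_imp_locally_integrable[OF uc], rule continuous_imp_locally_integrable[OF g])
  fix \<phi> :: "'a \<Rightarrow> real" and b :: 'a
  assume \<phi>: "test_function \<phi>" and b: "b \<in> Basis"
  obtain R where R: "R \<ge> 0" "\<And>x. x \<notin> cball 0 R \<Longrightarrow> \<phi> x = 0"
    using test_function_support[OF \<phi>] by metis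
  let ?D = "\<lambda>x. frechet_derivative \<phi> (at x)"
  have C1: "Ck (Suc 0) \<phi>" using \<phi> by (simp add: test_function_def del: Ck.simps)
  have \<phi>d: "(\<phi> has_derivative ?D x) (at x)" for x by (rule Ck_has_derivative[OF C1])
  have \<phi>c: "continuous_on UNIV \<phi>" and Dc: "continuous_on UNIV (\<lambda>x. ?D x b)"
    using Ck_decrease[OF C1] C1 by simp_all
  have D0: "?D x b = 0" if "x \<notin> cball 0 R" for x
  proof -
    have "(\<phi> has_derivative (\<lambda>v. 0)) (at x)"
      by (rule has_derivative_transform_within_open[of "\<lambda>x. 0" _ x UNIV "- cball 0 R"])
         (use that R(2) in \<open>auto simp: open_Compl\<close>)
    from fun_cong[OF has_derivative_unique[OF \<phi>d this], of b] show ?thesis .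
  qed
  have zero: "(LINT x|lborel. u x * ?D x b + (g x \<bullet> b) * \<phi> x) = 0"
  proof (rule integral_directional_derivative_eq_zero[where h="\<lambda>x. u x * \<phi> x" and h'="\<lambda>x v. u x * ?D x v + (g x \<bullet> v) * \<phi> x" and R=R])
    show "((\<lambda>x. u x * \<phi> x) has_derivative (\<lambda>v. u x * ?D x v + (g x \<bullet> v) * \<phi> x)) (at x)" for x
      by (rule has_derivative_mult[OF u \<phi>d])
  qed (use R uc g \<phi>c Dc in \<open>auto intro!: continuous_intros\<close>)
  have i1: "integrable lborel (\<lambda>x. u x * ?D x b)" and i2: "integrable lborel (\<lambda>x. (g x \<bullet> b) * \<phi> x)"
    using D0 R(2) uc g \<phi>c Dc by (auto intro!: integrable_continuous_compact_support[where R=R] continuous_intros)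
  have "(LINT x|lborel. u x * ?D x b) = - (LINT x|lborel. (g x \<bullet> b) * \<phi> x)"
    using zero Bochner_Integration.integral_add[OF i1 i2] by simp
  moreover have "(LINT x|lebesgue. u x * ?D x b) = (LINT x|lborel. u x * ?D x b)"
    "(LINT x|lebesgue. (g x \<bullet> b) * \<phi> x) = (LINT x|lborel. (g x \<bullet> b) * \<phi> x)"
    using i1 i2 by (auto intro!: integral_completion)
  ultimately show "(LINT x|lebesgue. u x * ?D x b) = - (LINT x|lebesgue. (g x \<bullet> b) * \<phi> x)" by simp
qed

section \<open>Integrals of Riesz kernels\<close>

lemma emeasure_lborel_ball:
  fixes x :: "'a::euclidean_space"
  assumes "r \<ge> 0"
  shows "emeasure lborel (ball x r) = ennreal (unit_ball_vol (real DIM('a)) * r ^ DIM('a))"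
    and "emeasure lborel (cball x r) = ennreal (unit_ball_vol (real DIM('a)) * r ^ DIM('a))"
  using emeasure_ball[OF assms, of x] emeasure_cball[OF assms, of x] by simp_all

text \<open>
  A substitute for polar coordinates: a radial kernel is bounded by a constant on each dyadic shell, and
  each shell lies in a ball of known volume.
\<close>

lemma nn_integral_le_ball_sum:
  fixes f :: "'a::euclidean_space \<Rightarrow> ennreal" and c r :: "nat \<Rightarrow> real"
  assumes le: "\<And>w. f w \<noteq> 0 \<Longrightarrow> \<exists>k. w \<in> ball x (r k) \<and> f w \<le> ennreal (c k)"
    and cr: "\<And>k. c k \<ge> 0" "\<And>k. r k \<ge> 0"
    and s: "(\<lambda>k. c k * (unit_ball_vol (real DIM('a)) * r k ^ DIM('a))) sums S"
  shows "(\<integral>\<^sup>+w. f w \<partial>lborel) \<le> ennreal S"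
proof -
  have "f w \<le> (\<Sum>k. ennreal (c k) * indicator (ball x (r k)) w)" for w
  proof (cases "f w = 0")
    case False
    then obtain k where k: "w \<in> ball x (r k)" "f w \<le> ennreal (c k)" using le by blast
    define t where "t i = ennreal (c i) * indicator (ball x (r i)) w" for i
    have "f w \<le> t k" using k by (simp add: t_def)
    also have "\<dots> \<le> (\<Sum>i. t i)"
      using sum_le_suminf[of t "{k}"] by simp
    finally show ?thesis by (simp add: t_def)
  qed simp
  then have "(\<integral>\<^sup>+w. f w \<partial>lborel) \<le> (\<integral>\<^sup>+w. (\<Sum>k. ennreal (c k) * indicator (ball x (r k)) w) \<partial>lborel)"
    by (rule nn_integral_mono)
  also have "\<dots> = (\<Sum>k. \<integral>\<^sup>+w. ennreal (c k) * indicator (ball x (r k)) w \<partial>lborel)"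
  proof (rule nn_integral_suminf)
    have [measurable]: "ball x (r k) \<in> sets borel" for k by simp
    show "(\<lambda>w. ennreal (c k) * indicator (ball x (r k)) w) \<in> borel_measurable lborel" for k by measurable
  qed
  also have "\<dots> = (\<Sum>k. ennreal (c k * (unit_ball_vol (real DIM('a)) * r k ^ DIM('a))))"
    using cr by (intro suminf_cong) (simp add: nn_integral_cmult_indicator emeasure_lborel_ball ennreal_mult)
  also have "\<dots> = ennreal S"
    using cr s by (subst suminf_ennreal2) (auto simp: sums_iff)
  finally show ?thesis .
qed

lemma exists_dyadic_shell_below:
  fixes t \<rho> :: real
  assumes "0 < t" "t < \<rho>"
  shows "\<exists>k. \<rho> / 2 ^ Suc k \<le> t \<and> t < \<rho> / 2 ^ k"
proof -
  have "\<exists>k. \<rho> / 2 ^ k \<le> t"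
  proof -
    obtain k where "\<rho> / t < 2 ^ k" using real_arch_pow[of 2 "\<rho> / t"] by auto
    then have "\<rho> / 2 ^ k < t" using assms by (simp add: field_simps)
    then show ?thesis by (auto intro: less_imp_le)
  qed
  then obtain k where k: "\<rho> / 2 ^ k \<le> t" "\<And>i. i < k \<Longrightarrow> \<not> \<rho> / 2 ^ i \<le> t"
    using exists_least_iff[of "\<lambda>k. \<rho> / 2 ^ k \<le> t"] by auto
  have "k \<noteq> 0" using k(1) assms by (intro notI) simp
  then obtain l where l: "k = Suc l" using not0_implies_Suc by blast
  show ?thesis by (rule exI[of _ l]) (use k(1) k(2)[of l] l in auto)
qed

lemma exists_dyadic_shell_above:
  fixes t \<rho> :: real
  assumes "0 < \<rho>" "\<rho> \<le> t"
  shows "\<exists>k. \<rho> * 2 ^ k \<le> t \<and> t < \<rho> * 2 ^ Suc k"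
proof -
  have "\<exists>k. t < \<rho> * 2 ^ k"
  proof -
    obtain k where "t / \<rho> < 2 ^ k" using real_arch_pow[of 2 "t / \<rho>"] by auto
    then show ?thesis using assms by (auto simp: field_simps)
  qed
  then obtain k where k: "t < \<rho> * 2 ^ k" "\<And>i. i < k \<Longrightarrow> \<not> t < \<rho> * 2 ^ i"
    using exists_least_iff[of "\<lambda>k. t < \<rho> * 2 ^ k"] by auto
  have "k \<noteq> 0" using k(1) assms by (intro notI) simp
  then obtain l where l: "k = Suc l" using not0_implies_Suc by blast
  show ?thesis by (rule exI[of _ l]) (use k(1) k(2)[of l] l in auto)
qed

lemma riesz_integral_ball:
  assumes "0 < \<beta>"
  obtains C where "C > 0"
    "\<And>(x::'a::euclidean_space) \<rho>. \<rho> > 0 \<Longrightarrow> \<beta> \<le> real DIM('a) \<Longrightarrow>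
      (\<integral>\<^sup>+w. ennreal (norm (x - w) powr (\<beta> - real DIM('a))) * indicator (ball x \<rho>) w \<partial>lborel) \<le> ennreal (C * \<rho> powr \<beta>)"
proof -
  define N where "N = real DIM('a)"
  define \<omega> where "\<omega> = unit_ball_vol N"
  have \<omega>: "\<omega> > 0" by (simp add: \<omega>_def N_def)
  define \<theta> where "\<theta> = (2::real) powr (- \<beta>)"
  have \<theta>: "0 < \<theta>" "\<theta> < 1" using assms powr_less_mono[of "- \<beta>" 0 2] by (auto simp: \<theta>_def)
  define C where "C = \<omega> * 2 powr (N - \<beta>) * (1 / (1 - \<theta>))"
  have pN: "y ^ DIM('a) = y powr N" if "y > 0" for y :: real
    using that by (simp add: N_def powr_realpow)
  show thesis
  proof
    show "C > 0" using \<omega> \<theta> by (simp add: C_def)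
    fix x :: 'a and \<rho> :: real assume \<rho>: "\<rho> > 0" and \<beta>: "\<beta> \<le> real DIM('a)"
    let ?c = "\<lambda>k. (\<rho> / 2 ^ Suc k) powr (\<beta> - N)" and ?r = "\<lambda>k. \<rho> / 2 ^ k"
    have "(\<integral>\<^sup>+w. ennreal (norm (x - w) powr (\<beta> - real DIM('a))) * indicator (ball x \<rho>) w \<partial>lborel) \<le> ennreal (C * \<rho> powr \<beta>)"
    proof (rule nn_integral_le_ball_sum[where x=x and c="?c" and r="?r"])
      fix w assume "ennreal (norm (x - w) powr (\<beta> - real DIM('a))) * indicator (ball x \<rho>) w \<noteq> 0"
      then have w: "w \<in> ball x \<rho>" "x \<noteq> w" by (auto split: split_indicator_asm)
      then obtain k where k: "\<rho> / 2 ^ Suc k \<le> norm (x - w)" "norm (x - w) < \<rho> / 2 ^ k"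
        using exists_dyadic_shell_below[of "norm (x - w)" \<rho>] by (auto simp: dist_norm)
      have "norm (x - w) powr (\<beta> - N) \<le> ?c k"
        using k(1) \<rho> \<beta> by (intro powr_mono2') (auto simp: N_def)
      then show "\<exists>k. w \<in> ball x (?r k) \<and> ennreal (norm (x - w) powr (\<beta> - real DIM('a))) * indicator (ball x \<rho>) w \<le> ennreal (?c k)"
        using k(2) w by (intro exI[of _ k]) (auto simp: dist_norm N_def ennreal_leI)
    next
      have eq: "?c k * (\<omega> * ?r k ^ DIM('a)) = \<omega> * 2 powr (N - \<beta>) * \<rho> powr \<beta> * \<theta> ^ k" for k
      proof -
        define s where "s = \<rho> / 2 ^ k"
        have s: "s > 0" using \<rho> by (simp add: s_def)
        have "?c k = (s / 2) powr (\<beta> - N)" by (simp add: s_def mult.commute)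
        also have "\<dots> = s powr (\<beta> - N) * 2 powr (N - \<beta>)"
          using s by (simp add: powr_divide powr_minus_divide[of 2 "\<beta> - N", simplified])
        finally have "?c k * (\<omega> * ?r k ^ DIM('a)) = \<omega> * 2 powr (N - \<beta>) * (s powr (\<beta> - N) * s powr N)"
          using pN[OF s] by (simp add: s_def[symmetric])
        also have "s powr (\<beta> - N) * s powr N = s powr \<beta>" using s by (simp flip: powr_add)
        also have "s powr \<beta> = \<rho> powr \<beta> * \<theta> ^ k"
          using \<rho> by (simp add: s_def \<theta>_def powr_divide powr_minus_divide power_one_over powr_powr powr_power mult.commute flip: powr_realpow)
        finally show ?thesis by simp
      qed
      have S: "(\<lambda>k. \<omega> * 2 powr (N - \<beta>) * \<rho> powr \<beta> * \<theta> ^ k) sums (\<omega> * 2 powr (N - \<beta>) * \<rho> powr \<beta> * (1 / (1 - \<theta>)))"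
        using \<theta> by (intro sums_mult geometric_sums) auto
      have "(\<lambda>k. ?c k * (\<omega> * ?r k ^ DIM('a))) sums (C * \<rho> powr \<beta>)"
        unfolding eq using S by (simp add: C_def mult_ac)
      then show "(\<lambda>k. ?c k * (unit_ball_vol (real DIM('a)) * ?r k ^ DIM('a))) sums (C * \<rho> powr \<beta>)"
        by (simp only: \<omega>_def N_def)
    qed (use \<rho> in auto)
    then show "(\<integral>\<^sup>+w. ennreal (norm (x - w) powr (\<beta> - real DIM('a))) * indicator (ball x \<rho>) w \<partial>lborel) \<le> ennreal (C * \<rho> powr \<beta>)" .
  qed
qed

lemma riesz_integral_exterior:
  assumes "\<gamma> > real DIM('a::euclidean_space)"
  obtains C where "C > 0"
    "\<And>(x::'a) \<rho>. \<rho> > 0 \<Longrightarrow>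
      (\<integral>\<^sup>+w. ennreal (norm (x - w) powr (- \<gamma>)) * indicator (- ball x \<rho>) w \<partial>lborel) \<le> ennreal (C * \<rho> powr (real DIM('a) - \<gamma>))"
proof -
  define N where "N = real DIM('a)"
  define \<omega> where "\<omega> = unit_ball_vol N"
  have \<omega>: "\<omega> > 0" by (simp add: \<omega>_def N_def)
  define \<theta> where "\<theta> = (2::real) powr (N - \<gamma>)"
  have \<theta>: "0 < \<theta>" "\<theta> < 1" using assms powr_less_mono[of "N - \<gamma>" 0 2] by (auto simp: \<theta>_def N_def)
  define C where "C = \<omega> * 2 powr N * (1 / (1 - \<theta>))"
  have pN: "y ^ DIM('a) = y powr N" if "y > 0" for y :: real
    using that by (simp add: N_def powr_realpow)
  have \<gamma>: "\<gamma> > 0" using assms by (rule le_less_trans[rotated]) simp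
  show thesis
  proof
    show "C > 0" using \<omega> \<theta> by (simp add: C_def)
    fix x :: 'a and \<rho> :: real assume \<rho>: "\<rho> > 0"
    let ?c = "\<lambda>k. (\<rho> * 2 ^ k) powr (- \<gamma>)" and ?r = "\<lambda>k. \<rho> * 2 ^ Suc k"
    have "(\<integral>\<^sup>+w. ennreal (norm (x - w) powr (- \<gamma>)) * indicator (- ball x \<rho>) w \<partial>lborel) \<le> ennreal (C * \<rho> powr (N - \<gamma>))"
    proof (rule nn_integral_le_ball_sum[where x=x and c="?c" and r="?r"])
      fix w assume "ennreal (norm (x - w) powr (- \<gamma>)) * indicator (- ball x \<rho>) w \<noteq> 0"
      then have w: "\<rho> \<le> norm (x - w)" by (auto simp: dist_norm split: split_indicator_asm)
      then obtain k where k: "\<rho> * 2 ^ k \<le> norm (x - w)" "norm (x - w) < \<rho> * 2 ^ Suc k"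
        using exists_dyadic_shell_above[OF \<rho>] by blast
      have "norm (x - w) powr (- \<gamma>) \<le> ?c k"
        using k(1) \<rho> \<gamma> by (intro powr_mono2') auto
      then show "\<exists>k. w \<in> ball x (?r k) \<and> ennreal (norm (x - w) powr (- \<gamma>)) * indicator (- ball x \<rho>) w \<le> ennreal (?c k)"
        using k(2) w by (intro exI[of _ k]) (auto simp: dist_norm ennreal_leI split: split_indicator)
    next
      have eq: "?c k * (\<omega> * ?r k ^ DIM('a)) = \<omega> * 2 powr N * \<rho> powr (N - \<gamma>) * \<theta> ^ k" for k
      proof -
        define s where "s = \<rho> * 2 ^ k"
        have s: "s > 0" using \<rho> by (simp add: s_def)
        have "?r k ^ DIM('a) = (2 * s) powr N" using pN[of "2 * s"] s by (simp add: s_def mult.left_commute)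
        also have "\<dots> = 2 powr N * s powr N" using s by (simp add: powr_mult)
        finally have "?c k * (\<omega> * ?r k ^ DIM('a)) = \<omega> * 2 powr N * (s powr (- \<gamma>) * s powr N)"
          by (simp add: s_def[symmetric])
        also have "s powr (- \<gamma>) * s powr N = s powr (N - \<gamma>)" using s by (simp flip: powr_add)
        also have "s powr (N - \<gamma>) = \<rho> powr (N - \<gamma>) * \<theta> ^ k"
          using \<rho> by (simp add: s_def \<theta>_def powr_mult powr_powr powr_power mult.commute flip: powr_realpow)
        finally show ?thesis by simp
      qed
      have S: "(\<lambda>k. \<omega> * 2 powr N * \<rho> powr (N - \<gamma>) * \<theta> ^ k) sums (\<omega> * 2 powr N * \<rho> powr (N - \<gamma>) * (1 / (1 - \<theta>)))"
        using \<theta> by (intro sums_mult geometric_sums) auto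
      have "(\<lambda>k. ?c k * (\<omega> * ?r k ^ DIM('a))) sums (C * \<rho> powr (N - \<gamma>))"
        unfolding eq using S by (simp add: C_def mult_ac)
      then show "(\<lambda>k. ?c k * (unit_ball_vol (real DIM('a)) * ?r k ^ DIM('a))) sums (C * \<rho> powr (N - \<gamma>))"
        by (simp only: \<omega>_def N_def)
    qed (use \<rho> in auto)
    then show "(\<integral>\<^sup>+w. ennreal (norm (x - w) powr (- \<gamma>)) * indicator (- ball x \<rho>) w \<partial>lborel) \<le> ennreal (C * \<rho> powr (real DIM('a) - \<gamma>))"
      by (simp add: N_def)
  qed
qed

text \<open>
  If $x$ is nearer to $y$ than to $z$, then $|x-z|$ is at least $|x-y|$ and at least $r=|y-z|/2$. So the product
  is at most $r^{a-N}|x-y|^{a-N}$ inside the ball of radius $r$ at $y$ and at most $|x-y|^{2a-2N}$ outside; both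
  integrals scale like $r^{2a-N}$.
\<close>

lemma riesz_composition_bound:
  fixes a :: real
  assumes a: "0 < a" "2 * a < real DIM('a::euclidean_space)"
  obtains C where "C > 0"
    "\<And>y z :: 'a. y \<noteq> z \<Longrightarrow> (\<integral>\<^sup>+x. ennreal (norm (x - y) powr (a - real DIM('a)) * norm (x - z) powr (a - real DIM('a))) \<partial>lborel)
      \<le> ennreal (C * norm (y - z) powr (2 * a - real DIM('a)))"
proof -
  define N where "N = real DIM('a)"
  obtain C1 where C1: "C1 > 0" "\<And>(x::'a) \<rho>. \<rho> > 0 \<Longrightarrow> a \<le> real DIM('a) \<Longrightarrow>
      (\<integral>\<^sup>+w. ennreal (norm (x - w) powr (a - real DIM('a))) * indicator (ball x \<rho>) w \<partial>lborel) \<le> ennreal (C1 * \<rho> powr a)"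
    using riesz_integral_ball[OF a(1), where 'a='a] by blast
  obtain C2 where C2: "C2 > 0" "\<And>(x::'a) \<rho>. \<rho> > 0 \<Longrightarrow>
      (\<integral>\<^sup>+w. ennreal (norm (x - w) powr (- (2 * N - 2 * a))) * indicator (- ball x \<rho>) w \<partial>lborel) \<le> ennreal (C2 * \<rho> powr (real DIM('a) - (2 * N - 2 * a)))"
    using riesz_integral_exterior[where 'a='a and \<gamma>="2 * N - 2 * a"] a unfolding N_def by auto
  define C where "C = 2 * (C1 + C2) * (1 / 2) powr (2 * a - N)"
  show thesis
  proof
    show "C > 0" using C1(1) C2(1) by (simp add: C_def)
    fix y z :: 'a assume yz: "y \<noteq> z"
    define r where "r = norm (y - z) / 2"
    have r: "r > 0" using yz by (simp add: r_def)
    define H where "H v x = ennreal (r powr (a - N)) * (ennreal (norm (v - x) powr (a - N)) * indicator (ball v r) x)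
        + ennreal (norm (v - x) powr (- (2 * N - 2 * a))) * indicator (- ball v r) x" for v x :: 'a
    have [measurable]: "ball v r \<in> sets borel" "- ball v r \<in> sets borel" for v :: 'a by auto
    have Hm [measurable]: "H v \<in> borel_measurable borel" for v
      unfolding H_def[abs_def] by measurable
    have intH: "(\<integral>\<^sup>+x. H v x \<partial>lborel) \<le> ennreal ((C1 + C2) * r powr (2 * a - N))" for v
    proof -
      have "(\<integral>\<^sup>+x. H v x \<partial>lborel) = ennreal (r powr (a - N)) * (\<integral>\<^sup>+x. ennreal (norm (v - x) powr (a - N)) * indicator (ball v r) x \<partial>lborel)
          + (\<integral>\<^sup>+x. ennreal (norm (v - x) powr (- (2 * N - 2 * a))) * indicator (- ball v r) x \<partial>lborel)"
        unfolding H_def by (subst nn_integral_add) (auto simp: nn_integral_cmult)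
      also have "\<dots> \<le> ennreal (r powr (a - N)) * ennreal (C1 * r powr a) + ennreal (C2 * r powr (N - (2 * N - 2 * a)))"
        using C1(2)[OF r, of v] C2(2)[OF r, of v] a unfolding N_def
        by (intro add_mono mult_left_mono) auto
      also have "\<dots> = ennreal (C1 * (r powr (a - N) * r powr a) + C2 * r powr (2 * a - N))"
        using C1(1) C2(1) by (simp add: mult_ac flip: ennreal_mult ennreal_plus)
      also have "r powr (a - N) * r powr a = r powr (2 * a - N)" using r by (simp flip: powr_add)
      finally show ?thesis by (simp add: algebra_simps)
    qed
    have one: "ennreal (norm (x - y) powr (a - N) * norm (x - z) powr (a - N)) \<le> H y x"
      if le: "norm (x - y) \<le> norm (x - z)" and r2: "2 * r \<le> norm (x - y) + norm (x - z)" for x y z :: 'a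
    proof (cases "x = y")
      case False
      then have pos: "0 < norm (x - y)" "norm (y - x) = norm (x - y)" by (auto simp: norm_minus_commute)
      show ?thesis
      proof (cases "norm (x - y) < r")
        case True
        have "norm (x - z) powr (a - N) \<le> r powr (a - N)"
          using le r2 r a by (intro powr_mono2') (auto simp: N_def)
        then have "norm (x - y) powr (a - N) * norm (x - z) powr (a - N) \<le> r powr (a - N) * norm (x - y) powr (a - N)"
          by (subst mult.commute) (rule mult_right_mono, auto)
        then show ?thesis
          using True pos(2) by (simp add: H_def dist_norm ennreal_leI flip: ennreal_mult)
      next
        case False
        have "norm (x - z) powr (a - N) \<le> norm (x - y) powr (a - N)"
          using le pos a by (intro powr_mono2') (auto simp: N_def)
        then have "norm (x - y) powr (a - N) * norm (x - z) powr (a - N) \<le> norm (x - y) powr (a - N) * norm (x - y) powr (a - N)"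
          by (intro mult_left_mono) auto
        also have "\<dots> = norm (x - y) powr (- (2 * N - 2 * a))" by (simp flip: powr_add)
        finally show ?thesis
          using False pos(2) by (simp add: H_def dist_norm ennreal_leI)
      qed
    qed simp
    have tri: "2 * r \<le> norm (x - y) + norm (x - z)" for x
      using norm_triangle_ineq4[of "x - z" "x - y"] by (simp add: r_def add.commute)
    have "ennreal (norm (x - y) powr (a - N) * norm (x - z) powr (a - N)) \<le> H y x + H z x" for x
    proof (cases "norm (x - y) \<le> norm (x - z)")
      case True
      then show ?thesis using one[OF True tri] by (simp add: add_increasing2)
    next
      case False
      then have "ennreal (norm (x - z) powr (a - N) * norm (x - y) powr (a - N)) \<le> H z x"
        using tri[of x] by (intro one) auto
      then show ?thesis by (simp add: add_increasing mult.commute)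
    qed
    then have "(\<integral>\<^sup>+x. ennreal (norm (x - y) powr (a - N) * norm (x - z) powr (a - N)) \<partial>lborel) \<le> (\<integral>\<^sup>+x. H y x + H z x \<partial>lborel)"
      by (rule nn_integral_mono)
    also have "\<dots> = (\<integral>\<^sup>+x. H y x \<partial>lborel) + (\<integral>\<^sup>+x. H z x \<partial>lborel)" by (rule nn_integral_add) auto
    also have "\<dots> \<le> ennreal ((C1 + C2) * r powr (2 * a - N)) + ennreal ((C1 + C2) * r powr (2 * a - N))"
      by (intro add_mono intH)
    also have "\<dots> = ennreal (2 * (C1 + C2) * r powr (2 * a - N))"
      using C1(1) C2(1) by (simp flip: ennreal_plus)
    also have "r powr (2 * a - N) = (1 / 2) powr (2 * a - N) * norm (y - z) powr (2 * a - N)"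
      by (simp add: r_def powr_mult[symmetric])
    finally show "(\<integral>\<^sup>+x. ennreal (norm (x - y) powr (a - real DIM('a)) * norm (x - z) powr (a - real DIM('a))) \<partial>lborel)
      \<le> ennreal (C * norm (y - z) powr (2 * a - real DIM('a)))"
      by (simp add: C_def N_def mult.assoc)
  qed
qed

section \<open>Upper bounds for the Coulomb energy\<close>

text \<open>
  Expanding the square, applying Tonelli and integrating out the middle variable with the previous bound
  reduces the energy to a multiple of the double integral of
  $|u(y)|^p|u(w)|^p|y-w|^{\alpha-N}$.
\<close>

lemma coulomb_energy_le_sup:
  fixes \<alpha> :: real
  assumes \<alpha>: "0 < \<alpha>" "\<alpha> < real DIM('a::euclidean_space)"
  obtains C where "C > 0"
    "\<And>(u :: 'a \<Rightarrow> real) p S. u \<in> borel_measurable borel \<Longrightarrow>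
      (\<And>y. u y \<noteq> 0 \<Longrightarrow> (\<integral>\<^sup>+w. ennreal (\<bar>u w\<bar> powr p) * ennreal (norm (y - w) powr (\<alpha> - real DIM('a))) \<partial>lborel) \<le> S) \<Longrightarrow>
      coulomb_energy \<alpha> p u \<le> ennreal C * S * (\<integral>\<^sup>+y. ennreal (\<bar>u y\<bar> powr p) \<partial>lborel)"
proof -
  define N a A where "N = real DIM('a)" and "a = \<alpha> / 2" and "A = riesz_const DIM('a) a"
  have A: "A > 0" unfolding A_def a_def by (rule riesz_const_pos) (use \<alpha> in auto)
  obtain C where C: "C > 0" "\<And>y z :: 'a. y \<noteq> z \<Longrightarrow> (\<integral>\<^sup>+x. ennreal (norm (x - y) powr (a - real DIM('a)) * norm (x - z) powr (a - real DIM('a))) \<partial>lborel)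
      \<le> ennreal (C * norm (y - z) powr (2 * a - real DIM('a)))"
    using riesz_composition_bound[where 'a='a and a=a] \<alpha> unfolding a_def by auto
  show thesis
  proof
    show "A\<^sup>2 * C > 0" using A C(1) by simp
    fix u :: "'a \<Rightarrow> real" and p S
    assume [measurable]: "u \<in> borel_measurable borel"
      and S: "\<And>y. u y \<noteq> 0 \<Longrightarrow> (\<integral>\<^sup>+w. ennreal (\<bar>u w\<bar> powr p) * ennreal (norm (y - w) powr (\<alpha> - real DIM('a))) \<partial>lborel) \<le> S"
    define f where "f y = ennreal (\<bar>u y\<bar> powr p)" for y
    have fm [measurable]: "f \<in> borel_measurable borel" unfolding f_def[abs_def] by measurable
    define k where "k x y = ennreal (norm (x - y) powr (a - N))" for x y :: 'a
    have km [measurable]: "(\<lambda>p. k (fst p) (snd p)) \<in> borel_measurable (borel \<Otimes>\<^sub>M borel)"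
      unfolding k_def by measurable
    have km1 [measurable]: "(\<lambda>x. k x y) \<in> borel_measurable borel" "k y \<in> borel_measurable borel" for y
      unfolding k_def by measurable
    define P where "P x = (\<integral>\<^sup>+y. k x y * f y \<partial>lborel)" for x
    have Pm [measurable]: "P \<in> borel_measurable borel"
      unfolding P_def[abs_def] by measurable
    have pot: "riesz_potential a (\<lambda>y. \<bar>u y\<bar> powr p) x = ennreal A * P x" for x
    proof -
      have "riesz_potential a (\<lambda>y. \<bar>u y\<bar> powr p) x = (\<integral>\<^sup>+y. ennreal A * (k x y * f y) \<partial>lborel)"
        unfolding riesz_potential_def nn_integral_completion
        using A by (intro nn_integral_cong) (simp add: riesz_kernel_def A_def[symmetric] k_def f_def N_def mult.assoc flip: ennreal_mult)
      also have "\<dots> = ennreal A * P x" unfolding P_def by (rule nn_integral_cmult) measurable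
      finally show ?thesis .
    qed
    have swap: "(\<integral>\<^sup>+x. (\<integral>\<^sup>+y. G x * (k x y * f y) \<partial>lborel) \<partial>lborel) = (\<integral>\<^sup>+y. f y * (\<integral>\<^sup>+x. G x * k x y \<partial>lborel) \<partial>lborel)"
      if [measurable]: "G \<in> borel_measurable borel" for G :: "'a \<Rightarrow> ennreal"
    proof -
      have "(\<integral>\<^sup>+x. (\<integral>\<^sup>+y. G x * (k x y * f y) \<partial>lborel) \<partial>lborel) = (\<integral>\<^sup>+y. (\<integral>\<^sup>+x. G x * (k x y * f y) \<partial>lborel) \<partial>lborel)"
        by (rule lborel_pair.Fubini'[symmetric]) (simp add: split_beta')
      also have "\<dots> = (\<integral>\<^sup>+y. f y * (\<integral>\<^sup>+x. G x * k x y \<partial>lborel) \<partial>lborel)"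
      proof (rule nn_integral_cong)
        fix y
        have "(\<integral>\<^sup>+x. G x * (k x y * f y) \<partial>lborel) = (\<integral>\<^sup>+x. f y * (G x * k x y) \<partial>lborel)"
          by (intro nn_integral_cong) (simp add: mult_ac)
        also have "\<dots> = f y * (\<integral>\<^sup>+x. G x * k x y \<partial>lborel)" by (rule nn_integral_cmult) measurable
        finally show "(\<integral>\<^sup>+x. G x * (k x y * f y) \<partial>lborel) = f y * (\<integral>\<^sup>+x. G x * k x y \<partial>lborel)" .
      qed
      finally show ?thesis .
    qed
    have inner: "(\<integral>\<^sup>+x. P x * k x y \<partial>lborel) \<le> ennreal C * S" if y: "u y \<noteq> 0" for y
    proof -
      have "(\<integral>\<^sup>+x. P x * k x y \<partial>lborel) = (\<integral>\<^sup>+x. (\<integral>\<^sup>+z. k x y * (k x z * f z) \<partial>lborel) \<partial>lborel)"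
        unfolding P_def by (intro nn_integral_cong) (simp add: nn_integral_cmult mult.commute)
      also have "\<dots> = (\<integral>\<^sup>+z. f z * (\<integral>\<^sup>+x. k x y * k x z \<partial>lborel) \<partial>lborel)"
        by (rule swap) measurable
      also have "\<dots> \<le> (\<integral>\<^sup>+z. ennreal C * (f z * ennreal (norm (y - z) powr (\<alpha> - N))) \<partial>lborel)"
      proof (rule nn_integral_mono_AE)
        have "AE z in lborel. z \<noteq> y" by (rule AE_lborel_singleton)
        then show "AE z in lborel. f z * (\<integral>\<^sup>+x. k x y * k x z \<partial>lborel) \<le> ennreal C * (f z * ennreal (norm (y - z) powr (\<alpha> - N)))"
        proof eventually_elim
          fix z assume "z \<noteq> y"
          then have "(\<integral>\<^sup>+x. k x y * k x z \<partial>lborel) \<le> ennreal (C * norm (y - z) powr (\<alpha> - N))"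
            using C(2)[of y z] by (simp add: k_def a_def N_def flip: ennreal_mult)
          then have "f z * (\<integral>\<^sup>+x. k x y * k x z \<partial>lborel) \<le> f z * ennreal (C * norm (y - z) powr (\<alpha> - N))"
            by (intro mult_left_mono) auto
          also have "\<dots> = ennreal C * (f z * ennreal (norm (y - z) powr (\<alpha> - N)))"
            using C(1) by (simp add: ennreal_mult mult_ac)
          finally show "f z * (\<integral>\<^sup>+x. k x y * k x z \<partial>lborel) \<le> ennreal C * (f z * ennreal (norm (y - z) powr (\<alpha> - N)))" .
        qed
      qed
      also have "\<dots> = ennreal C * (\<integral>\<^sup>+z. f z * ennreal (norm (y - z) powr (\<alpha> - N)) \<partial>lborel)"
        by (rule nn_integral_cmult) measurable
      also have "\<dots> \<le> ennreal C * S"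
        using S[OF y] by (intro mult_left_mono) (auto simp: f_def N_def)
      finally show ?thesis .
    qed
    have "coulomb_energy \<alpha> p u = (\<integral>\<^sup>+x. ennreal (A\<^sup>2) * (P x * P x) \<partial>lborel)"
      unfolding coulomb_energy_def nn_integral_completion a_def[symmetric] pot
      using A by (intro nn_integral_cong) (simp add: power2_eq_square ennreal_mult mult_ac)
    also have "\<dots> = ennreal (A\<^sup>2) * (\<integral>\<^sup>+x. P x * P x \<partial>lborel)" by (rule nn_integral_cmult) measurable
    also have "(\<integral>\<^sup>+x. P x * P x \<partial>lborel) = (\<integral>\<^sup>+x. (\<integral>\<^sup>+y. P x * (k x y * f y) \<partial>lborel) \<partial>lborel)"
      by (intro nn_integral_cong) (simp add: nn_integral_cmult P_def[symmetric])
    also have "\<dots> = (\<integral>\<^sup>+y. f y * (\<integral>\<^sup>+x. P x * k x y \<partial>lborel) \<partial>lborel)"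
      by (rule swap) measurable
    also have "\<dots> \<le> (\<integral>\<^sup>+y. (ennreal C * S) * f y \<partial>lborel)"
    proof (rule nn_integral_mono)
      fix y show "f y * (\<integral>\<^sup>+x. P x * k x y \<partial>lborel) \<le> (ennreal C * S) * f y"
      proof (cases "u y = 0")
        case False
        then show ?thesis using mult_left_mono[OF inner[OF False], of "f y"] by (simp add: mult.commute)
      qed (simp add: f_def)
    qed
    also have "\<dots> = (ennreal C * S) * (\<integral>\<^sup>+y. f y \<partial>lborel)" by (rule nn_integral_cmult) measurable
    finally have "coulomb_energy \<alpha> p u \<le> ennreal (A\<^sup>2) * ((ennreal C * S) * (\<integral>\<^sup>+y. f y \<partial>lborel))"
      by (simp add: mult_left_mono)
    also have "\<dots> = ennreal (A\<^sup>2 * C) * S * (\<integral>\<^sup>+y. ennreal (\<bar>u y\<bar> powr p) \<partial>lborel)"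
      using C(1) A by (simp add: f_def ennreal_mult mult.assoc)
    finally show "coulomb_energy \<alpha> p u \<le> ennreal (A\<^sup>2 * C) * S * (\<integral>\<^sup>+y. ennreal (\<bar>u y\<bar> powr p) \<partial>lborel)" .
  qed
qed

definition separated :: "real \<Rightarrow> 'a::metric_space set \<Rightarrow> bool" where
  "separated \<eta> X \<longleftrightarrow> finite X \<and> (\<forall>z\<in>X. \<forall>z'\<in>X. z \<noteq> z' \<longrightarrow> \<eta> \<le> dist z z')"

lemma separated_ball_unique:
  assumes "separated \<eta> X" "t \<le> \<eta> / 2" "z \<in> X" "z' \<in> X" "w \<in> ball z t" "w \<in> ball z' t"
  shows "z = z'"
proof (rule ccontr)
  assume "z \<noteq> z'"
  then have "\<eta> \<le> dist z z'" using assms by (auto simp: separated_def)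
  also have "\<dots> \<le> dist z w + dist w z'" by (rule dist_triangle)
  also have "\<dots> < t + t" using assms(5,6) by (intro add_strict_mono) (auto simp: dist_commute)
  finally show False using assms(2) by simp
qed

lemma separated_sum_eq:
  fixes h :: "'a::metric_space \<Rightarrow> 'b::comm_monoid_add"
  assumes X: "separated \<eta> X" "t \<le> \<eta> / 2" and h: "\<And>z. z \<in> X \<Longrightarrow> w \<notin> ball z t \<Longrightarrow> h z = 0"
    and z: "z \<in> X" "w \<in> ball z t"
  shows "(\<Sum>z\<in>X. h z) = h z"
proof -
  have "(\<Sum>z\<in>X. h z) = (\<Sum>z\<in>{z}. h z)"
  proof (rule sum.mono_neutral_right)
    show "finite X" using X by (simp add: separated_def)
    show "\<forall>i\<in>X - {z}. h i = 0"
    proof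
      fix i assume "i \<in> X - {z}"
      then show "h i = 0" using h[of i] separated_ball_unique[OF X _ z(1) _ z(2), of i] by auto
    qed
  qed (use z in auto)
  then show ?thesis by simp
qed

lemma separated_sum_indicator:
  assumes X: "separated \<eta> X" "t \<le> \<eta> / 2"
  shows "(\<Sum>z\<in>X. indicator (ball z t) w) = (indicator (\<Union>z\<in>X. ball z t) w :: 'b::semiring_1)"
proof (cases "\<exists>z\<in>X. w \<in> ball z t")
  case True
  then obtain z where z: "z \<in> X" "w \<in> ball z t" by blast
  have "(\<Sum>z\<in>X. indicator (ball z t) w) = (indicator (ball z t) w :: 'b)"
    by (rule separated_sum_eq[OF X _ z]) simp
  then show ?thesis using z by (auto simp: indicator_def)
next
  case False
  then have "(\<Sum>z\<in>X. indicator (ball z t) w) = (\<Sum>z\<in>X. 0 :: 'b)" by (intro sum.cong) auto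
  then show ?thesis using False by simp
qed

text \<open>
  At most one centre lies within $\eta/2$ of $y$, and its ball contributes at most a multiple of $\rho^\alpha$. For the other
  centres $z$ the kernel is comparable on the small ball and on the ball of radius $\eta/2$ at $z$; these larger balls are disjoint, so their
  contributions add up to at most an integral over one fixed ball.
\<close>

lemma separated_potential_bound:
  fixes \<alpha> R :: real
  assumes \<alpha>: "0 < \<alpha>" "\<alpha> < real DIM('a::euclidean_space)" and R: "R > 0"
  obtains C where "C > 0"
    "\<And>(X :: 'a set) \<eta> \<rho> y. separated \<eta> X \<Longrightarrow> 0 < \<rho> \<Longrightarrow> \<rho> \<le> \<eta> / 8 \<Longrightarrow> (\<Union>z\<in>X. ball z (\<eta> / 2)) \<subseteq> cball 0 R \<Longrightarrow> norm y \<le> R \<Longrightarrow>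
      (\<Sum>z\<in>X. \<integral>\<^sup>+w. ennreal (norm (y - w) powr (\<alpha> - real DIM('a))) * indicator (ball z \<rho>) w \<partial>lborel)
      \<le> ennreal (C * (\<rho> powr \<alpha> + (\<rho> / \<eta>) ^ DIM('a)))"
proof -
  define N where "N = real DIM('a)"
  define \<omega> where "\<omega> = unit_ball_vol N"
  have \<omega>: "\<omega> > 0" by (simp add: \<omega>_def N_def)
  obtain C0 where C0: "C0 > 0" "\<And>(x::'a) \<rho>. \<rho> > 0 \<Longrightarrow> \<alpha> \<le> real DIM('a) \<Longrightarrow>
      (\<integral>\<^sup>+w. ennreal (norm (x - w) powr (\<alpha> - real DIM('a))) * indicator (ball x \<rho>) w \<partial>lborel) \<le> ennreal (C0 * \<rho> powr \<alpha>)"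
    using riesz_integral_ball[OF \<alpha>(1), where 'a='a] by blast
  \<comment> \<open>$3/8$ compares $|y-w|\ge\frac34|y-z|$ on the small ball with $|y-w|\le 2|y-z|$ on the large one\<close>
  define c where "c = 2 ^ DIM('a) * (3 / 8) powr (\<alpha> - N)"
  have c: "c > 0" by (simp add: c_def)
  define C where "C = (C0 + \<omega>) + c * (C0 * (2 * R + 1) powr \<alpha>)"
  show thesis
  proof
    show "C > 0" using C0(1) \<omega> c by (simp add: C_def add_pos_nonneg)
    fix X :: "'a set" and \<eta> \<rho> :: real and y :: 'a
    assume X: "separated \<eta> X" and \<rho>: "0 < \<rho>" "\<rho> \<le> \<eta> / 8" and sub: "(\<Union>z\<in>X. ball z (\<eta> / 2)) \<subseteq> cball 0 R" and y: "norm y \<le> R"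
    have \<eta>: "\<eta> > 0" using \<rho> by simp
    define \<kappa> where "\<kappa> w = ennreal (norm (y - w) powr (\<alpha> - N))" for w
    have [measurable]: "\<kappa> \<in> borel_measurable borel" unfolding \<kappa>_def[abs_def] by measurable
    have bm [measurable]: "ball z t \<in> sets borel" for z :: 'a and t by simp
    have near: "(\<integral>\<^sup>+w. \<kappa> w * indicator (ball z \<rho>) w \<partial>lborel) \<le> ennreal ((C0 + \<omega>) * \<rho> powr \<alpha>)" for z
    proof -
      have "(\<integral>\<^sup>+w. \<kappa> w * indicator (ball z \<rho>) w \<partial>lborel) \<le>
          (\<integral>\<^sup>+w. \<kappa> w * indicator (ball y \<rho>) w + ennreal (\<rho> powr (\<alpha> - N)) * indicator (ball z \<rho>) w \<partial>lborel)"
      proof (rule nn_integral_mono)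
        fix w
        show "\<kappa> w * indicator (ball z \<rho>) w \<le> \<kappa> w * indicator (ball y \<rho>) w + ennreal (\<rho> powr (\<alpha> - N)) * indicator (ball z \<rho>) w"
        proof (cases "w \<in> ball y \<rho>")
          case False
          then have "norm (y - w) powr (\<alpha> - N) \<le> \<rho> powr (\<alpha> - N)"
            using \<rho> \<alpha> by (intro powr_mono2') (auto simp: N_def dist_norm)
          then show ?thesis using False by (auto simp: \<kappa>_def ennreal_leI split: split_indicator)
        qed (auto split: split_indicator)
      qed
      also have "\<dots> = (\<integral>\<^sup>+w. \<kappa> w * indicator (ball y \<rho>) w \<partial>lborel) + ennreal (\<rho> powr (\<alpha> - N)) * emeasure lborel (ball z \<rho>)"
        by (subst nn_integral_add) (auto simp: nn_integral_cmult_indicator)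
      also have "\<dots> \<le> ennreal (C0 * \<rho> powr \<alpha>) + ennreal (\<rho> powr (\<alpha> - N)) * ennreal (\<omega> * \<rho> ^ DIM('a))"
        using C0(2)[OF \<rho>(1), of y] \<alpha> \<rho>
        by (intro add_mono mult_left_mono) (auto simp: \<kappa>_def[abs_def] N_def \<omega>_def emeasure_lborel_ball)
      also have "\<dots> = ennreal (C0 * \<rho> powr \<alpha> + \<omega> * (\<rho> powr (\<alpha> - N) * \<rho> powr N))"
        using C0(1) \<omega> \<rho> by (simp add: N_def powr_realpow mult_ac flip: ennreal_mult ennreal_plus)
      also have "\<rho> powr (\<alpha> - N) * \<rho> powr N = \<rho> powr \<alpha>" using \<rho> by (simp flip: powr_add)
      finally show ?thesis by (simp add: algebra_simps)
    qed
    have far: "(\<integral>\<^sup>+w. \<kappa> w * indicator (ball z \<rho>) w \<partial>lborel) \<le> ennreal (c * (\<rho> / \<eta>) ^ DIM('a)) * (\<integral>\<^sup>+w. \<kappa> w * indicator (ball z (\<eta> / 2)) w \<partial>lborel)"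
      if z: "y \<notin> ball z (\<eta> / 2)" for z
    proof -
      define D where "D = norm (y - z)"
      have D: "D \<ge> \<eta> / 2" "D > 0" using z \<eta> by (auto simp: D_def dist_norm norm_minus_commute)
      have "(\<integral>\<^sup>+w. \<kappa> w * indicator (ball z \<rho>) w \<partial>lborel) \<le> (\<integral>\<^sup>+w. ennreal ((3 / 4 * D) powr (\<alpha> - N)) * indicator (ball z \<rho>) w \<partial>lborel)"
      proof (rule nn_integral_mono)
        fix w
        show "\<kappa> w * indicator (ball z \<rho>) w \<le> ennreal ((3 / 4 * D) powr (\<alpha> - N)) * indicator (ball z \<rho>) w"
        proof (cases "w \<in> ball z \<rho>")
          case True
          have "D \<le> norm (y - w) + norm (w - z)" using norm_triangle_ineq[of "y - w" "w - z"] by (simp add: D_def)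
          then have "3 / 4 * D \<le> norm (y - w)" using True \<rho> D by (simp add: dist_norm norm_minus_commute)
          then have "norm (y - w) powr (\<alpha> - N) \<le> (3 / 4 * D) powr (\<alpha> - N)"
            using D \<alpha> by (intro powr_mono2') (auto simp: N_def)
          then show ?thesis using True by (simp add: \<kappa>_def ennreal_leI)
        qed simp
      qed
      also have "\<dots> = ennreal ((3 / 4 * D) powr (\<alpha> - N) * (\<omega> * \<rho> ^ DIM('a)))"
        using \<rho> \<omega> by (simp add: nn_integral_cmult_indicator emeasure_lborel_ball \<omega>_def N_def flip: ennreal_mult)
      also have "(3 / 4 * D) powr (\<alpha> - N) * (\<omega> * \<rho> ^ DIM('a)) = (c * (\<rho> / \<eta>) ^ DIM('a)) * ((2 * D) powr (\<alpha> - N) * (\<omega> * (\<eta> / 2) ^ DIM('a)))"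
      proof -
        have "3 / 4 * D = 3 / 8 * (2 * D)" by simp
        then have "(3 / 4 * D) powr (\<alpha> - N) = (3 / 8) powr (\<alpha> - N) * (2 * D) powr (\<alpha> - N)"
          using D by (simp only: powr_mult)
        then show ?thesis using \<eta> by (simp add: c_def power_divide)
      qed
      also have "ennreal \<dots> = ennreal (c * (\<rho> / \<eta>) ^ DIM('a)) * (\<integral>\<^sup>+w. ennreal ((2 * D) powr (\<alpha> - N)) * indicator (ball z (\<eta> / 2)) w \<partial>lborel)"
        using \<rho> \<omega> c \<eta> by (simp add: nn_integral_cmult_indicator emeasure_lborel_ball \<omega>_def N_def flip: ennreal_mult)
      also have "\<dots> \<le> ennreal (c * (\<rho> / \<eta>) ^ DIM('a)) * (\<integral>\<^sup>+w. \<kappa> w * indicator (ball z (\<eta> / 2)) w \<partial>lborel)"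
      proof (intro mult_left_mono nn_integral_mono_AE)
        have "AE w in lborel. w \<noteq> y" by (rule AE_lborel_singleton)
        then show "AE w in lborel. ennreal ((2 * D) powr (\<alpha> - N)) * indicator (ball z (\<eta> / 2)) w \<le> \<kappa> w * indicator (ball z (\<eta> / 2)) w"
        proof eventually_elim
          fix w assume w: "w \<noteq> y"
          show "ennreal ((2 * D) powr (\<alpha> - N)) * indicator (ball z (\<eta> / 2)) w \<le> \<kappa> w * indicator (ball z (\<eta> / 2)) w"
          proof (cases "w \<in> ball z (\<eta> / 2)")
            case True
            have "norm (y - w) \<le> D + norm (z - w)" using norm_triangle_ineq[of "y - z" "z - w"] by (simp add: D_def)
            then have "norm (y - w) \<le> 2 * D" using True D by (simp add: dist_norm)
            then have "(2 * D) powr (\<alpha> - N) \<le> norm (y - w) powr (\<alpha> - N)"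
              using w \<alpha> by (intro powr_mono2') (auto simp: N_def)
            then show ?thesis using True by (simp add: \<kappa>_def ennreal_leI)
          qed simp
        qed
      qed simp
      finally show ?thesis .
    qed
    define q where "q = ennreal (c * (\<rho> / \<eta>) ^ DIM('a))"
    define n where "n = ennreal ((C0 + \<omega>) * \<rho> powr \<alpha>)"
    have "(\<Sum>z\<in>X. \<integral>\<^sup>+w. \<kappa> w * indicator (ball z \<rho>) w \<partial>lborel) \<le>
        (\<Sum>z\<in>X. n * indicator (ball z (\<eta> / 2)) y + q * (\<integral>\<^sup>+w. \<kappa> w * indicator (ball z (\<eta> / 2)) w \<partial>lborel))"
    proof (rule sum_mono)
      fix z
      show "(\<integral>\<^sup>+w. \<kappa> w * indicator (ball z \<rho>) w \<partial>lborel) \<le>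
          n * indicator (ball z (\<eta> / 2)) y + q * (\<integral>\<^sup>+w. \<kappa> w * indicator (ball z (\<eta> / 2)) w \<partial>lborel)"
      proof (cases "y \<in> ball z (\<eta> / 2)")
        case True
        then show ?thesis using near[of z] by (simp add: n_def add_increasing2)
      next
        case False
        then show ?thesis using far[OF False] by (simp add: q_def)
      qed
    qed
    also have "\<dots> = n * (\<Sum>z\<in>X. indicator (ball z (\<eta> / 2)) y) + q * (\<Sum>z\<in>X. \<integral>\<^sup>+w. \<kappa> w * indicator (ball z (\<eta> / 2)) w \<partial>lborel)"
      by (simp add: sum.distrib sum_distrib_left)
    also have "(\<Sum>z\<in>X. \<integral>\<^sup>+w. \<kappa> w * indicator (ball z (\<eta> / 2)) w \<partial>lborel) = (\<integral>\<^sup>+w. (\<Sum>z\<in>X. \<kappa> w * indicator (ball z (\<eta> / 2)) w) \<partial>lborel)"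
      by (rule nn_integral_sum[symmetric]) measurable
    also have "\<dots> = (\<integral>\<^sup>+w. \<kappa> w * indicator (\<Union>z\<in>X. ball z (\<eta> / 2)) w \<partial>lborel)"
      by (simp add: separated_sum_indicator[OF X] flip: sum_distrib_left)
    also have "\<dots> \<le> (\<integral>\<^sup>+w. \<kappa> w * indicator (ball y (2 * R + 1)) w \<partial>lborel)"
    proof (intro nn_integral_mono mult_left_mono)
      fix w
      have "w \<in> ball y (2 * R + 1)" if "w \<in> (\<Union>z\<in>X. ball z (\<eta> / 2))"
      proof -
        have "norm w \<le> R" using subsetD[OF sub that] by simp
        then show ?thesis using y norm_triangle_ineq4[of y w] by (simp add: dist_norm)
      qed
      then show "indicator (\<Union>z\<in>X. ball z (\<eta> / 2)) w \<le> (indicator (ball y (2 * R + 1)) w :: ennreal)"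
        by (auto split: split_indicator)
    qed simp
    also have "\<dots> \<le> ennreal (C0 * (2 * R + 1) powr \<alpha>)"
      using C0(2)[of "2 * R + 1" y] R \<alpha> by (simp add: \<kappa>_def[abs_def] N_def)
    also have "(\<Sum>z\<in>X. indicator (ball z (\<eta> / 2)) y) \<le> (1 :: ennreal)"
      unfolding separated_sum_indicator[OF X order_refl] by (auto split: split_indicator)
    finally have "(\<Sum>z\<in>X. \<integral>\<^sup>+w. \<kappa> w * indicator (ball z \<rho>) w \<partial>lborel) \<le> n * 1 + q * ennreal (C0 * (2 * R + 1) powr \<alpha>)"
      by (simp add: mult_left_mono add_mono)
    also have "\<dots> = ennreal ((C0 + \<omega>) * \<rho> powr \<alpha> + c * (\<rho> / \<eta>) ^ DIM('a) * (C0 * (2 * R + 1) powr \<alpha>))"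
      using C0(1) \<omega> c \<rho> \<eta> by (simp add: n_def q_def flip: ennreal_mult ennreal_plus)
    also have "\<dots> \<le> ennreal (C * (\<rho> powr \<alpha> + (\<rho> / \<eta>) ^ DIM('a)))"
    proof (rule ennreal_leI)
      have "0 \<le> c * (C0 * (2 * R + 1) powr \<alpha>) * \<rho> powr \<alpha>" "0 \<le> (C0 + \<omega>) * (\<rho> / \<eta>) ^ DIM('a)"
        using C0(1) \<omega> c \<rho> \<eta> by auto
      then show "(C0 + \<omega>) * \<rho> powr \<alpha> + c * (\<rho> / \<eta>) ^ DIM('a) * (C0 * (2 * R + 1) powr \<alpha>) \<le> C * (\<rho> powr \<alpha> + (\<rho> / \<eta>) ^ DIM('a))"
        unfolding C_def by (simp add: algebra_simps)
    qed
    finally show "(\<Sum>z\<in>X. \<integral>\<^sup>+w. ennreal (norm (y - w) powr (\<alpha> - real DIM('a))) * indicator (ball z \<rho>) w \<partial>lborel)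
      \<le> ennreal (C * (\<rho> powr \<alpha> + (\<rho> / \<eta>) ^ DIM('a)))"
      by (simp add: \<kappa>_def N_def)
  qed
qed

section \<open>Bubbles on separated sets\<close>

definition bubble :: "'a::euclidean_space \<Rightarrow> real" where
  "bubble x = flat 0 (1 - x \<bullet> x)"

definition bubble_grad :: "'a::euclidean_space \<Rightarrow> 'a" where
  "bubble_grad x = (- 2 * flat 2 (1 - x \<bullet> x)) *\<^sub>R x"

lemma flat_continuous [continuous_intros]:
  assumes "continuous_on S h"
  shows "continuous_on S (\<lambda>x. flat m (h x))"
proof -
  have "continuous_on UNIV (flat m)" using Ck_flat[of 0 m] by simp
  then show ?thesis using continuous_on_compose2[OF _ assms, of UNIV "flat m"] by simp
qed

lemma bubble_has_derivative: "(bubble has_derivative (\<lambda>v. bubble_grad x \<bullet> v)) (at x)"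
proof -
  have q: "((\<lambda>x. 1 - x \<bullet> x) has_derivative (\<lambda>v. - 2 * (x \<bullet> v))) (at x)"
    by (auto intro!: derivative_eq_intros simp: inner_commute)
  have f: "(flat 0 has_derivative (\<lambda>t. flat 2 (1 - x \<bullet> x) * t)) (at (1 - x \<bullet> x))"
    using flat_has_derivative[of 0 "1 - x \<bullet> x"] by (simp add: has_field_derivative_def numeral_2_eq_2)
  have "((\<lambda>x. flat 0 (1 - x \<bullet> x)) has_derivative (\<lambda>v. flat 2 (1 - x \<bullet> x) * (- 2 * (x \<bullet> v)))) (at x)"
    by (rule has_derivative_compose[OF q f])
  then show ?thesis by (simp add: bubble_def[abs_def] bubble_grad_def mult_ac)
qed

lemma bubble_range: "0 \<le> bubble x" "bubble x \<le> 1"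
  by (auto simp: bubble_def flat_def)

lemma not_in_unit_ball: "x \<notin> ball 0 1 \<Longrightarrow> 1 - x \<bullet> x \<le> 0" for x :: "'a::euclidean_space"
  by (simp add: dot_square_norm)

lemma bubble_outside: "x \<notin> ball 0 1 \<Longrightarrow> bubble x = 0" "x \<notin> ball 0 1 \<Longrightarrow> bubble_grad x = 0"
  using not_in_unit_ball[of x] by (auto simp: bubble_def bubble_grad_def flat_def)

lemma bubble_lower:
  assumes "x \<in> ball 0 (1/2)"
  shows "exp (- 2) \<le> bubble x"
proof -
  have "x \<bullet> x \<le> (1/2)\<^sup>2"
    unfolding dot_square_norm using assms by (intro power_mono) auto
  then have "1 - x \<bullet> x \<ge> 1 / 2" by (simp add: power2_eq_square)
  then show ?thesis by (auto simp: bubble_def flat_def divide_simps)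
qed

lemma bubble_grad_bound: "norm (bubble_grad x) \<le> 512"
proof (cases "x \<in> ball 0 1")
  case True
  define t where "t = 1 - x \<bullet> x"
  have "x \<bullet> x \<le> 1\<^sup>2" unfolding dot_square_norm using True by (intro power_mono) auto
  then have t: "\<bar>t\<bar> \<le> 1" by (simp add: t_def)
  have "\<bar>flat 2 t\<bar> \<le> 256 * t\<^sup>2" using flat_le_square[of 2 t] by simp
  also have "\<dots> \<le> 256" using t by (simp add: abs_square_le_1)
  finally have "\<bar>flat 2 t\<bar> * norm x \<le> 256 * 1" using True by (intro mult_mono) auto
  then show ?thesis by (simp add: bubble_grad_def t_def abs_mult mult_ac)
qed (simp add: bubble_outside)

definition bubbles :: "'a::euclidean_space set \<Rightarrow> real \<Rightarrow> real \<Rightarrow> 'a \<Rightarrow> real" where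
  "bubbles X r \<tau> x = (\<Sum>z\<in>X. \<tau> * bubble ((1 / r) *\<^sub>R (x - z)))"

definition bubbles_grad :: "'a::euclidean_space set \<Rightarrow> real \<Rightarrow> real \<Rightarrow> 'a \<Rightarrow> 'a" where
  "bubbles_grad X r \<tau> x = (\<Sum>z\<in>X. (\<tau> / r) *\<^sub>R bubble_grad ((1 / r) *\<^sub>R (x - z)))"

lemma scaled_mem_ball:
  fixes x z :: "'a::euclidean_space"
  assumes "r > 0"
  shows "(1 / r) *\<^sub>R (x - z) \<in> ball 0 t \<longleftrightarrow> x \<in> ball z (r * t)"
proof -
  have "norm ((1 / r) *\<^sub>R (x - z)) = dist z x / r"
    using assms by (simp add: dist_norm norm_minus_commute)
  then have "(1 / r) *\<^sub>R (x - z) \<in> ball 0 t \<longleftrightarrow> dist z x / r < t"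
    unfolding mem_ball dist_0_norm by simp
  then show ?thesis using assms by (simp add: pos_divide_less_eq mult.commute)
qed

lemma bubbles_weak_gradient:
  assumes "r > 0"
  shows "has_weak_gradient (bubbles X r \<tau>) (bubbles_grad X r \<tau>)"
proof (rule classical_gradient_is_weak)
  fix x :: 'a
  have "((\<lambda>x. bubble ((1 / r) *\<^sub>R (x - z))) has_derivative (\<lambda>v. bubble_grad ((1 / r) *\<^sub>R (x - z)) \<bullet> ((1 / r) *\<^sub>R v))) (at x)" for z
    by (rule has_derivative_compose[OF _ bubble_has_derivative]) (auto intro!: derivative_eq_intros)
  then have "((\<lambda>x. \<Sum>z\<in>X. \<tau> * bubble ((1 / r) *\<^sub>R (x - z))) has_derivative
      (\<lambda>v. \<Sum>z\<in>X. \<tau> * (bubble_grad ((1 / r) *\<^sub>R (x - z)) \<bullet> ((1 / r) *\<^sub>R v)))) (at x)"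
    by (intro has_derivative_sum has_derivative_mult_right)
  then show "(bubbles X r \<tau> has_derivative (\<lambda>v. bubbles_grad X r \<tau> x \<bullet> v)) (at x)"
    by (simp add: bubbles_def[abs_def] bubbles_grad_def inner_sum_left)
next
  show "continuous_on UNIV (bubbles_grad X r \<tau>)"
    unfolding bubbles_grad_def[abs_def] bubble_grad_def by (intro continuous_intros)
qed

context
  fixes X :: "'a::euclidean_space set" and \<eta> r \<tau> :: real
  assumes X: "separated \<eta> X" and r: "0 < r" "r \<le> \<eta> / 8" and \<tau>: "\<tau> > 0"
begin

abbreviation "supp \<equiv> (\<Union>z\<in>X. ball z r)"

lemma finite_X: "finite X" using X by (simp add: separated_def)

lemma r2: "r \<le> \<eta> / 2" using r by simp

lemma bubbles_at:
  assumes "z \<in> X" "x \<in> ball z r"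
  shows "bubbles X r \<tau> x = \<tau> * bubble ((1 / r) *\<^sub>R (x - z))"
    and "bubbles_grad X r \<tau> x = (\<tau> / r) *\<^sub>R bubble_grad ((1 / r) *\<^sub>R (x - z))"
  unfolding bubbles_def bubbles_grad_def
  using scaled_mem_ball[OF r(1), of x _ 1]
  by (intro separated_sum_eq[OF X r2 _ assms]; simp add: bubble_outside)+

lemma bubbles_off:
  assumes "x \<notin> supp"
  shows "bubbles X r \<tau> x = 0" and "bubbles_grad X r \<tau> x = 0"
proof -
  have "(1 / r) *\<^sub>R (x - z) \<notin> ball 0 1" if "z \<in> X" for z
    using scaled_mem_ball[OF r(1), of x z 1] assms that by auto
  then show "bubbles X r \<tau> x = 0" and "bubbles_grad X r \<tau> x = 0"
    unfolding bubbles_def bubbles_grad_def by (simp_all add: bubble_outside)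
qed

lemma emeasure_balls:
  assumes "t \<le> r" "t \<ge> 0"
  shows "emeasure lborel (\<Union>z\<in>X. ball z t) = ennreal (real (card X) * (unit_ball_vol (real DIM('a)) * t ^ DIM('a)))"
proof -
  have "emeasure lborel (\<Union>z\<in>X. ball z t) = (\<Sum>z\<in>X. emeasure lborel (ball z t))"
  proof (rule sum_emeasure[symmetric])
    show "disjoint_family_on (\<lambda>z. ball z t) X"
      unfolding disjoint_family_on_def
    proof (intro ballI impI equals0I)
      fix z z' w assume z: "z \<in> X" "z' \<in> X" "z \<noteq> z'" and w: "w \<in> ball z t \<inter> ball z' t"
      show False
        using separated_ball_unique[OF X _ z(1,2), of t w] w z(3) assms r2 by auto
    qed
  qed (auto simp: finite_X)
  also have "\<dots> = ennreal (real (card X) * (unit_ball_vol (real DIM('a)) * t ^ DIM('a)))"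
    using assms(2) by (simp add: emeasure_lborel_ball ennreal_mult ennreal_of_nat_eq_real_of_nat)
  finally show ?thesis .
qed

lemma bubbles_pointwise:
  "\<bar>bubbles X r \<tau> x\<bar> \<le> \<tau> * indicator supp x"
  "norm (bubbles_grad X r \<tau> x) \<le> 512 * \<tau> / r * indicator supp x"
proof -
  show "\<bar>bubbles X r \<tau> x\<bar> \<le> \<tau> * indicator supp x"
  proof (cases "x \<in> supp")
    case True
    then obtain z where "z \<in> X" "x \<in> ball z r" by blast
    then show ?thesis using True bubble_range[of "(1 / r) *\<^sub>R (x - z)"] \<tau> by (simp add: bubbles_at mult_left_le)
  qed (simp add: bubbles_off)
  show "norm (bubbles_grad X r \<tau> x) \<le> 512 * \<tau> / r * indicator supp x"
  proof (cases "x \<in> supp")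
    case True
    then obtain z where z: "z \<in> X" "x \<in> ball z r" by blast
    have "norm (bubbles_grad X r \<tau> x) = \<tau> / r * norm (bubble_grad ((1 / r) *\<^sub>R (x - z)))"
      using \<tau> r by (simp add: bubbles_at(2)[OF z])
    also have "\<dots> \<le> \<tau> / r * 512" using \<tau> r by (intro mult_left_mono bubble_grad_bound) auto
    finally show ?thesis using True by (simp add: mult.commute)
  qed (simp add: bubbles_off)
qed

lemma supp_borel [measurable]: "supp \<in> sets borel"
  by (intro borel_open open_UN ballI open_ball)

lemma bubbles_grad_integral:
  "(\<integral>\<^sup>+x. ennreal ((norm (bubbles_grad X r \<tau> x))\<^sup>2) \<partial>lborel)
    \<le> ennreal ((512 * \<tau> / r)\<^sup>2 * (real (card X) * (unit_ball_vol (real DIM('a)) * r ^ DIM('a))))"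
proof -
  have "(\<integral>\<^sup>+x. ennreal ((norm (bubbles_grad X r \<tau> x))\<^sup>2) \<partial>lborel) \<le> (\<integral>\<^sup>+x. ennreal ((512 * \<tau> / r)\<^sup>2) * indicator supp x \<partial>lborel)"
  proof (rule nn_integral_mono)
    fix x
    have "(norm (bubbles_grad X r \<tau> x))\<^sup>2 \<le> (512 * \<tau> / r * indicator supp x)\<^sup>2"
      by (intro power_mono bubbles_pointwise) auto
    then show "ennreal ((norm (bubbles_grad X r \<tau> x))\<^sup>2) \<le> ennreal ((512 * \<tau> / r)\<^sup>2) * indicator supp x"
      by (cases "x \<in> supp") (auto simp: ennreal_leI)
  qed
  also have "\<dots> = ennreal ((512 * \<tau> / r)\<^sup>2) * emeasure lborel supp"
    by (rule nn_integral_cmult_indicator) simp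
  also have "\<dots> = ennreal ((512 * \<tau> / r)\<^sup>2 * (real (card X) * (unit_ball_vol (real DIM('a)) * r ^ DIM('a))))"
    using r by (simp add: emeasure_balls flip: ennreal_mult)
  finally show ?thesis .
qed

lemma bubbles_powr_le:
  assumes "s \<ge> 1"
  shows "ennreal (\<bar>bubbles X r \<tau> x\<bar> powr s) \<le> ennreal (\<tau> powr s) * indicator supp x"
proof (cases "x \<in> supp")
  case True
  then have "\<bar>bubbles X r \<tau> x\<bar> powr s \<le> \<tau> powr s"
    using bubbles_pointwise(1)[of x] assms by (intro powr_mono2) auto
  then show ?thesis using True by (simp add: ennreal_leI)
qed (simp add: bubbles_off)

lemma bubbles_Lp_upper:
  assumes "s \<ge> 1"
  shows "(\<integral>\<^sup>+x. ennreal (\<bar>bubbles X r \<tau> x\<bar> powr s) \<partial>lborel)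
    \<le> ennreal (\<tau> powr s * (real (card X) * (unit_ball_vol (real DIM('a)) * r ^ DIM('a))))"
proof -
  have "(\<integral>\<^sup>+x. ennreal (\<bar>bubbles X r \<tau> x\<bar> powr s) \<partial>lborel) \<le> (\<integral>\<^sup>+x. ennreal (\<tau> powr s) * indicator supp x \<partial>lborel)"
    by (intro nn_integral_mono bubbles_powr_le assms)
  also have "\<dots> = ennreal (\<tau> powr s) * emeasure lborel supp"
    by (rule nn_integral_cmult_indicator) simp
  also have "\<dots> = ennreal (\<tau> powr s * (real (card X) * (unit_ball_vol (real DIM('a)) * r ^ DIM('a))))"
    using r by (simp add: emeasure_balls flip: ennreal_mult)
  finally show ?thesis .
qed

lemma bubbles_Lp_lower:
  assumes "s \<ge> 1"
  shows "ennreal ((exp (- 2) * \<tau>) powr s * (real (card X) * (unit_ball_vol (real DIM('a)) * (r / 2) ^ DIM('a))))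
    \<le> (\<integral>\<^sup>+x. ennreal (\<bar>bubbles X r \<tau> x\<bar> powr s) \<partial>lborel)"
proof -
  let ?S = "\<Union>z\<in>X. ball z (r / 2)"
  have "ennreal ((exp (- 2) * \<tau>) powr s * (real (card X) * (unit_ball_vol (real DIM('a)) * (r / 2) ^ DIM('a))))
      = ennreal ((exp (- 2) * \<tau>) powr s) * emeasure lborel ?S"
    using r emeasure_balls[of "r / 2"] by (simp flip: ennreal_mult)
  also have "\<dots> = (\<integral>\<^sup>+x. ennreal ((exp (- 2) * \<tau>) powr s) * indicator ?S x \<partial>lborel)"
  proof (rule nn_integral_cmult_indicator[symmetric])
    have "open ?S" by (intro open_UN ballI open_ball)
    then show "?S \<in> sets lborel" by simp
  qed
  also have "\<dots> \<le> (\<integral>\<^sup>+x. ennreal (\<bar>bubbles X r \<tau> x\<bar> powr s) \<partial>lborel)"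
  proof (rule nn_integral_mono)
    fix x
    show "ennreal ((exp (- 2) * \<tau>) powr s) * indicator ?S x \<le> ennreal (\<bar>bubbles X r \<tau> x\<bar> powr s)"
    proof (cases "x \<in> ?S")
      case True
      then obtain z where z: "z \<in> X" "x \<in> ball z (r / 2)" by blast
      then have z': "x \<in> ball z r" using r by simp
      have "exp (- 2) \<le> bubble ((1 / r) *\<^sub>R (x - z))"
        by (rule bubble_lower) (use scaled_mem_ball[OF r(1), of x z "1/2"] z in simp)
      then have "exp (- 2) * \<tau> \<le> bubbles X r \<tau> x"
        unfolding bubbles_at(1)[OF z(1) z'] using \<tau> by (simp add: mult.commute)
      then have "(exp (- 2) * \<tau>) powr s \<le> \<bar>bubbles X r \<tau> x\<bar> powr s"
        using assms \<tau> by (intro powr_mono2) auto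
      then show ?thesis using True by (simp add: ennreal_leI)
    qed simp
  qed
  finally show ?thesis .
qed

lemma bubbles_borel [measurable]: "bubbles X r \<tau> \<in> borel_measurable borel"
  unfolding bubbles_def[abs_def] bubble_def
  by (intro borel_measurable_continuous_onI continuous_intros)

lemma bubbles_potential:
  assumes "s \<ge> 1" and p: "(\<Sum>z\<in>X. \<integral>\<^sup>+w. ennreal (norm (y - w) powr e) * indicator (ball z r) w \<partial>lborel) \<le> ennreal C" "C \<ge> 0"
  shows "(\<integral>\<^sup>+w. ennreal (\<bar>bubbles X r \<tau> w\<bar> powr s) * ennreal (norm (y - w) powr e) \<partial>lborel) \<le> ennreal (\<tau> powr s * C)"
proof -
  have bm [measurable]: "ball z t \<in> sets borel" for z :: 'a and t by simp
  have "(\<integral>\<^sup>+w. ennreal (\<bar>bubbles X r \<tau> w\<bar> powr s) * ennreal (norm (y - w) powr e) \<partial>lborel)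
      \<le> (\<integral>\<^sup>+w. ennreal (\<tau> powr s) * (\<Sum>z\<in>X. ennreal (norm (y - w) powr e) * indicator (ball z r) w) \<partial>lborel)"
  proof (rule nn_integral_mono)
    fix w
    have "ennreal (\<bar>bubbles X r \<tau> w\<bar> powr s) * ennreal (norm (y - w) powr e)
        \<le> (ennreal (\<tau> powr s) * indicator supp w) * ennreal (norm (y - w) powr e)"
      by (intro mult_right_mono bubbles_powr_le assms) auto
    also have "indicator supp w = (\<Sum>z\<in>X. indicator (ball z r) w :: ennreal)"
      by (rule separated_sum_indicator[OF X r2, symmetric])
    finally show "ennreal (\<bar>bubbles X r \<tau> w\<bar> powr s) * ennreal (norm (y - w) powr e)
        \<le> ennreal (\<tau> powr s) * (\<Sum>z\<in>X. ennreal (norm (y - w) powr e) * indicator (ball z r) w)"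
      by (simp add: sum_distrib_left sum_distrib_right mult_ac)
  qed
  also have "\<dots> = ennreal (\<tau> powr s) * (\<Sum>z\<in>X. \<integral>\<^sup>+w. ennreal (norm (y - w) powr e) * indicator (ball z r) w \<partial>lborel)"
    by (subst nn_integral_cmult) (auto simp: nn_integral_sum)
  also have "\<dots> \<le> ennreal (\<tau> powr s) * ennreal C" by (intro mult_left_mono p) auto
  also have "\<dots> = ennreal (\<tau> powr s * C)" using p(2) by (simp flip: ennreal_mult)
  finally show ?thesis .
qed

end

text \<open>
  The norm is defined with an arbitrarily chosen weak gradient; by uniqueness it may be computed with
  any given one.
\<close>

lemma coulomb_sobolevI:
  fixes u :: "'a::euclidean_space \<Rightarrow> real"
  assumes wg: "has_weak_gradient u g" and G: "(\<integral>\<^sup>+x. ennreal ((norm (g x))\<^sup>2) \<partial>lborel) \<le> ennreal G" "G \<ge> 0"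
    and E: "coulomb_energy \<alpha> p u \<le> ennreal E" "E \<ge> 0" and p: "p \<ge> 1"
  shows "u \<in> coulomb_sobolev \<alpha> p" and "coulomb_sobolev_norm \<alpha> p u \<le> sqrt (G + E powr (1 / p))"
proof -
  have wg': "has_weak_gradient u (weak_gradient u)"
    unfolding weak_gradient_def by (rule someI[of "has_weak_gradient u", OF wg])
  have ae: "AE x in lebesgue. weak_gradient u x = g x" by (rule weak_gradient_unique[OF wg' wg])
  note m = has_weak_gradient_measurable[OF wg] has_weak_gradient_measurable(2)[OF wg']
  have nn: "(\<integral>\<^sup>+x. ennreal (norm ((norm (weak_gradient u x))\<^sup>2)) \<partial>lebesgue) \<le> ennreal G"
  proof -
    have "(\<integral>\<^sup>+x. ennreal (norm ((norm (weak_gradient u x))\<^sup>2)) \<partial>lebesgue) = (\<integral>\<^sup>+x. ennreal ((norm (g x))\<^sup>2) \<partial>lebesgue)"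
      using ae by (intro nn_integral_cong_AE) (auto elim!: eventually_mono)
    then show ?thesis using G(1) by (simp add: nn_integral_completion)
  qed
  have mm: "(\<lambda>x. (norm (weak_gradient u x))\<^sup>2) \<in> borel_measurable lebesgue"
    using m(3) by measurable
  have int: "integrable lebesgue (\<lambda>x. (norm (weak_gradient u x))\<^sup>2)"
    by (rule integrableI_bounded[OF mm]) (use nn in \<open>rule le_less_trans, simp\<close>)
  have wd: "weakly_differentiable u" using wg by (auto simp: weakly_differentiable_def)
  have "coulomb_energy \<alpha> p u < \<infinity>" using E(1) by (rule le_less_trans) simp
  then show "u \<in> coulomb_sobolev \<alpha> p"
    using m(1) wd int by (simp add: coulomb_sobolev_def)
  have "ennreal (LINT x|lebesgue. (norm (weak_gradient u x))\<^sup>2) \<le> ennreal G"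
    using nn nn_integral_eq_integral[OF int] by simp
  then have "(LINT x|lebesgue. (norm (weak_gradient u x))\<^sup>2) \<le> G" using G(2) by simp
  moreover have "enn2real (coulomb_energy \<alpha> p u) powr (1 / p) \<le> E powr (1 / p)"
    using p E by (intro powr_mono2) (auto simp: enn2real_leI)
  ultimately show "coulomb_sobolev_norm \<alpha> p u \<le> sqrt (G + E powr (1 / p))"
    unfolding coulomb_sobolev_norm_def by (intro real_sqrt_le_mono add_mono)
qed

lemma grid_exists:
  fixes M :: nat
  assumes "M \<ge> 1"
  obtains X :: "'a::euclidean_space set" where "separated (1 / real M) X" "card X = M ^ DIM('a)" "X \<subseteq> cball 0 (real DIM('a))"
proof -
  define F where "F f = (\<Sum>b\<in>Basis. (real (f b) / real M) *\<^sub>R b)" for f :: "'a \<Rightarrow> nat"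
  define I where "I = (Basis :: 'a set) \<rightarrow>\<^sub>E {..<M}"
  have Fb: "F f \<bullet> b = real (f b) / real M" if "b \<in> Basis" for f b
    using that by (simp add: F_def inner_sum_left_Basis)
  have sep: "1 / real M \<le> dist (F f) (F h)" if "f \<in> I" "h \<in> I" "f \<noteq> h" for f h
  proof -
    obtain b where b: "b \<in> Basis" "f b \<noteq> h b"
    proof -
      have "f = h" if "\<forall>b\<in>Basis. f b = h b"
        using PiE_ext[of f "Basis :: 'a set" "\<lambda>_. {..<M}" h] \<open>f \<in> I\<close> \<open>h \<in> I\<close> that
        unfolding I_def by simp
      then show thesis using that \<open>f \<noteq> h\<close> by blast
    qed
    have "1 \<le> \<bar>real (f b) - real (h b)\<bar>" using b(2) by linarith
    then have "1 / real M \<le> \<bar>real (f b) - real (h b)\<bar> / real M" by (rule divide_right_mono) simp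
    also have "\<dots> = \<bar>(F f - F h) \<bullet> b\<bar>"
      using b(1) by (simp add: inner_diff_left Fb flip: diff_divide_distrib)
    also have "\<dots> \<le> dist (F f) (F h)" unfolding dist_norm by (rule Basis_le_norm[OF b(1)])
    finally show ?thesis .
  qed
  have inj: "inj_on F I"
  proof (rule inj_onI, rule ccontr)
    fix f h assume "f \<in> I" "h \<in> I" "F f = F h" "f \<noteq> h"
    then show False using sep[of f h] assms by simp
  qed
  have fin: "finite I" unfolding I_def by (intro finite_PiE) auto
  show thesis
  proof
    show "separated (1 / real M) (F ` I)"
      unfolding separated_def using fin sep by blast
    show "card (F ` I) = M ^ DIM('a)"
      unfolding card_image[OF inj] by (simp add: I_def card_PiE)
    show "F ` I \<subseteq> cball 0 (real DIM('a))"
    proof (rule image_subsetI)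
      fix f assume f: "f \<in> I"
      have "norm (F f) \<le> (\<Sum>b\<in>Basis. \<bar>F f \<bullet> b\<bar>)" by (rule norm_le_l1)
      also have "\<dots> \<le> (\<Sum>b\<in>(Basis :: 'a set). 1)"
      proof (rule sum_mono)
        fix b :: 'a assume b: "b \<in> Basis"
        then have "f b < M" using f by (auto simp: I_def)
        then show "\<bar>F f \<bullet> b\<bar> \<le> 1" using b by (simp add: Fb)
      qed
      finally show "F f \<in> cball 0 (real DIM('a))" by simp
    qed
  qed
qed

section \<open>Failure of compactness in the remaining range\<close>

lemma powr_nonneg_exponent_le_1:
  "(x::real) \<le> 1 \<Longrightarrow> 0 < x \<Longrightarrow> 0 \<le> e \<Longrightarrow> x powr e \<le> 1"
  using powr_mono2[of e x 1] by simp

lemma nn_integral_vanishing_sets: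
  fixes f :: "'a \<Rightarrow> ennreal"
  assumes f: "f \<in> borel_measurable M" "(\<integral>\<^sup>+x. f x \<partial>M) < \<infinity>"
    and A: "\<And>n. A n \<in> sets M" "\<And>n. emeasure M (A n) \<le> ennreal (c n)" "summable c" "\<And>n. c n \<ge> 0"
  shows "(\<lambda>n. \<integral>\<^sup>+x. f x * indicator (A n) x \<partial>M) \<longlonglongrightarrow> 0"
proof -
  have fin: "emeasure M (A n) < \<infinity>" for n using A(2)[of n] by (rule le_less_trans) simp
  have "measure M (A n) \<le> c n" for n
    using A(2)[of n] A(4)[of n] unfolding measure_def by (intro enn2real_leI) auto
  then have "summable (\<lambda>n. measure M (A n))"
    by (intro summable_comparison_test'[OF A(3), of 0]) auto
  then have ae: "AE x in M. eventually (\<lambda>n. x \<in> space M - A n) sequentially"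
    using fin A(1) by (intro borel_cantelli_AE1) auto
  note [measurable] = f(1) A(1)
  have "(\<lambda>n. \<integral>\<^sup>+x. f x * indicator (A n) x \<partial>M) \<longlonglongrightarrow> (\<integral>\<^sup>+x. 0 \<partial>M)"
  proof (rule nn_integral_dominated_convergence[where w=f])
    show "AE x in M. (\<lambda>n. f x * indicator (A n) x) \<longlonglongrightarrow> 0"
      using ae
    proof eventually_elim
      fix x assume "eventually (\<lambda>n. x \<in> space M - A n) sequentially"
      then have "eventually (\<lambda>n. 0 = f x * indicator (A n) x) sequentially"
        by eventually_elim simp
      then show "(\<lambda>n. f x * indicator (A n) x) \<longlonglongrightarrow> 0"
        by (rule Lim_transform_eventually[OF tendsto_const])
    qed
  qed (use f in \<open>auto split: split_indicator\<close>)
  then show ?thesis by simp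
qed

text \<open>
  If $u_n\to v$ in $L^q(K)$, then $\int_{S_n}|u_n|^q$ is at most a constant times $\|u_n-v\|_q^q+\int_{S_n}|v|^q$. The last
  term tends to $0$ because, by Borel--Cantelli, almost every point lies in only finitely many $S_n$.
\<close>

lemma concentrating_not_convergent:
  fixes u :: "nat \<Rightarrow> 'a::euclidean_space \<Rightarrow> real"
  assumes q: "q \<ge> 1" and K: "compact K" and um: "\<And>n. u n \<in> borel_measurable borel"
    and S: "\<And>n. S n \<in> sets borel" "\<And>n. S n \<subseteq> K" "\<And>n x. x \<notin> S n \<Longrightarrow> u n x = 0"
    and small: "\<And>n. emeasure lborel (S n) \<le> ennreal (c n)" "summable c" "\<And>n. c n \<ge> 0"
    and lower: "\<And>n. ennreal \<delta> \<le> (\<integral>\<^sup>+x. ennreal (\<bar>u n x\<bar> powr q) \<partial>lborel)" "\<delta> > 0"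
    and upper: "\<And>n. (\<integral>\<^sup>+x. ennreal (\<bar>u n x\<bar> powr q) \<partial>lborel) < \<infinity>"
  shows "\<not> converges_in_Lq q K u"
proof
  assume "converges_in_Lq q K u"
  then obtain v where v: "v \<in> Lq_on q K" and lim: "(\<lambda>n. Lq_norm q K (\<lambda>x. u n x - v x)) \<longlonglongrightarrow> 0"
    by (auto simp: converges_in_Lq_def)
  let ?M = "lebesgue_on K"
  have KL: "K \<in> sets lebesgue" using K by (simp add: lmeasurable_compact fmeasurableD)
  have vm [measurable]: "v \<in> borel_measurable ?M" and vi: "integrable ?M (\<lambda>x. \<bar>v x\<bar> powr q)"
    using v by (auto simp: Lq_on_def)
  have umK [measurable]: "u n \<in> borel_measurable ?M" for n
    by (intro lebesgue_on_measurable borel_imp_lebesgue um)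
  have eqM: "(\<integral>\<^sup>+x. ennreal (\<bar>u n x\<bar> powr q) \<partial>?M) = (\<integral>\<^sup>+x. ennreal (\<bar>u n x\<bar> powr q) \<partial>lborel)" for n
    unfolding nn_integral_lebesgue_on[OF KL]
  proof (rule nn_integral_cong)
    fix x show "ennreal (\<bar>u n x\<bar> powr q) * indicator K x = ennreal (\<bar>u n x\<bar> powr q)"
      using S(2)[of n] S(3)[of x n] by (cases "x \<in> S n") auto
  qed
  have vfin: "(\<integral>\<^sup>+x. ennreal (\<bar>v x\<bar> powr q) \<partial>?M) < \<infinity>"
    using vi by (simp add: integrable_iff_bounded)
  define d where "d n = (\<integral>\<^sup>+x. ennreal (\<bar>u n x - v x\<bar> powr q) \<partial>?M)" for n
  have dfin: "d n < \<infinity>" for n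
    unfolding d_def
    by (rule le_less_trans[OF nn_integral_powr_diff_le]) (use q vfin upper in \<open>auto simp: eqM ennreal_mult_less_top\<close>)
  have d0: "d \<longlonglongrightarrow> 0"
  proof -
    have L: "(LINT x|?M. \<bar>u n x - v x\<bar> powr q) = enn2real (d n)" for n
      unfolding d_def by (rule integral_eq_nn_integral) auto
    have "(\<lambda>n. (Lq_norm q K (\<lambda>x. u n x - v x)) powr q) \<longlonglongrightarrow> 0"
      by (rule tendsto_zero_powrI[OF lim tendsto_const]) (use q in \<open>auto simp: Lq_norm_def\<close>)
    moreover have "(Lq_norm q K (\<lambda>x. u n x - v x)) powr q = enn2real (d n)" for n
      unfolding Lq_norm_def L using q by (simp add: powr_powr)
    ultimately have "(\<lambda>n. ennreal (enn2real (d n))) \<longlonglongrightarrow> ennreal 0"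
      by (intro tendsto_ennrealI) simp
    then show ?thesis using dfin by (simp add: less_top)
  qed
  have vS: "(\<lambda>n. \<integral>\<^sup>+x. ennreal (\<bar>v x\<bar> powr q) * indicator (S n) x \<partial>?M) \<longlonglongrightarrow> 0"
  proof (rule nn_integral_vanishing_sets[where c=c])
    show "S n \<in> sets ?M" for n
      using S(1,2)[of n] KL by (simp add: sets_restrict_space_iff)
    then show "emeasure ?M (S n) \<le> ennreal (c n)" for n
      using S(1,2)[of n] KL small(1)[of n] by (subst emeasure_restrict_space) auto
  qed (use vfin small in auto)
  have le: "ennreal \<delta> \<le> ennreal (2 powr q) * (d n + (\<integral>\<^sup>+x. ennreal (\<bar>v x\<bar> powr q) * indicator (S n) x \<partial>?M))" for n
  proof -
    have [measurable]: "S n \<in> sets ?M" using S(1,2)[of n] KL by (simp add: sets_restrict_space_iff)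
    have "ennreal \<delta> \<le> (\<integral>\<^sup>+x. ennreal (\<bar>u n x\<bar> powr q) \<partial>?M)" using lower(1)[of n] eqM by simp
    also have "\<dots> \<le> (\<integral>\<^sup>+x. ennreal (2 powr q) * (ennreal (\<bar>u n x - v x\<bar> powr q) + ennreal (\<bar>v x\<bar> powr q) * indicator (S n) x) \<partial>?M)"
    proof (rule nn_integral_mono)
      fix x
      show "ennreal (\<bar>u n x\<bar> powr q) \<le> ennreal (2 powr q) * (ennreal (\<bar>u n x - v x\<bar> powr q) + ennreal (\<bar>v x\<bar> powr q) * indicator (S n) x)"
      proof (cases "x \<in> S n")
        case True
        then show ?thesis
          using powr_abs_diff_le[of q "u n x - v x" "- v x"] q by (simp add: ennreal_leI flip: ennreal_mult ennreal_plus)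
      qed (use S(3) in simp)
    qed
    also have "\<dots> = ennreal (2 powr q) * (d n + (\<integral>\<^sup>+x. ennreal (\<bar>v x\<bar> powr q) * indicator (S n) x \<partial>?M))"
      unfolding d_def by (subst nn_integral_cmult) (auto simp: nn_integral_add)
    finally show ?thesis .
  qed
  have "(\<lambda>n. ennreal (2 powr q) * (d n + (\<integral>\<^sup>+x. ennreal (\<bar>v x\<bar> powr q) * indicator (S n) x \<partial>?M))) \<longlonglongrightarrow> ennreal (2 powr q) * (0 + 0)"
    by (intro ennreal_tendsto_cmult tendsto_add d0 vS) simp
  then have "ennreal \<delta> \<le> ennreal (2 powr q) * (0 + 0)"
    by (rule LIMSEQ_le_const) (use le in blast)
  then show False using lower(2) by simp
qed

text \<open>
  The parameter $d$ is the codimension of the set of centres as its spacing shrinks: there are about $r^{-(N-d)}$ bumps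
  of radius $r$, and $d=N$ is the case of a single bump.
\<close>

lemma not_compactly_embedded_of_exponent:
  fixes \<alpha> p q d :: real
  assumes \<alpha>: "0 < \<alpha>" "\<alpha> < real DIM('a::euclidean_space)" and p: "1 \<le> p" and q: "1 \<le> q"
    and d: "0 < d" "d \<le> real DIM('a)"
    and c1: "1 / q \<le> 1 / 2 - 1 / d" and c2: "1 / q \<le> (d + \<alpha>) / (2 * p * d)" and c3: "1 / q \<le> 1 / p"
  shows "\<not> compactly_embedded_Lq_loc (coulomb_sobolev \<alpha> p :: ('a \<Rightarrow> real) set) (coulomb_sobolev_norm \<alpha> p) q"
proof
  assume emb: "compactly_embedded_Lq_loc (coulomb_sobolev \<alpha> p :: ('a \<Rightarrow> real) set) (coulomb_sobolev_norm \<alpha> p) q"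
  define N where "N = real DIM('a)"
  have N: "N \<ge> 1" by (simp add: N_def DIM_ge_Suc0 Suc_leI)
  have dN: "d / N > 0" using d N by simp
  define R where "R = N + 1"
  have R: "R > 0" using N by (simp add: R_def)
  define \<omega> where "\<omega> = unit_ball_vol N"
  have \<omega>: "\<omega> > 0" by (simp add: \<omega>_def N_def)
  obtain CE where CE: "CE > 0" "\<And>(u :: 'a \<Rightarrow> real) p S. u \<in> borel_measurable borel \<Longrightarrow>
      (\<And>y. u y \<noteq> 0 \<Longrightarrow> (\<integral>\<^sup>+w. ennreal (\<bar>u w\<bar> powr p) * ennreal (norm (y - w) powr (\<alpha> - real DIM('a))) \<partial>lborel) \<le> S) \<Longrightarrow>
      coulomb_energy \<alpha> p u \<le> ennreal CE * S * (\<integral>\<^sup>+y. ennreal (\<bar>u y\<bar> powr p) \<partial>lborel)"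
    using coulomb_energy_le_sup[OF \<alpha>] by blast
  obtain CP where CP: "CP > 0" "\<And>(X :: 'a set) \<eta> r y. separated \<eta> X \<Longrightarrow> 0 < r \<Longrightarrow> r \<le> \<eta> / 8 \<Longrightarrow> (\<Union>z\<in>X. ball z (\<eta> / 2)) \<subseteq> cball 0 R \<Longrightarrow> norm y \<le> R \<Longrightarrow>
      (\<Sum>z\<in>X. \<integral>\<^sup>+w. ennreal (norm (y - w) powr (\<alpha> - real DIM('a))) * indicator (ball z r) w \<partial>lborel)
      \<le> ennreal (CP * (r powr \<alpha> + (r / \<eta>) ^ DIM('a)))"
    using separated_potential_bound[OF \<alpha> R] by blast
  define r where "r i = (1 / 2 :: real) ^ i" for i :: nat
  have r: "0 < r i" "r i \<le> 1" for i by (auto simp: r_def power_le_one)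
  \<comment> \<open>\<open>M i\<close> is the number of bumps per coordinate direction\<close>
  define M where "M i = nat \<lfloor>r i powr (- (1 - d / N))\<rfloor>" for i
  have e1: "0 \<le> 1 - d / N" "1 - d / N < 1" using d N dN by (auto simp: N_def)
  have big: "1 \<le> r i powr (- (1 - d / N))" for i
    unfolding powr_minus
    using powr_nonneg_exponent_le_1[OF r(2,1) e1(1), of i] r(1)[of i]
    by (simp add: one_le_inverse_iff)
  have M1: "M i \<ge> 1" for i
    using big[of i] unfolding M_def by linarith
  have Mle: "real (M i) \<le> r i powr (- (1 - d / N))" and Mge: "r i powr (- (1 - d / N)) \<le> 2 * real (M i)" for i
  proof -
    define t where "t = r i powr (- (1 - d / N))"
    have "1 \<le> \<lfloor>t\<rfloor>" using big[of i] by (simp add: t_def le_floor_iff)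
    then have "real (M i) = of_int \<lfloor>t\<rfloor>" "1 \<le> real_of_int \<lfloor>t\<rfloor>"
      by (simp_all add: M_def t_def)
    then have "real (M i) \<le> t" "t \<le> 2 * real (M i)" by linarith+
    then show "real (M i) \<le> r i powr (- (1 - d / N))" "r i powr (- (1 - d / N)) \<le> 2 * real (M i)"
      by (simp_all add: t_def)
  qed
  have pwr: "r i powr a = ((1 / 2) powr a) ^ i" for i a
    by (simp add: r_def powr_powr mult.commute powr_realpow[symmetric])
  \<comment> \<open>the radius must be at most an eighth of the spacing \<open>1 / M i\<close>\<close>
  obtain i0 where i0: "\<And>i. i \<ge> i0 \<Longrightarrow> r i powr (d / N) \<le> 1 / 8"
  proof -
    have "(1 / 2 :: real) powr (d / N) < 1" using dN powr_less_mono2[of "d / N" "1/2" 1] by simp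
    then have "(\<lambda>i. r i powr (d / N)) \<longlonglongrightarrow> 0" unfolding pwr by (intro LIMSEQ_power_zero) auto
    then have "eventually (\<lambda>i. r i powr (d / N) < 1 / 8) sequentially" by (rule order_tendstoD) simp
    then show thesis using that unfolding eventually_sequentially by (meson less_imp_le)
  qed
  have rM: "r i \<le> (1 / real (M i)) / 8" if "i \<ge> i0" for i
  proof -
    have "r i * real (M i) \<le> r i * r i powr (- (1 - d / N))" using Mle r(1)[of i] by (intro mult_left_mono) auto
    also have "\<dots> = r i powr (d / N)" using r(1)[of i] by (simp add: powr_mult_base)
    also have "\<dots> \<le> 1 / 8" by (rule i0[OF that])
    finally show ?thesis using M1[of i] by (simp add: field_simps)
  qed
  define m where "m i = real (M i ^ DIM('a))" for i
  have mpow: "(r i powr (- (1 - d / N))) ^ DIM('a) = r i powr (d - N)" for i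
    using r(1)[of i] N by (simp add: powr_power N_def[symmetric] algebra_simps)
  have mle: "m i \<le> r i powr (d - N)" for i
    unfolding m_def of_nat_power mpow[symmetric] by (intro power_mono Mle) simp
  have mge: "r i powr (d - N) \<le> 2 ^ DIM('a) * m i" for i
    unfolding m_def of_nat_power mpow[symmetric] power_mult_distrib[symmetric] by (intro power_mono Mge) simp
  have m0: "m i \<ge> 0" for i by (simp add: m_def)
  have rN: "r i ^ DIM('a) = r i powr N" for i using r(1)[of i] by (simp add: N_def powr_realpow)
  have mr: "m i * r i ^ DIM('a) \<le> r i powr d" and mr': "r i powr d \<le> 2 ^ DIM('a) * (m i * r i ^ DIM('a))" for i
  proof -
    have e: "r i powr d = r i powr (d - N) * r i powr N" by (simp flip: powr_add)
    show "m i * r i ^ DIM('a) \<le> r i powr d" unfolding rN e by (intro mult_right_mono mle) simp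
    show "r i powr d \<le> 2 ^ DIM('a) * (m i * r i ^ DIM('a))"
      unfolding rN e mult.assoc[symmetric] by (intro mult_right_mono mge) simp
  qed
  have "\<forall>i. \<exists>X :: 'a set. separated (1 / real (M i)) X \<and> card X = M i ^ DIM('a) \<and> X \<subseteq> cball 0 (real DIM('a))"
    using grid_exists[OF M1] by metis
  then obtain X where X: "\<And>i. separated (1 / real (M i)) (X i :: 'a set)" "\<And>i. card (X i) = M i ^ DIM('a)" "\<And>i. X i \<subseteq> cball 0 (real DIM('a))"
    by metis
  have near: "(\<Union>z\<in>X i. ball z t) \<subseteq> cball 0 R" if "t \<le> 1" for i t
  proof
    fix x assume "x \<in> (\<Union>z\<in>X i. ball z t)"
    then obtain z where z: "z \<in> X i" "dist z x < t" by auto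
    then have "norm z \<le> N" using X(3)[of i] by (auto simp: N_def)
    then show "x \<in> cball 0 R" using z(2) that norm_triangle_ineq2[of x z] by (simp add: R_def dist_norm norm_minus_commute)
  qed
  define \<tau> where "\<tau> i = r i powr (- (d / q))" for i
  have \<tau>: "\<tau> i > 0" for i using r(1)[of i] by (simp add: \<tau>_def)
  have \<tau>p: "\<tau> i powr s = r i powr (- (d * s / q))" for i s by (simp add: \<tau>_def powr_powr)
  define w where "w n = bubbles (X (n + i0)) (r (n + i0)) (\<tau> (n + i0))" for n
  define g where "g n = bubbles_grad (X (n + i0)) (r (n + i0)) (\<tau> (n + i0))" for n
  define S where "S n = (\<Union>z\<in>X (n + i0). ball z (r (n + i0)))" for n
  have ctx: "separated (1 / real (M (n + i0))) (X (n + i0))" "0 < r (n + i0)" "r (n + i0) \<le> 1 / real (M (n + i0)) / 8" "\<tau> (n + i0) > 0" for n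
    using X(1) r(1) rM[of "n + i0"] \<tau> by auto
  have card: "real (card (X i)) = m i" for i by (simp add: X(2) m_def)
  have wm: "w n \<in> borel_measurable borel" for n unfolding w_def by (rule bubbles_borel[OF ctx])
  have wg: "has_weak_gradient (w n) (g n)" for n unfolding w_def g_def by (rule bubbles_weak_gradient[OF ctx(2)])
  have q0: "d * 1 / q = d / q" by simp
  have G: "(\<integral>\<^sup>+x. ennreal ((norm (g n x))\<^sup>2) \<partial>lborel) \<le> ennreal (512\<^sup>2 * \<omega>)" for n
  proof -
    define i where "i = n + i0"
    have "(512 * \<tau> i / r i)\<^sup>2 * (m i * (\<omega> * r i ^ DIM('a))) = 512\<^sup>2 * \<omega> * ((\<tau> i / r i)\<^sup>2 * (m i * r i ^ DIM('a)))"
      by (simp add: power_mult_distrib power_divide)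
    also have "\<dots> \<le> 512\<^sup>2 * \<omega> * 1"
    proof (intro mult_left_mono)
      have e: "(\<tau> i / r i)\<^sup>2 = r i powr (- 2 * (d / q) - 2)"
      proof -
        have "\<tau> i / r i = r i powr (- (d / q) - 1)" using r(1)[of i] by (simp add: \<tau>_def powr_diff)
        then show ?thesis by (simp add: power2_eq_square flip: powr_add)
      qed
      have "(\<tau> i / r i)\<^sup>2 * (m i * r i ^ DIM('a)) \<le> (\<tau> i / r i)\<^sup>2 * r i powr d" by (intro mult_left_mono mr) auto
      also have "\<dots> = r i powr (d - 2 - 2 * d / q)"
        unfolding e by (simp add: algebra_simps flip: powr_add)
      also have "\<dots> \<le> 1"
      proof (rule powr_nonneg_exponent_le_1[OF r(2,1)])
        have "2 * d * (1 / q) \<le> 2 * d * (1 / 2 - 1 / d)" using c1 d by (intro mult_left_mono) auto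
        then show "0 \<le> d - 2 - 2 * d / q" using d by (simp add: algebra_simps)
      qed
      finally show "(\<tau> i / r i)\<^sup>2 * (m i * r i ^ DIM('a)) \<le> 1" .
    qed (use \<omega> in simp)
    finally have "(512 * \<tau> i / r i)\<^sup>2 * (m i * (\<omega> * r i ^ DIM('a))) \<le> 512\<^sup>2 * \<omega>" by simp
    then show ?thesis
      using order_trans[OF bubbles_grad_integral[OF ctx] ennreal_leI]
      unfolding g_def card i_def \<omega>_def N_def by blast
  qed
  define E where "E = CE * CP * \<omega> * 2 * 2 ^ DIM('a)"
  have E: "E \<ge> 0" using CE(1) CP(1) \<omega> by (simp add: E_def)
  have energy: "coulomb_energy \<alpha> p (w n) \<le> ennreal E" for n
  proof -
    define i where "i = n + i0"
    define D where "D = CP * (r i powr \<alpha> + (r i / (1 / real (M i))) ^ DIM('a))"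
    have D0: "D \<ge> 0" using CP(1) r(1)[of i] by (simp add: D_def)
    have half: "1 / real (M i) / 2 \<le> 1" using M1[of i] by (simp add: field_simps)
    have pot: "(\<integral>\<^sup>+x. ennreal (\<bar>w n x\<bar> powr p) * ennreal (norm (y - x) powr (\<alpha> - real DIM('a))) \<partial>lborel) \<le> ennreal (\<tau> i powr p * D)"
      if "w n y \<noteq> 0" for y
      unfolding w_def i_def
    proof (rule bubbles_potential[OF ctx p])
      have "y \<in> S n"
      proof (rule ccontr)
        assume "y \<notin> S n"
        then have "w n y = 0" unfolding w_def S_def by (rule bubbles_off(1)[OF ctx])
        then show False using that by simp
      qed
      then have "norm y \<le> R" using subsetD[OF near[OF r(2)], of y] unfolding S_def by simp
      then show "(\<Sum>z\<in>X (n + i0). \<integral>\<^sup>+x. ennreal (norm (y - x) powr (\<alpha> - real DIM('a))) * indicator (ball z (r (n + i0))) x \<partial>lborel) \<le> ennreal D"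
        unfolding D_def i_def by (intro CP(2) ctx near) (use half i_def in auto)
    qed (rule D0)
    have "coulomb_energy \<alpha> p (w n) \<le> ennreal CE * ennreal (\<tau> i powr p * D) * (\<integral>\<^sup>+y. ennreal (\<bar>w n y\<bar> powr p) \<partial>lborel)"
      by (rule CE(2)[OF wm pot])
    also have "\<dots> \<le> ennreal CE * ennreal (\<tau> i powr p * D) * ennreal (\<tau> i powr p * (m i * (\<omega> * r i ^ DIM('a))))"
      using bubbles_Lp_upper[OF ctx p] unfolding w_def i_def card \<omega>_def N_def by (intro mult_left_mono) auto
    also have "\<dots> = ennreal (CE * (\<tau> i powr p * D) * (\<tau> i powr p * (m i * (\<omega> * r i ^ DIM('a)))))"
      using CE(1) D0 \<omega> m0 r(1)[of i] by (simp flip: ennreal_mult)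
    also have "\<dots> \<le> ennreal E"
    proof (rule ennreal_leI)
      define A B where "A = \<tau> i powr p * r i powr \<alpha>" and "B = \<tau> i powr p * r i powr d"
      have D: "\<tau> i powr p * D \<le> CP * (A + B)"
      proof -
        have "(r i / (1 / real (M i))) ^ DIM('a) = m i * r i ^ DIM('a)" by (simp add: m_def power_mult_distrib mult.commute)
        then have "D \<le> CP * (r i powr \<alpha> + r i powr d)" using CP(1) mr[of i] by (simp add: D_def)
        then have "\<tau> i powr p * D \<le> \<tau> i powr p * (CP * (r i powr \<alpha> + r i powr d))" by (intro mult_left_mono) auto
        then show ?thesis by (simp add: A_def B_def algebra_simps)
      qed
      have Bm: "\<tau> i powr p * (m i * (\<omega> * r i ^ DIM('a))) \<le> \<omega> * B"
      proof -
        have "\<omega> * \<tau> i powr p * (m i * r i ^ DIM('a)) \<le> \<omega> * \<tau> i powr p * r i powr d"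
          using \<omega> by (intro mult_left_mono mr) auto
        then show ?thesis by (simp add: B_def mult_ac)
      qed
      have AB: "A * B \<le> 1"
      proof -
        have "A * B = r i powr (d + \<alpha> - 2 * p * d / q)"
          unfolding A_def B_def \<tau>p by (simp add: algebra_simps flip: powr_add)
        also have "\<dots> \<le> 1"
        proof (rule powr_nonneg_exponent_le_1[OF r(2,1)])
          have "2 * p * d * (1 / q) \<le> 2 * p * d * ((d + \<alpha>) / (2 * p * d))" using c2 d p by (intro mult_left_mono) auto
          then show "0 \<le> d + \<alpha> - 2 * p * d / q" using d p by simp
        qed
        finally show ?thesis .
      qed
      have BB: "B * B \<le> 1"
      proof -
        have "B \<le> 1"
          unfolding B_def \<tau>p powr_add[symmetric]
        proof (rule powr_nonneg_exponent_le_1[OF r(2,1)])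
          have "p * (1 / q) \<le> p * (1 / p)" using c3 p by (intro mult_left_mono) auto
          then have "d * (p / q) \<le> d * 1" using d p by (intro mult_left_mono) auto
          then show "0 \<le> - (d * p / q) + d" by simp
        qed
        moreover have "B \<ge> 0" by (simp add: B_def)
        ultimately show ?thesis by (simp add: mult_le_one)
      qed
      have "CE * (\<tau> i powr p * D) * (\<tau> i powr p * (m i * (\<omega> * r i ^ DIM('a)))) \<le> CE * (CP * (A + B)) * (\<omega> * B)"
        using CE(1) CP(1) D0 m0 \<omega> r(1)[of i]
        by (intro mult_mono D Bm mult_nonneg_nonneg) (auto simp: A_def B_def)
      also have "\<dots> = CE * CP * \<omega> * (A * B + B * B)" by (simp add: algebra_simps)
      also have "\<dots> \<le> CE * CP * \<omega> * 2"
        using CE(1) CP(1) \<omega> AB BB by (intro mult_left_mono) auto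
      also have "\<dots> \<le> E" unfolding E_def using CE(1) CP(1) \<omega> by (simp add: one_le_power)
      finally show "CE * (\<tau> i powr p * D) * (\<tau> i powr p * (m i * (\<omega> * r i ^ DIM('a)))) \<le> E" .
    qed
    finally show ?thesis .
  qed
  have memb: "w n \<in> coulomb_sobolev \<alpha> p" and bound: "coulomb_sobolev_norm \<alpha> p (w n) \<le> sqrt (512\<^sup>2 * \<omega> + E powr (1 / p))" for n
    using coulomb_sobolevI[OF wg G _ energy E p, of n] \<omega> by auto
  obtain k where k: "strict_mono (k :: nat \<Rightarrow> nat)" and conv: "converges_in_Lq q (cball 0 R) (\<lambda>n. w (k n))"
    using emb memb bound unfolding compactly_embedded_Lq_loc_def by (metis compact_cball)
  define \<delta> where "\<delta> = exp (- 2) powr q * \<omega> * (1 / 2) ^ DIM('a) * (1 / 2) ^ DIM('a)"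
  have lower: "ennreal \<delta> \<le> (\<integral>\<^sup>+x. ennreal (\<bar>w n x\<bar> powr q) \<partial>lborel)" for n
  proof -
    define i where "i = n + i0"
    have "\<tau> i powr q * r i powr d = 1" using q r(1)[of i] unfolding \<tau>p by (simp flip: powr_add)
    then have "1 \<le> \<tau> i powr q * (2 ^ DIM('a) * (m i * r i ^ DIM('a)))"
      using mult_left_mono[OF mr'[of i], of "\<tau> i powr q"] by simp
    then have "\<delta> * 1 \<le> \<delta> * (\<tau> i powr q * (2 ^ DIM('a) * (m i * r i ^ DIM('a))))"
      using \<omega> by (intro mult_left_mono) (auto simp: \<delta>_def)
    also have "\<dots> = (exp (- 2) * \<tau> i) powr q * (m i * (\<omega> * (r i / 2) ^ DIM('a)))"
      using \<tau>[of i] by (simp add: \<delta>_def powr_mult power_divide)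
    finally have "ennreal \<delta> \<le> ennreal ((exp (- 2) * \<tau> i) powr q * (m i * (\<omega> * (r i / 2) ^ DIM('a))))" by (simp add: ennreal_leI)
    also have "\<dots> \<le> (\<integral>\<^sup>+x. ennreal (\<bar>w n x\<bar> powr q) \<partial>lborel)"
      using bubbles_Lp_lower[OF ctx q, of n] unfolding w_def i_def card \<omega>_def N_def .
    finally show ?thesis .
  qed
  have "\<not> converges_in_Lq q (cball 0 R) (\<lambda>n. w (k n))"
  proof (rule concentrating_not_convergent[where S="\<lambda>n. S (k n)" and c="\<lambda>n. \<omega> * ((1 / 2) powr d) ^ n" and \<delta>=\<delta>])
    show "S (k n) \<in> sets borel" for n unfolding S_def by (rule supp_borel[OF ctx])
    show "S (k n) \<subseteq> cball 0 R" for n unfolding S_def by (rule near[OF r(2)])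
    show "w (k n) x = 0" if "x \<notin> S (k n)" for n x
      using that unfolding w_def S_def by (rule bubbles_off(1)[OF ctx])
    have half: "(1 / 2 :: real) powr d < 1" using d powr_less_mono2[of d "1/2" 1] by simp
    show "emeasure lborel (S (k n)) \<le> ennreal (\<omega> * ((1 / 2) powr d) ^ n)" for n
    proof -
      define i where "i = k n + i0"
      have "emeasure lborel (S (k n)) = ennreal (m i * (\<omega> * r i ^ DIM('a)))"
        unfolding S_def using emeasure_balls[OF ctx order_refl, of "k n"] r(1)[of i] unfolding i_def card \<omega>_def N_def by simp
      also have "\<dots> \<le> ennreal (\<omega> * ((1 / 2) powr d) ^ n)"
      proof (rule ennreal_leI)
        have "m i * (\<omega> * r i ^ DIM('a)) \<le> \<omega> * r i powr d" using mult_left_mono[OF mr[of i], of \<omega>] \<omega> by (simp add: mult_ac)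
        also have "r i powr d = ((1 / 2) powr d) ^ i" by (rule pwr)
        also have "\<omega> * \<dots> \<le> \<omega> * ((1 / 2) powr d) ^ n"
          using \<omega> half seq_suble[OF k, of n] by (intro mult_left_mono power_decreasing) (auto simp: i_def)
        finally show "m i * (\<omega> * r i ^ DIM('a)) \<le> \<omega> * ((1 / 2) powr d) ^ n" .
      qed
      finally show ?thesis .
    qed
    show "summable (\<lambda>n. \<omega> * ((1 / 2) powr d) ^ n)" using half by (intro summable_mult summable_geometric) auto
    show "\<delta> > 0" using \<omega> by (simp add: \<delta>_def)
    show "(\<integral>\<^sup>+x. ennreal (\<bar>w (k n) x\<bar> powr q) \<partial>lborel) < \<infinity>" for n
      unfolding w_def by (rule le_less_trans[OF bubbles_Lp_upper[OF ctx q]]) simp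
  qed (use q wm lower \<omega> in auto)
  then show False using conv by contradiction
qed

theorem proposition3p3:
  fixes \<alpha> p q :: real
  assumes "0 < \<alpha>" and "\<alpha> < real DIM('a::euclidean_space)"
    and "1 \<le> p" and "1 \<le> q"
  shows "compactly_embedded_Lq_loc
           (coulomb_sobolev \<alpha> p :: ('a \<Rightarrow> real) set) (coulomb_sobolev_norm \<alpha> p) q \<longleftrightarrow>
         1 / q > Min {1 / 2 - 1 / real DIM('a), 1 / p, (2 + \<alpha>) / (2 * (2 * p + \<alpha>))}"
proof -
  define N where "N = real DIM('a)"
  have N: "N > 0" "\<alpha> < N" using assms by (auto simp: N_def)
  have Min: "1 / q > Min {1 / 2 - 1 / N, 1 / p, (2 + \<alpha>) / (2 * (2 * p + \<alpha>))} \<longleftrightarrow>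
      1 / q > 1 / 2 - 1 / N \<or> 1 / q > 1 / p \<or> 1 / q > (2 + \<alpha>) / (2 * (2 * p + \<alpha>))"
    by (subst Min_less_iff) auto
  show ?thesis
    unfolding N_def[symmetric] Min
  proof
    assume "1 / q > 1 / 2 - 1 / N \<or> 1 / q > 1 / p \<or> 1 / q > (2 + \<alpha>) / (2 * (2 * p + \<alpha>))"
    then show "compactly_embedded_Lq_loc (coulomb_sobolev \<alpha> p :: ('a \<Rightarrow> real) set) (coulomb_sobolev_norm \<alpha> p) q"
      unfolding N_def using assms by (intro compactly_embedded_of_subcritical)
  next
    assume emb: "compactly_embedded_Lq_loc (coulomb_sobolev \<alpha> p :: ('a \<Rightarrow> real) set) (coulomb_sobolev_norm \<alpha> p) q"
    show "1 / q > 1 / 2 - 1 / N \<or> 1 / q > 1 / p \<or> 1 / q > (2 + \<alpha>) / (2 * (2 * p + \<alpha>))"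
    proof (rule ccontr)
      assume "\<not> ?thesis"
      then have le: "1 / q \<le> 1 / 2 - 1 / N" "1 / q \<le> 1 / p" "1 / q \<le> (2 + \<alpha>) / (2 * (2 * p + \<alpha>))" by auto
      have "0 < 1 / q" using assms by simp
      then have "1 / N < 1 / 2" using le(1) by linarith
      then have N2: "N > 2" using N by (simp add: field_simps)
      have "\<exists>d. 0 < d \<and> d \<le> N \<and> 1 / q \<le> 1 / 2 - 1 / d \<and> 1 / q \<le> (d + \<alpha>) / (2 * p * d)"
      proof (cases "p * (N - 2) \<le> N + \<alpha>")
        case True
        have "1 / 2 - 1 / N = (p * (N - 2)) / (2 * p * N)" using N assms by (simp add: field_simps)
        also have "\<dots> \<le> (N + \<alpha>) / (2 * p * N)" using True N assms by (intro divide_right_mono) auto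
        finally show ?thesis using le(1) N by (intro exI[of _ N]) auto
      next
        case False
        then have p1: "p > 1"
        proof -
          have "N + \<alpha> < p * (N - 2)" using False by simp
          moreover have "1 * (N - 2) < N + \<alpha>" using assms(1) by simp
          ultimately have "1 * (N - 2) < p * (N - 2)" by (rule less_trans[rotated])
          then show ?thesis using N2 by (simp add: mult_less_cancel_right)
        qed
        \<comment> \<open>the value of \<open>d\<close> at which \<open>1 / 2 - 1 / d\<close> and \<open>(d + \<alpha>) / (2 * p * d)\<close> coincide\<close>
        define d where "d = (2 * p + \<alpha>) / (p - 1)"
        have d0: "d > 0" using p1 assms by (simp add: d_def)
        have dN: "d \<le> N" unfolding d_def using p1 False by (simp add: pos_divide_le_eq algebra_simps)
        have e1: "1 / 2 - 1 / d = (2 + \<alpha>) / (2 * (2 * p + \<alpha>))"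
          unfolding d_def using p1 assms by (simp add: divide_simps)
        have "d + \<alpha> = p * (2 + \<alpha>) / (p - 1)"
          unfolding d_def using p1 by (simp add: field_simps)
        then have e2: "(d + \<alpha>) / (2 * p * d) = (2 + \<alpha>) / (2 * (2 * p + \<alpha>))"
          unfolding d_def using p1 assms by (simp add: divide_simps)
        show ?thesis using d0 dN e1 e2 le(3) by (intro exI[of _ d]) auto
      qed
      then obtain d where d: "0 < d" "d \<le> N" "1 / q \<le> 1 / 2 - 1 / d" "1 / q \<le> (d + \<alpha>) / (2 * p * d)" by blast
      then show False
        using not_compactly_embedded_of_exponent[OF assms, of d] le(2) emb unfolding N_def by blast
    qed
  qed
qed

end
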